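(* Let $G$ be a six-dimensional almost abelian Lie group endowed with a left-invariant complex structure $J$ and a left-invariant nowhere vanishing closed $(3,0)$-form $\Psi$, and let $\omega_0$ be (the fundamental form of) a left-invariant locally conformally Kähler metric on $(G,J)$. Then, for all $\tau,\alpha'\in\mathbb{R}$, $\omega_0$ is a fixed point of the anomaly flow $$\tfrac{\partial}{\partial t}\big(\lVert\Psi\rVert_{\omega(t)}\,\omega(t)^2\big)=i\partial\overline\partial\omega(t)-\frac{\alpha'}{4}\operatorname{tr}(R^\tau_t\wedge R^\tau_t),\qquad \omega(0)=\omega_0,$$ namely $\omega(t)\equiv\omega_0$ is a constant solution of it.
   Context: A Lie group is almost abelian if its Lie algebra contains an abelian ideal of codimension one. A Hermitian metric $g$ on $(G,J)$ has fundamental form $\omega=g(J\cdot,\cdot)$ (identified with $g$); it is locally conformally Kähler (LCK) if there is an open cover $\{U_i\}$ and $f_i\in C^\infty(U_i)$ such that $e^{-f_i}g|_{U_i}$ is Kähler on $U_i$ for all $i$; equivalently, there is a closed 1-form $\alpha$ with $d\omega=\alpha\wedge\omega$. The norm of $\Psi$ is defined by $i\Psi\wedge\overline\Psi=\lVert\Psi\rVert_\omega^2\,\omega^3$. For $\tau\in\mathbb{R}$, $R^\tau_t$ is the curvature of the canonical Hermitian (Gauduchon) connection $\nabla^\tau$ of $\omega(t)$, where $g(\nabla^\tau_XY,Z)=g(\nabla^g_XY,Z)+\frac{1-\tau}{4}T(X,Y,Z)+\frac{1+\tau}{4}C(X,Y,Z)$, $\nabla^g$ is the Levi-Civita connection,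 $T(X,Y,Z)=d\omega(JX,JY,JZ)$, $C(X,Y,Z)=-d\omega(JX,Y,Z)$. The curvature 2-forms $\Omega^i_j$ with respect to a $g$-orthonormal frame $\{e_i\}$ are given by $R^\tau(X,Y)=\Omega^i_j(X,Y)\,e^j\otimes e_i$, and $\operatorname{tr}(R^\tau\wedge R^\tau)=\sum_{i<j}\Omega^i_j\wedge\Omega^i_j$. *)

theory Defs
  imports "HOL-Analysis.Analysis" "HOL-Algebra.Group" "HOL-Library.Function_Algebras"
    "HOL-Combinatorics.Permutations"
begin

section \<open>Lie groups\<close>

text \<open>\<open>S\<close> is meant to be open. Since the spaces below are finite-dimensional, continuity of all
  iterated directional derivatives is the usual notion of a \<open>C\<^sup>k\<close> map.\<close>

fun C_k_on :: "nat \<Rightarrow> 'a::real_normed_vector set \<Rightarrow> ('a \<Rightarrow> 'b::real_normed_vector) \<Rightarrow> bool" where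
  "C_k_on 0 S f \<longleftrightarrow> continuous_on S f"
| "C_k_on (Suc k) S f \<longleftrightarrow> (\<forall>x\<in>S. f differentiable (at x)) \<and>
     (\<forall>v. C_k_on k S (\<lambda>x. frechet_derivative f (at x) v))"

definition smooth_on :: "'a::real_normed_vector set \<Rightarrow> ('a \<Rightarrow> 'b::real_normed_vector) \<Rightarrow> bool" where
  "smooth_on S f \<longleftrightarrow> (\<forall>k. C_k_on k S f)"

record ('g, 'n::finite) lie_group_data = "'g monoid" +
  atlas :: "('g set \<times> ('g \<Rightarrow> real ^ 'n)) set"

definition smooth_atlas :: "('g::topological_space set \<times> ('g \<Rightarrow> real ^ 'n)) set \<Rightarrow> bool" where
  "smooth_atlas A \<longleftrightarrow>
     (\<Union>(U, \<phi>)\<in>A. U) = UNIV \<and>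
     (\<forall>(U, \<phi>)\<in>A. open U \<and> open (\<phi> ` U) \<and> homeomorphism U (\<phi> ` U) \<phi> (inv_into U \<phi>)) \<and>
     (\<forall>(U, \<phi>)\<in>A. \<forall>(V, \<psi>)\<in>A. smooth_on (\<phi> ` (U \<inter> V)) (\<psi> \<circ> inv_into U \<phi>))"

definition lie_group ::
  "('g::{t2_space, second_countable_topology}, 'n::finite) lie_group_data \<Rightarrow> bool" where
  "lie_group G \<longleftrightarrow>
     group G \<and> carrier G = UNIV \<and> smooth_atlas (atlas G) \<and>
     continuous_on UNIV (\<lambda>(a, b). a \<otimes>\<^bsub>G\<^esub> b) \<and>
     continuous_on UNIV (\<lambda>a. inv\<^bsub>G\<^esub> a) \<and>
     (\<forall>(U, \<phi>)\<in>atlas G. \<forall>(V, \<psi>)\<in>atlas G. \<forall>(W, \<zeta>)\<in>atlas G.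
        smooth_on {(x, y). x \<in> \<phi> ` U \<and> y \<in> \<psi> ` V \<and> inv_into U \<phi> x \<otimes>\<^bsub>G\<^esub> inv_into V \<psi> y \<in> W}
          (\<lambda>(x, y). \<zeta> (inv_into U \<phi> x \<otimes>\<^bsub>G\<^esub> inv_into V \<psi> y))) \<and>
     (\<forall>(U, \<phi>)\<in>atlas G. \<forall>(W, \<zeta>)\<in>atlas G.
        smooth_on {x \<in> \<phi> ` U. inv\<^bsub>G\<^esub> (inv_into U \<phi> x) \<in> W} (\<lambda>x. \<zeta> (inv\<^bsub>G\<^esub> (inv_into U \<phi> x))))"

definition smooth_fun :: "('g, 'n::finite) lie_group_data \<Rightarrow> ('g \<Rightarrow> 'b::real_normed_vector) \<Rightarrow> bool" where
  "smooth_fun G f \<longleftrightarrow> (\<forall>(U, \<phi>)\<in>atlas G. smooth_on (\<phi> ` U) (f \<circ> inv_into U \<phi>))"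

section \<open>Vector fields and the Lie algebra\<close>

text \<open>A vector field is the derivation of \<open>C\<^sup>\<infinity>(G)\<close> that it induces, extended by \<open>0\<close> to
  non-smooth functions in order to have a unique representative.\<close>

type_synonym 'g vf = "('g \<Rightarrow> real) \<Rightarrow> 'g \<Rightarrow> real"

definition vscale :: "real \<Rightarrow> 'g vf \<Rightarrow> 'g vf" where
  "vscale c X = (\<lambda>f p. c * X f p)"

definition fscale :: "('g \<Rightarrow> real) \<Rightarrow> 'g vf \<Rightarrow> 'g vf" where
  "fscale h X = (\<lambda>f p. h p * X f p)"

definition lie_bracket :: "'g vf \<Rightarrow> 'g vf \<Rightarrow> 'g vf" where
  "lie_bracket X Y = (\<lambda>f. X (Y f) - Y (X f))"

definition derivations :: "('g, 'n::finite) lie_group_data \<Rightarrow> 'g vf set" where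
  "derivations G = {X.
     (\<forall>f. smooth_fun G f \<longrightarrow> smooth_fun G (X f)) \<and>
     (\<forall>f. \<not> smooth_fun G f \<longrightarrow> X f = (\<lambda>p. 0)) \<and>
     (\<forall>f h. smooth_fun G f \<longrightarrow> smooth_fun G h \<longrightarrow>
        X (\<lambda>p. f p + h p) = (\<lambda>p. X f p + X h p) \<and>
        X (\<lambda>p. f p * h p) = (\<lambda>p. f p * X h p + h p * X f p)) \<and>
     (\<forall>c f. smooth_fun G f \<longrightarrow> X (\<lambda>p. c * f p) = (\<lambda>p. c * X f p))}"

text \<open>The pushforward \<open>(L\<^sub>a)\<^sub>* X\<close> along left translation by \<open>a\<close>.\<close>

definition push :: "('g, 'n::finite) lie_group_data \<Rightarrow> 'g \<Rightarrow> 'g vf \<Rightarrow> 'g vf" where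
  "push G a X = (\<lambda>f p. X (\<lambda>q. f (a \<otimes>\<^bsub>G\<^esub> q)) (inv\<^bsub>G\<^esub> a \<otimes>\<^bsub>G\<^esub> p))"

definition lie_algebra :: "('g, 'n::finite) lie_group_data \<Rightarrow> 'g vf set" where
  "lie_algebra G = {X \<in> derivations G. \<forall>a. push G a X = X}"

text \<open>The tangent bundle of a Lie group is trivialised by left-invariant vector fields, so the
  module of all smooth vector fields is generated over \<open>C\<^sup>\<infinity>(G)\<close> by the Lie algebra.\<close>

definition vector_fields :: "('g, 'n::finite) lie_group_data \<Rightarrow> 'g vf set" where
  "vector_fields G = {X. \<exists>(m::nat) h Y.
     (\<forall>i<m. smooth_fun G (h i) \<and> Y i \<in> lie_algebra G) \<and> X = (\<Sum>i<m. fscale (h i) (Y i))}"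

interpretation vf: vector_space vscale
  by unfold_locales (auto simp: vscale_def fun_eq_iff algebra_simps)

definition lie_group_dim :: "('g, 'n::finite) lie_group_data \<Rightarrow> nat" where
  "lie_group_dim G = vf.dim (lie_algebra G)"

definition almost_abelian :: "('g, 'n::finite) lie_group_data \<Rightarrow> bool" where
  "almost_abelian G \<longleftrightarrow> (\<exists>I. I \<subseteq> lie_algebra G \<and> vf.subspace I \<and>
     (\<forall>X\<in>lie_algebra G. \<forall>Y\<in>I. lie_bracket X Y \<in> I) \<and>
     (\<forall>X\<in>I. \<forall>Y\<in>I. lie_bracket X Y = 0) \<and>
     vf.dim I + 1 = vf.dim (lie_algebra G))"

section \<open>Differential forms\<close>

text \<open>A complex \<open>k\<close>-form is a \<open>C\<^sup>\<infinity>(G)\<close>-multilinear alternating map on lists of \<open>k\<close> vector fields;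
  its values on all other lists are irrelevant, so equality of \<open>k\<close>-forms is \<open>form_eq G k\<close>.\<close>

type_synonym 'g form = "'g vf list \<Rightarrow> 'g \<Rightarrow> complex"

definition vf_lists :: "('g, 'n::finite) lie_group_data \<Rightarrow> nat \<Rightarrow> 'g vf list set" where
  "vf_lists G k = {Xs. length Xs = k \<and> set Xs \<subseteq> vector_fields G}"

definition form_eq :: "('g, 'n::finite) lie_group_data \<Rightarrow> nat \<Rightarrow> 'g form \<Rightarrow> 'g form \<Rightarrow> bool" where
  "form_eq G k \<eta> \<theta> \<longleftrightarrow> (\<forall>Xs\<in>vf_lists G k. \<eta> Xs = \<theta> Xs)"

definition forms :: "('g, 'n::finite) lie_group_data \<Rightarrow> nat \<Rightarrow> 'g form set" where
  "forms G k = {\<eta>. \<forall>Xs\<in>vf_lists G k.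
     smooth_fun G (\<eta> Xs) \<and>
     (\<forall>i<k. \<forall>X\<in>vector_fields G. \<forall>Y\<in>vector_fields G. \<forall>h. smooth_fun G h \<longrightarrow>
        \<eta> (Xs[i := fscale h X + Y]) =
          (\<lambda>p. complex_of_real (h p) * \<eta> (Xs[i := X]) p + \<eta> (Xs[i := Y]) p)) \<and>
     (\<forall>i<k. \<forall>j<k. i \<noteq> j \<longrightarrow> Xs ! i = Xs ! j \<longrightarrow> \<eta> Xs = (\<lambda>p. 0))}"

definition real_form :: "('g, 'n::finite) lie_group_data \<Rightarrow> nat \<Rightarrow> 'g form \<Rightarrow> bool" where
  "real_form G k \<eta> \<longleftrightarrow> (\<forall>Xs\<in>vf_lists G k. \<forall>p. \<eta> Xs p \<in> \<real>)"

definition left_invariant_form :: "('g, 'n::finite) lie_group_data \<Rightarrow> nat \<Rightarrow> 'g form \<Rightarrow> bool" where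
  "left_invariant_form G k \<eta> \<longleftrightarrow>
     (\<forall>a. \<forall>Xs\<in>vf_lists G k. \<forall>p. \<eta> (map (push G a) Xs) (a \<otimes>\<^bsub>G\<^esub> p) = \<eta> Xs p)"

definition vf_apply :: "'g vf \<Rightarrow> ('g \<Rightarrow> complex) \<Rightarrow> 'g \<Rightarrow> complex" where
  "vf_apply X f = (\<lambda>p. Complex (X (\<lambda>q. Re (f q)) p) (X (\<lambda>q. Im (f q)) p))"

definition omit :: "nat \<Rightarrow> 'a list \<Rightarrow> 'a list" where
  "omit i xs = take i xs @ drop (Suc i) xs"

text \<open>Cartan's formula, in the normalisation \<open>d\<alpha>(X, Y) = X \<alpha>(Y) - Y \<alpha>(X) - \<alpha>([X, Y])\<close>.\<close>

definition ext_d :: "'g form \<Rightarrow> 'g form" where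
  "ext_d \<eta> = (\<lambda>Xs p.
     (\<Sum>i<length Xs. (-1) ^ i * vf_apply (Xs ! i) (\<eta> (omit i Xs)) p) +
     (\<Sum>j<length Xs. \<Sum>i<j.
        (-1) ^ (i + j) * \<eta> (lie_bracket (Xs ! i) (Xs ! j) # omit i (omit j Xs)) p))"

definition closed_form :: "('g, 'n::finite) lie_group_data \<Rightarrow> nat \<Rightarrow> 'g form \<Rightarrow> bool" where
  "closed_form G k \<eta> \<longleftrightarrow> form_eq G (Suc k) (ext_d \<eta>) 0"

text \<open>The wedge of a \<open>k\<close>-form and an \<open>l\<close>-form, normalised so that
  \<open>(\<alpha> \<and> \<beta>)(X, Y) = \<alpha>(X) \<beta>(Y) - \<alpha>(Y) \<beta>(X)\<close> for 1-forms.\<close>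

definition wedge :: "nat \<Rightarrow> nat \<Rightarrow> 'g form \<Rightarrow> 'g form \<Rightarrow> 'g form" where
  "wedge k l \<alpha> \<beta> = (\<lambda>Xs p.
     (\<Sum>\<sigma> | \<sigma> permutes {..<k + l}. of_int (sign \<sigma>) *
        \<alpha> (map (\<lambda>i. Xs ! \<sigma> i) [0..<k]) p * \<beta> (map (\<lambda>i. Xs ! \<sigma> i) [k..<k + l]) p)
     / (fact k * fact l))"

definition cnj_form :: "'g form \<Rightarrow> 'g form" where
  "cnj_form \<eta> = (\<lambda>Xs p. cnj (\<eta> Xs p))"

section \<open>Complex structures and types of forms\<close>

definition left_invariant_complex_structure ::
  "('g, 'n::finite) lie_group_data \<Rightarrow> ('g vf \<Rightarrow> 'g vf) \<Rightarrow> bool" where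
  "left_invariant_complex_structure G J \<longleftrightarrow>
     (\<forall>X\<in>vector_fields G. J X \<in> vector_fields G \<and> J (J X) = - X) \<and>
     (\<forall>X\<in>vector_fields G. \<forall>Y\<in>vector_fields G. \<forall>h. smooth_fun G h \<longrightarrow>
        J (fscale h X + Y) = fscale h (J X) + J Y) \<and>
     (\<forall>X\<in>vector_fields G. \<forall>Y\<in>vector_fields G.
        lie_bracket X Y + J (lie_bracket (J X) Y) + J (lie_bracket X (J Y))
          - lie_bracket (J X) (J Y) = 0) \<and>
     (\<forall>a. \<forall>X\<in>vector_fields G. J (push G a X) = push G a (J X))"

text \<open>The \<open>(p, q)\<close>-component of a \<open>(p + q)\<close>-form \<open>\<eta>\<close>: the sum, over the sets \<open>S\<close> of \<open>p\<close> slots, of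
  the complex-multilinear extension of \<open>\<eta>\<close> evaluated on \<open>X\<^sup>1\<^sup>,\<^sup>0 = (X - \<i> J X) / 2\<close> in the slots in
  \<open>S\<close> and on \<open>X\<^sup>0\<^sup>,\<^sup>1 = (X + \<i> J X) / 2\<close> in the remaining slots. Expanding the product, \<open>A\<close> is the set
  of slots in which the \<open>J X\<close> summand is chosen.\<close>

definition type_part :: "('g vf \<Rightarrow> 'g vf) \<Rightarrow> nat \<Rightarrow> nat \<Rightarrow> 'g form \<Rightarrow> 'g form" where
  "type_part J p q \<eta> = (\<lambda>Xs x.
     (\<Sum>S | S \<subseteq> {..<p + q} \<and> card S = p. \<Sum>A\<in>Pow {..<p + q}.
        (\<Prod>i\<in>A. if i \<in> S then - \<i> else \<i>) *
        \<eta> (map (\<lambda>i. if i \<in> A then J (Xs ! i) else Xs ! i) [0..<p + q]) x)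
     / 2 ^ (p + q))"

definition has_type ::
  "('g, 'n::finite) lie_group_data \<Rightarrow> ('g vf \<Rightarrow> 'g vf) \<Rightarrow> nat \<Rightarrow> nat \<Rightarrow> 'g form \<Rightarrow> bool" where
  "has_type G J p q \<eta> \<longleftrightarrow> \<eta> \<in> forms G (p + q) \<and> form_eq G (p + q) (type_part J p q \<eta>) \<eta>"

text \<open>The Dolbeault operators \<open>\<partial>\<close> and \<open>\<partial>\<close>-bar on forms of type \<open>(p, q)\<close>.\<close>

definition del :: "('g vf \<Rightarrow> 'g vf) \<Rightarrow> nat \<Rightarrow> nat \<Rightarrow> 'g form \<Rightarrow> 'g form" where
  "del J p q \<eta> = type_part J (Suc p) q (ext_d \<eta>)"

definition delbar :: "('g vf \<Rightarrow> 'g vf) \<Rightarrow> nat \<Rightarrow> nat \<Rightarrow> 'g form \<Rightarrow> 'g form" where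
  "delbar J p q \<eta> = type_part J p (Suc q) (ext_d \<eta>)"

definition nowhere_vanishing :: "('g, 'n::finite) lie_group_data \<Rightarrow> nat \<Rightarrow> 'g form \<Rightarrow> bool" where
  "nowhere_vanishing G k \<eta> \<longleftrightarrow> (\<forall>p. \<exists>Xs\<in>vf_lists G k. \<eta> Xs p \<noteq> 0)"

section \<open>Hermitian metrics\<close>

type_synonym 'g metric = "'g vf \<Rightarrow> 'g vf \<Rightarrow> 'g \<Rightarrow> real"

definition hermitian_metric ::
  "('g, 'n::finite) lie_group_data \<Rightarrow> ('g vf \<Rightarrow> 'g vf) \<Rightarrow> 'g metric \<Rightarrow> bool" where
  "hermitian_metric G J g \<longleftrightarrow>
     (\<forall>X\<in>vector_fields G. \<forall>Y\<in>vector_fields G.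
        smooth_fun G (g X Y) \<and> g X Y = g Y X \<and> g (J X) (J Y) = g X Y) \<and>
     (\<forall>X\<in>vector_fields G. \<forall>Y\<in>vector_fields G. \<forall>Z\<in>vector_fields G. \<forall>h. smooth_fun G h \<longrightarrow>
        g (fscale h X + Y) Z = (\<lambda>p. h p * g X Z p + g Y Z p)) \<and>
     (\<forall>X\<in>vector_fields G. \<forall>p. (\<exists>f. X f p \<noteq> 0) \<longrightarrow> g X X p > 0)"

definition left_invariant_metric :: "('g, 'n::finite) lie_group_data \<Rightarrow> 'g metric \<Rightarrow> bool" where
  "left_invariant_metric G g \<longleftrightarrow>
     (\<forall>a. \<forall>X\<in>vector_fields G. \<forall>Y\<in>vector_fields G. \<forall>p.
        g (push G a X) (push G a Y) (a \<otimes>\<^bsub>G\<^esub> p) = g X Y p)"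

definition fundamental_form :: "('g vf \<Rightarrow> 'g vf) \<Rightarrow> 'g metric \<Rightarrow> 'g form" where
  "fundamental_form J g = (\<lambda>Xs p. complex_of_real (g (J (Xs ! 0)) (Xs ! 1) p))"

definition lck_metric ::
  "('g, 'n::finite) lie_group_data \<Rightarrow> ('g vf \<Rightarrow> 'g vf) \<Rightarrow> 'g metric \<Rightarrow> bool" where
  "lck_metric G J g \<longleftrightarrow> hermitian_metric G J g \<and>
     (\<exists>\<alpha>\<in>forms G 1. real_form G 1 \<alpha> \<and> closed_form G 1 \<alpha> \<and>
        form_eq G 3 (ext_d (fundamental_form J g)) (wedge 1 2 \<alpha> (fundamental_form J g)))"

text \<open>The norm of a \<open>(3, 0)\<close>-form \<open>\<Psi>\<close>, determined by \<open>\<i> \<Psi> \<and> cnj \<Psi> = \<parallel>\<Psi>\<parallel>\<^sup>2 \<omega>\<^sup>3\<close>.\<close>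

definition form_norm ::
  "('g, 'n::finite) lie_group_data \<Rightarrow> ('g vf \<Rightarrow> 'g vf) \<Rightarrow> 'g metric \<Rightarrow> 'g form \<Rightarrow> 'g \<Rightarrow> real" where
  "form_norm G J g \<Psi> p = (let \<omega> = fundamental_form J g in
     THE r. r \<ge> 0 \<and> (\<forall>Xs\<in>vf_lists G 6.
       \<i> * wedge 3 3 \<Psi> (cnj_form \<Psi>) Xs p =
         complex_of_real (r\<^sup>2) * wedge 4 2 (wedge 2 2 \<omega> \<omega>) \<omega> Xs p))"

section \<open>Gauduchon connections and their curvature\<close>

type_synonym 'g connection = "'g vf \<Rightarrow> 'g vf \<Rightarrow> 'g vf"

definition affine_connection :: "('g, 'n::finite) lie_group_data \<Rightarrow> 'g connection \<Rightarrow> bool" where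
  "affine_connection G D \<longleftrightarrow>
     (\<forall>X\<in>vector_fields G. \<forall>Y\<in>vector_fields G. D X Y \<in> vector_fields G) \<and>
     (\<forall>X\<in>vector_fields G. \<forall>Y\<in>vector_fields G. \<forall>Z\<in>vector_fields G. \<forall>h. smooth_fun G h \<longrightarrow>
        D (fscale h X + Y) Z = fscale h (D X Z) + D Y Z \<and>
        D X (fscale h Y + Z) = fscale h (D X Y) + fscale (X h) Y + D X Z)"

definition levi_civita ::
  "('g, 'n::finite) lie_group_data \<Rightarrow> 'g metric \<Rightarrow> 'g connection \<Rightarrow> bool" where
  "levi_civita G g D \<longleftrightarrow> affine_connection G D \<and>
     (\<forall>X\<in>vector_fields G. \<forall>Y\<in>vector_fields G. D X Y - D Y X = lie_bracket X Y) \<and>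
     (\<forall>X\<in>vector_fields G. \<forall>Y\<in>vector_fields G. \<forall>Z\<in>vector_fields G.
        X (g Y Z) = (\<lambda>p. g (D X Y) Z p + g Y (D X Z) p))"

definition gauduchon_connection ::
  "('g, 'n::finite) lie_group_data \<Rightarrow> ('g vf \<Rightarrow> 'g vf) \<Rightarrow> 'g metric \<Rightarrow> real \<Rightarrow> 'g connection \<Rightarrow> bool"
  where
  "gauduchon_connection G J g \<tau> E \<longleftrightarrow> affine_connection G E \<and>
     (\<exists>D. levi_civita G g D \<and>
       (let d\<omega> = (\<lambda>X Y Z p. Re (ext_d (fundamental_form J g) [X, Y, Z] p));
            T = (\<lambda>X Y Z. d\<omega> (J X) (J Y) (J Z));
            C = (\<lambda>X Y Z p. - d\<omega> (J X) Y Z p)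
        in \<forall>X\<in>vector_fields G. \<forall>Y\<in>vector_fields G. \<forall>Z\<in>vector_fields G. \<forall>p.
             g (E X Y) Z p =
               g (D X Y) Z p + (1 - \<tau>) / 4 * T X Y Z p + (1 + \<tau>) / 4 * C X Y Z p))"

definition curvature :: "'g connection \<Rightarrow> 'g vf \<Rightarrow> 'g vf \<Rightarrow> 'g vf \<Rightarrow> 'g vf" where
  "curvature E X Y Z = E X (E Y Z) - E Y (E X Z) - E (lie_bracket X Y) Z"

text \<open>Every vector field on a Lie group being a combination of left-invariant ones, Gram-Schmidt
  provides a global orthonormal frame for any metric.\<close>

definition orthonormal_frame ::
  "('g, 'n::finite) lie_group_data \<Rightarrow> 'g metric \<Rightarrow> nat \<Rightarrow> (nat \<Rightarrow> 'g vf) \<Rightarrow> bool" where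
  "orthonormal_frame G g n e \<longleftrightarrow>
     (\<forall>i<n. e i \<in> vector_fields G) \<and>
     (\<forall>i<n. \<forall>j<n. g (e i) (e j) = (\<lambda>p. if i = j then 1 else 0)) \<and>
     (\<forall>X\<in>vector_fields G. \<exists>h. (\<forall>i<n. smooth_fun G (h i)) \<and> X = (\<Sum>i<n. fscale (h i) (e i)))"

text \<open>\<open>\<Omega>\<^sup>i\<^sub>j(X, Y)\<close> is the \<open>e\<^sub>i\<close>-component of \<open>R(X, Y) e\<^sub>j\<close>.\<close>

definition curvature_form ::
  "'g metric \<Rightarrow> 'g connection \<Rightarrow> (nat \<Rightarrow> 'g vf) \<Rightarrow> nat \<Rightarrow> nat \<Rightarrow> 'g form" where
  "curvature_form g E e i j =
     (\<lambda>Xs p. complex_of_real (g (curvature E (Xs ! 0) (Xs ! 1) (e j)) (e i) p))"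

definition tr_curvature_squared ::
  "'g metric \<Rightarrow> 'g connection \<Rightarrow> nat \<Rightarrow> (nat \<Rightarrow> 'g vf) \<Rightarrow> 'g form" where
  "tr_curvature_squared g E n e =
     (\<Sum>j<n. \<Sum>i<j. wedge 2 2 (curvature_form g E e i j) (curvature_form g E e i j))"

section \<open>The anomaly flow in real dimension six\<close>

text \<open>The 4-form \<open>tr (R\<^sup>\<tau> \<and> R\<^sup>\<tau>)\<close> depends neither on the orthonormal frame \<open>e\<close> nor on the
  choice of \<open>E\<close>, which is unique as a map on vector fields.\<close>

definition anomaly_flow_solution ::
  "('g, 'n::finite) lie_group_data \<Rightarrow> ('g vf \<Rightarrow> 'g vf) \<Rightarrow> 'g form \<Rightarrow> real \<Rightarrow> real \<Rightarrow> 'g metric \<Rightarrow>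
   real set \<Rightarrow> (real \<Rightarrow> 'g metric) \<Rightarrow> bool" where
  "anomaly_flow_solution G J \<Psi> \<tau> \<alpha>' g\<^sub>0 I g \<longleftrightarrow>
     0 \<in> I \<and> g 0 = g\<^sub>0 \<and>
     (\<forall>t\<in>I. hermitian_metric G J (g t) \<and>
        (\<exists>E e. gauduchon_connection G J (g t) \<tau> E \<and> orthonormal_frame G (g t) 6 e \<and>
          (\<forall>Xs\<in>vf_lists G 4. \<forall>p.
            ((\<lambda>s. complex_of_real (form_norm G J (g s) \<Psi> p) *
                  wedge 2 2 (fundamental_form J (g s)) (fundamental_form J (g s)) Xs p)
             has_vector_derivative
               (\<i> * del J 1 2 (delbar J 1 1 (fundamental_form J (g t))) Xs p -
                complex_of_real (\<alpha>' / 4) * tr_curvature_squared (g t) E 6 e Xs p))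
             (at t within I))))"

end

theory Submission
  imports Defs
begin

text \<open>
  Fix an orthonormal left-invariant frame \<open>e\<^sub>0, \<dots>, e\<^sub>5\<close> for which \<open>e\<^sub>5 = J e\<^sub>0\<close> is normal to the
  abelian ideal, \<open>J e\<^sub>1 = e\<^sub>2\<close> and \<open>J e\<^sub>3 = e\<^sub>4\<close>. Integrability of \<open>J\<close>, the LCK condition
  \<open>d\<omega> = \<alpha> \<and> \<omega>\<close> and \<open>d\<Psi> = 0\<close> successively force \<open>ad e\<^sub>5\<close> to preserve \<open>W = \<langle>e\<^sub>1, \<dots>, e\<^sub>4\<rangle>\<close> and
  commute with \<open>J\<close> there, to act as \<open>- s / 2 + (skew)\<close> on \<open>W\<close> and as a scalar on \<open>e\<^sub>0\<close>, where
  \<open>\<alpha> = s e\<^sup>5\<close>, and that scalar to be \<open>s\<close>.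

  Then \<open>\<partial>\<close>-bar of \<open>\<omega>\<close> is \<open>(s / 2) (e\<^sup>5 + \<i> e\<^sup>0) \<and> \<omega>\<close>, which is closed because
  \<open>de\<^sup>0 = - s e\<^sup>5 \<and> e\<^sup>0\<close>. The skew part of \<open>ad e\<^sub>5\<close> drops out of the curvature of the
  Gauduchon connections, and what remains satisfies \<open>tr (R \<and> R) = 0\<close> by a polynomial identity. So both
  terms on the right-hand side of the flow vanish at \<open>\<omega>\<^sub>0\<close>.
\<close>

section \<open>Smooth functions\<close>

text \<open>Equalities of forms and connections range over all vector fields, whereas left
  invariance gives information only about left-invariant ones. Component functions in the frame
  bridge the gap: their derivatives cancel in every tensorial expression, and what remains at a
  point is an identity between polynomials in real components. The solution predicate asks for some
  Gauduchon connection and some orthonormal frame, so both are exhibited: a connection is prescribed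
  by constant coefficients in the left-invariant frame. Being affine, metric or torsion-free then
  becomes a condition on the coefficients, and curvature becomes matrix algebra.\<close>

lemma C_k_on_cong:
  assumes "open S" "\<And>x. x \<in> S \<Longrightarrow> f x = h x"
  shows "C_k_on k S f \<longleftrightarrow> C_k_on k S h"
proof -
  have "C_k_on k S f" if "C_k_on k S h" "\<And>x. x \<in> S \<Longrightarrow> f x = h x" for f h :: "'a \<Rightarrow> 'b"
    using that
  proof (induction k arbitrary: f h)
    case 0
    then show ?case using continuous_on_cong[of S S f h] by simp
  next
    case (Suc k)
    \<comment> \<open>Derivatives are local and \<open>S\<close> is open, so agreement on
      \<open>S\<close> is enough. The sum and product rules below rely on this, as they identify
      \<open>frechet_derivative\<close> only at points of \<open>S\<close>.\<close>
    have der: "(f has_derivative frechet_derivative h (at x)) (at x)" if "x \<in> S" for x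
    proof -
      have "(h has_derivative frechet_derivative h (at x)) (at x)"
        using Suc.prems(1) that frechet_derivative_works by auto
      then show ?thesis
        by (rule has_derivative_transform_within_open[OF _ assms(1) that]) (simp add: Suc.prems(2))
    qed
    have eq: "frechet_derivative f (at x) v = frechet_derivative h (at x) v" if "x \<in> S" for x v
      using frechet_derivative_at[OF der[OF that]] by simp
    have "C_k_on k S (\<lambda>x. frechet_derivative h (at x) v)" for v
      using Suc.prems(1) by (simp only: C_k_on.simps(2))
    then have "C_k_on k S (\<lambda>x. frechet_derivative f (at x) v)" for v
      by (rule Suc.IH) (rule eq)
    moreover have "\<forall>x\<in>S. f differentiable (at x)"
      using der differentiableI by blast
    ultimately show ?case by simp
  qed
  from this[of h f] this[of f h] show ?thesis using assms(2) by auto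
qed

lemma C_k_on_SucD:
  assumes "C_k_on (Suc k) S f" shows "C_k_on k S f"
  using assms
proof (induction k arbitrary: f)
  case 0
  then show ?case
    by (auto intro!: continuous_at_imp_continuous_on differentiable_imp_continuous_within)
next
  case (Suc k)
  show ?case
    unfolding C_k_on.simps(2)[of k]
  proof (intro conjI allI)
    show "\<forall>x\<in>S. f differentiable (at x)" using Suc.prems by simp
    show "C_k_on k S (\<lambda>x. frechet_derivative f (at x) v)" for v
      by (rule Suc.IH) (use Suc.prems in \<open>simp only: C_k_on.simps(2)[of "Suc k"]\<close>)
  qed
qed

lemma C_k_on_const: "C_k_on k S (\<lambda>x. c)"
  by (induction k arbitrary: c) auto

lemma C_k_on_add:
  assumes "open S" "C_k_on k S f" "C_k_on k S h"
  shows "C_k_on k S (\<lambda>x. f x + h x)"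
  using assms(2,3)
proof (induction k arbitrary: f h)
  case 0
  then show ?case by (simp add: continuous_on_add)
next
  case (Suc k)
  have der: "((\<lambda>x. f x + h x) has_derivative
      (\<lambda>v. frechet_derivative f (at x) v + frechet_derivative h (at x) v)) (at x)"
    if "x \<in> S" for x
    using Suc.prems that by (intro has_derivative_add) (auto simp flip: frechet_derivative_works)
  have "C_k_on k S (\<lambda>x. frechet_derivative (\<lambda>x. f x + h x) (at x) v)" for v
  proof -
    have "C_k_on k S (\<lambda>x. frechet_derivative f (at x) v + frechet_derivative h (at x) v)"
      using Suc by auto
    moreover have "frechet_derivative (\<lambda>x. f x + h x) (at x) v
        = frechet_derivative f (at x) v + frechet_derivative h (at x) v" if "x \<in> S" for x
      using frechet_derivative_at[OF der[OF that]] by metis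
    ultimately show ?thesis
      by (subst C_k_on_cong[OF assms(1)])
  qed
  then show ?case using der by (auto intro: differentiableI)
qed

lemma C_k_on_mult:
  fixes f h :: "'a::real_normed_vector \<Rightarrow> real"
  assumes "open S" "C_k_on k S f" "C_k_on k S h"
  shows "C_k_on k S (\<lambda>x. f x * h x)"
  using assms(2,3)
proof (induction k arbitrary: f h)
  case 0
  then show ?case by (simp add: continuous_on_mult)
next
  case (Suc k)
  \<comment> \<open>The derivative of a product contains the undifferentiated factors, so these must
    be known to be of class \<open>k\<close> as well.\<close>
  have f: "C_k_on k S f" "C_k_on k S (\<lambda>x. frechet_derivative f (at x) v)"
    and h: "C_k_on k S h" "C_k_on k S (\<lambda>x. frechet_derivative h (at x) v)" for v
    using Suc.prems C_k_on_SucD by auto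
  have der: "((\<lambda>x. f x * h x) has_derivative
      (\<lambda>v. f x * frechet_derivative h (at x) v + frechet_derivative f (at x) v * h x)) (at x)"
    if "x \<in> S" for x
    using Suc.prems that by (intro has_derivative_mult) (auto simp flip: frechet_derivative_works)
  have "C_k_on k S (\<lambda>x. frechet_derivative (\<lambda>x. f x * h x) (at x) v)" for v
  proof -
    have "C_k_on k S (\<lambda>x. f x * frechet_derivative h (at x) v + frechet_derivative f (at x) v * h x)"
      using f h assms(1) by (intro C_k_on_add Suc.IH) auto
    moreover have "frechet_derivative (\<lambda>x. f x * h x) (at x) v
        = f x * frechet_derivative h (at x) v + frechet_derivative f (at x) v * h x" if "x \<in> S" for x
      using frechet_derivative_at[OF der[OF that]] by metis
    ultimately show ?thesis
      by (subst C_k_on_cong[OF assms(1)])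
  qed
  then show ?case using der by (auto intro: differentiableI)
qed

locale real_lie_group =
  fixes G :: "('g::{t2_space, second_countable_topology}, 'n::finite) lie_group_data"
  assumes lie_group: "lie_group G"
begin

lemma open_chart: "(U, \<phi>) \<in> atlas G \<Longrightarrow> open (\<phi> ` U)"
  using lie_group by (auto simp: lie_group_def smooth_atlas_def)

lemma smooth_const [simp]: "smooth_fun G (\<lambda>p. c)"
  by (auto simp: smooth_fun_def smooth_on_def o_def C_k_on_const)

lemma smooth_add: "smooth_fun G f \<Longrightarrow> smooth_fun G h \<Longrightarrow> smooth_fun G (\<lambda>p. f p + h p)"
  unfolding smooth_fun_def smooth_on_def o_def case_prod_beta
  using open_chart by (auto intro!: C_k_on_add)

lemma smooth_mult:
  fixes f h :: "'g \<Rightarrow> real"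
  shows "smooth_fun G f \<Longrightarrow> smooth_fun G h \<Longrightarrow> smooth_fun G (\<lambda>p. f p * h p)"
  unfolding smooth_fun_def smooth_on_def o_def case_prod_beta
  using open_chart by (auto intro!: C_k_on_mult)

lemma smooth_uminus:
  fixes f :: "'g \<Rightarrow> real"
  shows "smooth_fun G f \<Longrightarrow> smooth_fun G (\<lambda>p. - f p)"
  using smooth_mult[of "\<lambda>p. -1" f] by simp

lemma smooth_diff:
  fixes f h :: "'g \<Rightarrow> real"
  shows "smooth_fun G f \<Longrightarrow> smooth_fun G h \<Longrightarrow> smooth_fun G (\<lambda>p. f p - h p)"
  using smooth_add[of f "\<lambda>p. - h p"] smooth_uminus by simp

lemma smooth_sum:
  fixes f :: "'i \<Rightarrow> 'g \<Rightarrow> real"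
  shows "(\<And>i. i \<in> I \<Longrightarrow> smooth_fun G (f i)) \<Longrightarrow> smooth_fun G (\<lambda>p. \<Sum>i\<in>I. f i p)"
  by (induction I rule: infinite_finite_induct) (auto intro: smooth_add)

end

section \<open>The Lie algebra and the module of vector fields\<close>

lemma sum_vf_apply: "(\<Sum>i\<in>I. F i :: 'g vf) f p = (\<Sum>i\<in>I. F i f p)"
  by (induction I rule: infinite_finite_induct) auto

lemma vscale_eq_fscale: "vscale c X = fscale (\<lambda>p. c) X"
  by (simp add: vscale_def fscale_def)

lemma fscale_1 [simp]: "fscale (\<lambda>p. 1) X = X"
  by (simp add: fscale_def)

lemma fscale_fscale: "fscale a (fscale b X) = fscale (\<lambda>p. a p * b p) X"
  by (simp add: fscale_def mult.assoc)

lemma fscale_sum_right: "fscale a (\<Sum>i\<in>I. F i) = (\<Sum>i\<in>I. fscale a (F i))"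
  by (auto simp: fun_eq_iff fscale_def sum_vf_apply sum_distrib_left)

lemma lie_bracket_swap: "lie_bracket X Y = - lie_bracket Y X"
  by (auto simp: lie_bracket_def fun_eq_iff)

context real_lie_group
begin

section \<open>Derivations of the algebra of smooth functions\<close>

lemma derivation_smooth: "X \<in> derivations G \<Longrightarrow> smooth_fun G f \<Longrightarrow> smooth_fun G (X f)"
  by (simp add: derivations_def)

lemma derivation_nonsmooth: "X \<in> derivations G \<Longrightarrow> \<not> smooth_fun G f \<Longrightarrow> X f = (\<lambda>p. 0)"
  by (simp add: derivations_def)

lemma derivation_add:
  "X \<in> derivations G \<Longrightarrow> smooth_fun G f \<Longrightarrow> smooth_fun G h \<Longrightarrow>
     X (\<lambda>p. f p + h p) = (\<lambda>p. X f p + X h p)"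
  by (simp add: derivations_def)

lemma derivation_mult:
  "X \<in> derivations G \<Longrightarrow> smooth_fun G f \<Longrightarrow> smooth_fun G h \<Longrightarrow>
     X (\<lambda>p. f p * h p) = (\<lambda>p. f p * X h p + h p * X f p)"
  by (simp add: derivations_def)

lemma derivation_scale:
  "X \<in> derivations G \<Longrightarrow> smooth_fun G f \<Longrightarrow> X (\<lambda>p. c * f p) = (\<lambda>p. c * X f p)"
  unfolding derivations_def by blast

lemma derivation_const:
  assumes "X \<in> derivations G" shows "X (\<lambda>p. c) = (\<lambda>p. 0)"
proof -
  have "X (\<lambda>p. 1) = (\<lambda>p. 0)"
    using derivation_mult[OF assms, of "\<lambda>p. 1" "\<lambda>p. 1"] by (auto simp: fun_eq_iff)
  then show ?thesis using derivation_scale[OF assms, of "\<lambda>p. 1" c] by simp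
qed

lemma derivation_uminus:
  "X \<in> derivations G \<Longrightarrow> smooth_fun G f \<Longrightarrow> X (\<lambda>p. - f p) = (\<lambda>p. - X f p)"
  using derivation_scale[of X f "-1"] by simp

lemma derivation_diff:
  "X \<in> derivations G \<Longrightarrow> smooth_fun G f \<Longrightarrow> smooth_fun G h \<Longrightarrow>
     X (\<lambda>p. f p - h p) = (\<lambda>p. X f p - X h p)"
  using derivation_add[of X f "\<lambda>p. - h p"] by (simp add: derivation_uminus smooth_uminus)

lemma derivation_sum:
  assumes "X \<in> derivations G" "\<And>i. i \<in> I \<Longrightarrow> smooth_fun G (f i)"
  shows "X (\<lambda>p. \<Sum>i\<in>I. f i p) = (\<lambda>p. \<Sum>i\<in>I. X (f i) p)"
  using assms(2)
proof (induction I rule: infinite_finite_induct)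
  case (insert i I)
  then show ?case by (simp add: derivation_add[OF assms(1)] smooth_sum)
qed (simp_all add: derivation_const[OF assms(1)])

lemma derivationI:
  assumes "\<And>f. smooth_fun G f \<Longrightarrow> smooth_fun G (X f)"
    and "\<And>f. \<not> smooth_fun G f \<Longrightarrow> X f = (\<lambda>p. 0)"
    and "\<And>f h. smooth_fun G f \<Longrightarrow> smooth_fun G h \<Longrightarrow> X (\<lambda>p. f p + h p) = (\<lambda>p. X f p + X h p)"
    and "\<And>f h. smooth_fun G f \<Longrightarrow> smooth_fun G h \<Longrightarrow>
           X (\<lambda>p. f p * h p) = (\<lambda>p. f p * X h p + h p * X f p)"
    and "\<And>c f. smooth_fun G f \<Longrightarrow> X (\<lambda>p. c * f p) = (\<lambda>p. c * X f p)"
  shows "X \<in> derivations G"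
  using assms by (simp add: derivations_def)

lemma derivations_0: "0 \<in> derivations G"
  by (intro derivationI) (auto simp: fun_eq_iff zero_fun_def)

lemma derivations_plus:
  assumes X: "X \<in> derivations G" and Y: "Y \<in> derivations G" shows "X + Y \<in> derivations G"
proof (intro derivationI)
  show "smooth_fun G ((X + Y) f)" if "smooth_fun G f" for f
    using that by (simp add: plus_fun_def smooth_add derivation_smooth[OF X] derivation_smooth[OF Y])
qed (use X Y in \<open>simp_all add: plus_fun_def derivation_nonsmooth derivation_add[OF X]
    derivation_add[OF Y] derivation_mult[OF X] derivation_mult[OF Y] derivation_scale[OF X]
    derivation_scale[OF Y] derivation_const[OF X] derivation_const[OF Y] algebra_simps\<close>)

lemma derivations_fscale:
  assumes X: "X \<in> derivations G" and h: "smooth_fun G h" shows "fscale h X \<in> derivations G"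
proof (intro derivationI)
  show "smooth_fun G (fscale h X f)" if "smooth_fun G f" for f
    using that h by (simp add: fscale_def smooth_mult derivation_smooth[OF X])
qed (simp_all add: fscale_def derivation_nonsmooth[OF X] derivation_add[OF X]
    derivation_mult[OF X] derivation_scale[OF X] derivation_const[OF X] algebra_simps)

lemma derivations_sum:
  "(\<And>i. i \<in> I \<Longrightarrow> F i \<in> derivations G) \<Longrightarrow> (\<Sum>i\<in>I. F i) \<in> derivations G"
  by (induction I rule: infinite_finite_induct) (auto intro: derivations_0 derivations_plus)

lemma derivations_bracket:
  assumes X: "X \<in> derivations G" and Y: "Y \<in> derivations G"
  shows "lie_bracket X Y \<in> derivations G"
proof (intro derivationI)
  note [simp] = lie_bracket_def fun_diff_def derivation_smooth[OF X] derivation_smooth[OF Y]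
  show "smooth_fun G (lie_bracket X Y f)" if "smooth_fun G f" for f
    using that by (auto intro!: smooth_diff)
  \<comment> \<open>Each field sends a non-smooth \<open>f\<close> to the constant \<open>0\<close>,
    which the other field annihilates.\<close>
  show "lie_bracket X Y f = (\<lambda>p. 0)" if "\<not> smooth_fun G f" for f
    using that by (simp add: derivation_nonsmooth[OF X] derivation_nonsmooth[OF Y]
      derivation_const[OF X] derivation_const[OF Y])
  fix f h :: "'g \<Rightarrow> real" assume fh: "smooth_fun G f" "smooth_fun G h"
  then show "lie_bracket X Y (\<lambda>p. f p + h p) = (\<lambda>p. lie_bracket X Y f p + lie_bracket X Y h p)"
    by (simp add: derivation_add[OF X] derivation_add[OF Y] algebra_simps)
  have "X (Y (\<lambda>p. f p * h p)) = (\<lambda>p. f p * X (Y h) p + Y h p * X f p + (h p * X (Y f) p + Y f p * X h p))"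
    if "X \<in> derivations G" "Y \<in> derivations G" for X Y
    using fh by (simp add: derivation_mult[OF that(1)] derivation_mult[OF that(2)]
      derivation_add[OF that(1)] smooth_mult derivation_smooth[OF that(1)] derivation_smooth[OF that(2)])
  from this[OF X Y] this[OF Y X]
  show "lie_bracket X Y (\<lambda>p. f p * h p) = (\<lambda>p. f p * lie_bracket X Y h p + h p * lie_bracket X Y f p)"
    by (simp add: algebra_simps)
next
  fix c and f :: "'g \<Rightarrow> real" assume "smooth_fun G f"
  then show "lie_bracket X Y (\<lambda>p. c * f p) = (\<lambda>p. c * lie_bracket X Y f p)"
    by (simp add: lie_bracket_def fun_diff_def derivation_scale[OF X] derivation_scale[OF Y]
      derivation_smooth[OF X] derivation_smooth[OF Y]
      derivation_const[OF X] derivation_const[OF Y] algebra_simps)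
qed

section \<open>Left-invariant vector fields\<close>

lemma lie_algebra_derivation: "X \<in> lie_algebra G \<Longrightarrow> X \<in> derivations G"
  by (simp add: lie_algebra_def)

lemma lie_algebra_push: "X \<in> lie_algebra G \<Longrightarrow> push G a X = X"
  by (simp add: lie_algebra_def)

lemma lie_algebra_0: "0 \<in> lie_algebra G"
  by (auto simp: lie_algebra_def derivations_0 push_def fun_eq_iff)

lemma lie_algebra_plus: "X \<in> lie_algebra G \<Longrightarrow> Y \<in> lie_algebra G \<Longrightarrow> X + Y \<in> lie_algebra G"
  by (auto simp: lie_algebra_def derivations_plus push_def fun_eq_iff)

lemma lie_algebra_vscale: "X \<in> lie_algebra G \<Longrightarrow> vscale c X \<in> lie_algebra G"
  using derivations_fscale[of X "\<lambda>p. c"]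
  by (auto simp: lie_algebra_def push_def fun_eq_iff vscale_eq_fscale fscale_def)

lemma lie_algebra_subspace: "vf.subspace (lie_algebra G)"
  by (simp add: vf.subspace_def lie_algebra_0 lie_algebra_plus lie_algebra_vscale)

lemma group_G: "group G" and carrier_G: "carrier G = UNIV"
  using lie_group by (auto simp: lie_group_def)

lemma lie_algebra_bracket:
  assumes X: "X \<in> lie_algebra G" and Y: "Y \<in> lie_algebra G"
  shows "lie_bracket X Y \<in> lie_algebra G"
proof -
  interpret group G by (rule group_G)
  \<comment> \<open>Left invariance restated as commuting with pullback along left translations, a
    property that passes to compositions and hence to the bracket.\<close>
  have *: "Z (\<lambda>q. f (a \<otimes>\<^bsub>G\<^esub> q)) = (\<lambda>q. Z f (a \<otimes>\<^bsub>G\<^esub> q))" if "Z \<in> lie_algebra G" for Z f a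
  proof
    fix q
    have "Z f (a \<otimes>\<^bsub>G\<^esub> q) = push G a Z f (a \<otimes>\<^bsub>G\<^esub> q)" by (simp add: lie_algebra_push[OF that])
    also have "\<dots> = Z (\<lambda>q. f (a \<otimes>\<^bsub>G\<^esub> q)) q"
      using carrier_G by (simp add: push_def m_assoc[symmetric])
    finally show "Z (\<lambda>q. f (a \<otimes>\<^bsub>G\<^esub> q)) q = Z f (a \<otimes>\<^bsub>G\<^esub> q)" by simp
  qed
  have "push G a (lie_bracket X Y) = lie_bracket X Y" for a
    using carrier_G
    by (simp add: fun_eq_iff push_def lie_bracket_def *[OF X] *[OF Y] m_assoc[symmetric])
  then show ?thesis
    using derivations_bracket[OF X[THEN lie_algebra_derivation] Y[THEN lie_algebra_derivation]]
    by (simp add: lie_algebra_def)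
qed

section \<open>The module of smooth vector fields\<close>

lemma vector_fields_derivation:
  assumes "X \<in> vector_fields G" shows "X \<in> derivations G"
proof -
  obtain m h Y where "\<forall>i<(m::nat). smooth_fun G (h i) \<and> Y i \<in> lie_algebra G"
      "X = (\<Sum>i<m. fscale (h i) (Y i))"
    using assms unfolding vector_fields_def by blast
  then show ?thesis
    by (simp only:) (intro derivations_sum derivations_fscale lie_algebra_derivation, auto)
qed

lemma vector_fields_fscale_lie:
  assumes "smooth_fun G h" "Y \<in> lie_algebra G" shows "fscale h Y \<in> vector_fields G"
  unfolding vector_fields_def
  using assms by (intro CollectI exI[of _ "Suc 0"] exI[of _ "\<lambda>i. h"] exI[of _ "\<lambda>i. Y"]) auto

lemma lie_algebra_vector_fields: "Y \<in> lie_algebra G \<Longrightarrow> Y \<in> vector_fields G"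
  using vector_fields_fscale_lie[of "\<lambda>p. 1" Y] by simp

lemma vector_fields_0: "0 \<in> vector_fields G"
  by (rule lie_algebra_vector_fields[OF lie_algebra_0])

lemma vector_fields_plus:
  assumes "X \<in> vector_fields G" "Y \<in> vector_fields G" shows "X + Y \<in> vector_fields G"
proof -
  \<comment> \<open>Appending one generator at a time avoids reindexing the concatenation of two
    finite families.\<close>
  have step: "X + fscale k Z \<in> vector_fields G"
    if "X \<in> vector_fields G" "smooth_fun G k" "Z \<in> lie_algebra G" for X k Z
  proof -
    obtain m h Y where Y: "\<forall>i<(m::nat). smooth_fun G (h i) \<and> Y i \<in> lie_algebra G"
        "X = (\<Sum>i<m. fscale (h i) (Y i))"
      using \<open>X \<in> vector_fields G\<close> unfolding vector_fields_def by blast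
    show ?thesis unfolding vector_fields_def
      using Y that by (intro CollectI exI[of _ "Suc m"] exI[of _ "h(m := k)"] exI[of _ "Y(m := Z)"])
        (auto simp: less_Suc_eq)
  qed
  obtain m h Z where Z: "\<forall>i<(m::nat). smooth_fun G (h i) \<and> Z i \<in> lie_algebra G"
      "Y = (\<Sum>i<m. fscale (h i) (Z i))"
    using assms(2) unfolding vector_fields_def by blast
  have "X + (\<Sum>i<n. fscale (h i) (Z i)) \<in> vector_fields G" if "n \<le> m" for n
    using that
  proof (induction n)
    case 0
    then show ?case using assms(1) by simp
  next
    case (Suc n)
    have "X + (\<Sum>i<Suc n. fscale (h i) (Z i)) = (X + (\<Sum>i<n. fscale (h i) (Z i))) + fscale (h n) (Z n)"
      by (simp only: sum.lessThan_Suc add.assoc)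
    also have "\<dots> \<in> vector_fields G"
      by (intro step Suc.IH) (use Suc.prems Z(1) in simp_all)
    finally show ?case .
  qed
  then show ?thesis using Z(2) by simp
qed

lemma vector_fields_sum:
  "(\<And>i. i \<in> I \<Longrightarrow> F i \<in> vector_fields G) \<Longrightarrow> (\<Sum>i\<in>I. F i) \<in> vector_fields G"
  by (induction I rule: infinite_finite_induct) (auto intro: vector_fields_0 vector_fields_plus)

lemma vector_fields_fscale:
  assumes "X \<in> vector_fields G" "smooth_fun G k" shows "fscale k X \<in> vector_fields G"
proof -
  obtain m h Y where "\<forall>i<(m::nat). smooth_fun G (h i) \<and> Y i \<in> lie_algebra G"
      "X = (\<Sum>i<m. fscale (h i) (Y i))"
    using assms unfolding vector_fields_def by blast
  then show ?thesis using assms(2)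
    by (simp only: fscale_sum_right fscale_fscale)
      (intro vector_fields_sum vector_fields_fscale_lie smooth_mult, auto)
qed

lemma vector_fields_uminus: "X \<in> vector_fields G \<Longrightarrow> - X \<in> vector_fields G"
  using vector_fields_fscale[of X "\<lambda>p. -1"] by (simp add: fscale_def fun_Compl_def)

end

section \<open>Orthonormal frames adapted to the abelian ideal\<close>

locale invariant_hermitian = real_lie_group G
  for G :: "('g::{t2_space, second_countable_topology}, 'n::finite) lie_group_data" +
  fixes J :: "'g vf \<Rightarrow> 'g vf" and g :: "'g metric"
  assumes complex_structure: "left_invariant_complex_structure G J"
    and hermitian: "hermitian_metric G J g"
    and left_invariant: "left_invariant_metric G g"
begin

abbreviation "VF \<equiv> vector_fields G"
abbreviation "L \<equiv> lie_algebra G"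

lemma J_VF: "X \<in> VF \<Longrightarrow> J X \<in> VF"
  and J_J: "X \<in> VF \<Longrightarrow> J (J X) = - X"
  and J_linear: "X \<in> VF \<Longrightarrow> Y \<in> VF \<Longrightarrow> smooth_fun G h \<Longrightarrow> J (fscale h X + Y) = fscale h (J X) + J Y"
  and J_integrable: "X \<in> VF \<Longrightarrow> Y \<in> VF \<Longrightarrow> lie_bracket X Y + J (lie_bracket (J X) Y)
          + J (lie_bracket X (J Y)) - lie_bracket (J X) (J Y) = 0"
  and J_push: "X \<in> VF \<Longrightarrow> J (push G a X) = push G a (J X)"
  using complex_structure by (simp_all add: left_invariant_complex_structure_def)

lemma J_plus: "X \<in> VF \<Longrightarrow> Y \<in> VF \<Longrightarrow> J (X + Y) = J X + J Y"
  using J_linear[of X Y "\<lambda>p. 1"] by simp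

lemma J_0 [simp]: "J 0 = 0"
  using J_plus[OF vector_fields_0 vector_fields_0] by simp

lemma J_fscale: "X \<in> VF \<Longrightarrow> smooth_fun G h \<Longrightarrow> J (fscale h X) = fscale h (J X)"
  using J_linear[OF _ vector_fields_0, of X h] by simp

lemma J_uminus: "X \<in> VF \<Longrightarrow> J (- X) = - J X"
  using J_fscale[of X "\<lambda>p. -1"] by (simp add: fscale_def fun_Compl_def)

lemma L_VF: "X \<in> L \<Longrightarrow> X \<in> VF"
  by (rule lie_algebra_vector_fields)

lemma J_L:
  assumes "X \<in> L" shows "J X \<in> L"
  using vector_fields_derivation[OF J_VF[OF L_VF[OF assms]]] J_push[OF L_VF[OF assms]]
  by (simp add: lie_algebra_def lie_algebra_push[OF assms])

lemma g_smooth: "X \<in> VF \<Longrightarrow> Y \<in> VF \<Longrightarrow> smooth_fun G (g X Y)"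
  and g_sym: "X \<in> VF \<Longrightarrow> Y \<in> VF \<Longrightarrow> g X Y = g Y X"
  and g_J: "X \<in> VF \<Longrightarrow> Y \<in> VF \<Longrightarrow> g (J X) (J Y) = g X Y"
  and g_linear: "X \<in> VF \<Longrightarrow> Y \<in> VF \<Longrightarrow> Z \<in> VF \<Longrightarrow> smooth_fun G h \<Longrightarrow>
        g (fscale h X + Y) Z = (\<lambda>p. h p * g X Z p + g Y Z p)"
  and g_pos: "X \<in> VF \<Longrightarrow> X f p \<noteq> 0 \<Longrightarrow> g X X p > 0"
  using hermitian by (simp_all add: hermitian_metric_def) blast+

lemma g_plus: "X \<in> VF \<Longrightarrow> Y \<in> VF \<Longrightarrow> Z \<in> VF \<Longrightarrow> g (X + Y) Z p = g X Z p + g Y Z p"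
  using g_linear[of X Y Z "\<lambda>p. 1"] by simp

lemma g_0: "Z \<in> VF \<Longrightarrow> g 0 Z p = 0"
  using g_plus[OF vector_fields_0 vector_fields_0, of Z p] by simp

lemma g_fscale: "X \<in> VF \<Longrightarrow> Z \<in> VF \<Longrightarrow> smooth_fun G h \<Longrightarrow> g (fscale h X) Z p = h p * g X Z p"
  using g_linear[OF _ vector_fields_0, of X Z h] g_0[of Z p] by simp

lemma g_uminus: "X \<in> VF \<Longrightarrow> Z \<in> VF \<Longrightarrow> g (- X) Z p = - g X Z p"
  using g_plus[of X "- X" Z p] g_0[of Z p] vector_fields_uminus[of X] by simp

lemma g_sum:
  "(\<And>i. i \<in> I \<Longrightarrow> F i \<in> VF) \<Longrightarrow> Z \<in> VF \<Longrightarrow> g (\<Sum>i\<in>I. F i) Z p = (\<Sum>i\<in>I. g (F i) Z p)"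
  by (induction I rule: infinite_finite_induct) (auto simp: g_0 g_plus vector_fields_sum)

section \<open>The inner product on the Lie algebra\<close>

definition ip :: "'g vf \<Rightarrow> 'g vf \<Rightarrow> real" where
  "ip X Y = g X Y \<one>\<^bsub>G\<^esub>"

text \<open>Translation by \<open>p\<close> fixes left-invariant fields and carries the identity to
  \<open>p\<close>. Metric questions about \<open>L\<close> thereby become linear algebra with the
  single inner product \<open>ip\<close>.\<close>

lemma g_L:
  assumes "X \<in> L" "Y \<in> L" shows "g X Y = (\<lambda>p. ip X Y)"
proof
  interpret group G by (rule group_G)
  fix p
  have "g (push G p X) (push G p Y) (p \<otimes>\<^bsub>G\<^esub> \<one>\<^bsub>G\<^esub>) = g X Y \<one>\<^bsub>G\<^esub>"
    using left_invariant assms L_VF by (simp add: left_invariant_metric_def)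
  then show "g X Y p = ip X Y"
    using assms carrier_G by (simp add: lie_algebra_push ip_def)
qed

lemma ip_sym: "X \<in> L \<Longrightarrow> Y \<in> L \<Longrightarrow> ip X Y = ip Y X"
  using g_sym[of X Y] L_VF by (simp add: ip_def)

lemma ip_plus: "X \<in> L \<Longrightarrow> Y \<in> L \<Longrightarrow> Z \<in> L \<Longrightarrow> ip (X + Y) Z = ip X Z + ip Y Z"
  using g_plus L_VF by (simp add: ip_def)

lemma ip_vscale: "X \<in> L \<Longrightarrow> Z \<in> L \<Longrightarrow> ip (vscale c X) Z = c * ip X Z"
  using g_fscale L_VF by (simp add: ip_def vscale_eq_fscale)

lemma ip_0: "Z \<in> L \<Longrightarrow> ip 0 Z = 0"
  using g_0 L_VF by (simp add: ip_def)

lemma ip_uminus: "X \<in> L \<Longrightarrow> Z \<in> L \<Longrightarrow> ip (- X) Z = - ip X Z"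
  using g_uminus L_VF by (simp add: ip_def)

lemma ip_J: "X \<in> L \<Longrightarrow> Y \<in> L \<Longrightarrow> ip (J X) (J Y) = ip X Y"
  using g_J L_VF by (simp add: ip_def)

lemma ip_pos:
  assumes "X \<in> L" "X \<noteq> 0" shows "ip X X > 0"
proof -
  obtain f p where "X f p \<noteq> 0" using assms(2) by (auto simp: fun_eq_iff zero_fun_def)
  then show ?thesis
    using g_pos[OF L_VF[OF assms(1)]] g_L[OF assms(1) assms(1)] by metis
qed

lemma L_uminus: "X \<in> L \<Longrightarrow> - X \<in> L"
  using vf.subspace_neg[OF lie_algebra_subspace] by simp

lemma ip_J_left:
  assumes "X \<in> L" "Y \<in> L" shows "ip (J X) Y = - ip X (J Y)"
proof -
  have "ip (J X) Y = ip (J (J X)) (J Y)" using assms by (simp add: ip_J J_L)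
  also have "\<dots> = - ip X (J Y)" using assms by (simp add: J_J L_VF ip_uminus J_L)
  finally show ?thesis .
qed

lemma ip_J_self: "X \<in> L \<Longrightarrow> ip (J X) X = 0"
  using ip_J_left[of X X] ip_sym[of X "J X"] J_L by simp

section \<open>Gram-Schmidt and orthonormal bases\<close>

lemma span_L: "B \<subseteq> L \<Longrightarrow> vf.span B \<subseteq> L"
  by (rule vf.span_minimal[OF _ lie_algebra_subspace])

lemma ip_span:
  assumes "X \<in> L" "B \<subseteq> L" "\<And>b. b \<in> B \<Longrightarrow> ip b X = 0" "Y \<in> vf.span B"
  shows "ip Y X = 0"
proof -
  have "vf.subspace {Y \<in> L. ip Y X = 0}"
    using assms(1) by (auto simp: vf.subspace_def ip_plus ip_vscale ip_0 lie_algebra_0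
        lie_algebra_plus lie_algebra_vscale)
  then have "vf.span B \<subseteq> {Y \<in> L. ip Y X = 0}"
    using assms by (intro vf.span_minimal) auto
  then show ?thesis using assms(4) by auto
qed

text \<open>One Gram-Schmidt step: both \<open>X\<close> and the new vector \<open>b\<close> are
  projected off \<open>B\<close>, and then the component along the rest of \<open>b\<close> is
  removed from the rest of \<open>X\<close>. Independence of \<open>B\<close> is not
  assumed.\<close>

lemma orthogonal_projection:
  assumes "finite B" "B \<subseteq> L" "X \<in> L"
  shows "\<exists>P\<in>vf.span B. \<forall>b\<in>B. ip (X - P) b = 0"
  using assms
proof (induction B arbitrary: X)
  case empty
  then show ?case by (simp add: vf.span_zero)
next
  case (insert b B)
  then obtain P Q where P: "P \<in> vf.span B" "\<And>c. c \<in> B \<Longrightarrow> ip (X - P) c = 0"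
      and Q: "Q \<in> vf.span B" "\<And>c. c \<in> B \<Longrightarrow> ip (b - Q) c = 0"
    by (metis insert_subset)
  have L: "P \<in> L" "Q \<in> L" "b \<in> L" "B \<subseteq> L" "b - Q \<in> L" "X - P \<in> L"
    using P Q insert.prems span_L[of B] vf.subspace_diff[OF lie_algebra_subspace] by auto
  \<comment> \<open>If \<open>b\<close> lies in the span of \<open>B\<close>, then
    \<open>b - Q\<close> is \<open>0\<close> and there is nothing left to remove; the coefficient is
    then set to \<open>0\<close>.\<close>
  define t where "t = (if b - Q = 0 then 0 else ip (X - P) (b - Q) / ip (b - Q) (b - Q))"
  define R where "R = X - P - vscale t (b - Q)"
  have RL: "R \<in> L"
    unfolding R_def using L vf.subspace_diff[OF lie_algebra_subspace] lie_algebra_vscale by auto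
  have diff: "ip (Y - Z) W = ip Y W - ip Z W" if "Y \<in> L" "Z \<in> L" "W \<in> L" for Y Z W
    using ip_plus[of Y "- Z" W] ip_uminus[of Z W] L_uminus[of Z] that by simp
  have RB: "ip R c = 0" if "c \<in> B" for c
    unfolding R_def using that L P(2) Q(2)
    by (subst diff) (auto simp: ip_vscale lie_algebra_vscale)
  have "ip R (b - Q) = 0"
    using ip_pos[OF L(5)] L ip_0
    by (auto simp: R_def t_def diff lie_algebra_vscale ip_vscale ip_sym[of _ 0] lie_algebra_0)
  moreover have "ip Q R = 0"
  proof (rule ip_span[OF RL L(4) _ Q(1)])
    show "ip c R = 0" if "c \<in> B" for c
      using RB[OF that] ip_sym[of c R] RL L(4) that by auto
  qed
  ultimately have "ip R b = 0"
    using diff[of b Q R] ip_sym[of R "b - Q"] ip_sym[of R b] RL L by simp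
  moreover have "P + vscale t (b - Q) \<in> vf.span (insert b B)"
    using P(1) Q(1) vf.span_mono[of B "insert b B"]
    by (intro vf.span_add vf.span_scale vf.span_diff) (auto intro: vf.span_base)
  moreover have "R = X - (P + vscale t (b - Q))"
    by (simp only: R_def diff_diff_eq)
  ultimately show ?case using RB by (metis insert_iff)
qed

lemma orthogonal_unit:
  assumes "finite B" "B \<subseteq> L" "card B < vf.dim L"
  shows "\<exists>N\<in>L. ip N N = 1 \<and> (\<forall>b\<in>B. ip N b = 0)"
proof -
  have "\<not> L \<subseteq> vf.span B"
  proof
    assume "L \<subseteq> vf.span B"
    from vf.dim_le_card[OF this assms(1)] show False using assms(3) by simp
  qed
  then obtain X where X: "X \<in> L" "X \<notin> vf.span B" by auto
  then obtain P where P: "P \<in> vf.span B" "\<And>b. b \<in> B \<Longrightarrow> ip (X - P) b = 0"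
    using orthogonal_projection[OF assms(1,2)] by blast
  define Y where "Y = X - P"
  have YL: "Y \<in> L"
    unfolding Y_def using X P span_L[OF assms(2)] vf.subspace_diff[OF lie_algebra_subspace] by auto
  have "Y \<noteq> 0" using X(2) P(1) by (auto simp: Y_def)
  then have pos: "ip Y Y > 0" using ip_pos YL by simp
  have sc: "ip (vscale c Y) (vscale c Y) = c * (c * ip Y Y)" for c
    using YL by (simp add: ip_vscale lie_algebra_vscale ip_sym[of Y "vscale c Y"])
  show ?thesis
  proof (intro bexI[of _ "vscale (1 / sqrt (ip Y Y)) Y"] conjI ballI)
    show "ip (vscale (1 / sqrt (ip Y Y)) Y) (vscale (1 / sqrt (ip Y Y)) Y) = 1"
      unfolding sc using pos by (simp add: field_simps)
  qed (use YL P(2) assms(2) in \<open>auto simp: ip_vscale Y_def intro: lie_algebra_vscale\<close>)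
qed

lemma orthogonal_independent:
  assumes "finite B" "B \<subseteq> L" "\<And>b. b \<in> B \<Longrightarrow> b \<noteq> 0"
    "\<And>b c. b \<in> B \<Longrightarrow> c \<in> B \<Longrightarrow> b \<noteq> c \<Longrightarrow> ip b c = 0"
  shows "vf.independent B"
  using assms
proof (induction B)
  case (insert b B)
  have "b \<notin> vf.span B"
  proof
    assume "b \<in> vf.span B"
    moreover have "ip c b = 0" if "c \<in> B" for c
      using insert.prems(3)[of c b] insert.hyps(2) that by (metis insertCI)
    ultimately have "ip b b = 0"
      using insert.prems(1) ip_span[of b B b] by simp
    then show False using ip_pos[of b] insert.prems(1) insert.prems(2)[of b] by simp
  qed
  moreover have "vf.independent B"
    using insert.prems by (intro insert.IH) auto
  ultimately show ?case by (rule vf.independent_insertI)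
qed (simp add: vf.independent_empty)

lemma independent_spans:
  assumes "vf.independent B" "B \<subseteq> V" "card B = vf.dim V" "vf.dim V > 0"
  shows "V \<subseteq> vf.span B"
proof -
  obtain C where C: "B \<subseteq> C" "C \<subseteq> V" "vf.independent C" "V \<subseteq> vf.span C"
    using vf.maximal_independent_subset_extend[OF assms(2,1)] .
  then have "card C = card B" using vf.basis_card_eq_dim[of C V] assms(3) by simp
  \<comment> \<open>An infinite set has \<open>card\<close> equal to \<open>0\<close>, so positive
    dimension yields finiteness.\<close>
  moreover from this have "finite C" using assms(3,4) by (intro card_ge_0_finite) simp
  ultimately have "B = C" using card_subset_eq[of C B] C(1) by simp
  then show ?thesis using C(4) by simp
qed

text \<open>The unit normal \<open>N\<close> of the ideal becomes \<open>e 5\<close>, and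
  \<open>- J N\<close>, orthogonal to it because \<open>J\<close> is skew, becomes
  \<open>e 0\<close>. The orthogonal complement of these two is invariant under \<open>J\<close>, so
  a unit vector \<open>X\<close> in it brings along \<open>J X\<close>, and a unit vector
  \<open>Y\<close> orthogonal to both brings along \<open>J Y\<close>.\<close>

lemma adapted_frame_exists:
  assumes dimL: "vf.dim L = 6" and I: "I \<subseteq> L" "vf.subspace I" "vf.dim I + 1 = vf.dim L"
  shows "\<exists>e. (\<forall>i<6. e i \<in> L) \<and> (\<forall>i<6. \<forall>j<6. ip (e i) (e j) = (if i = j then 1 else 0)) \<and>
    L \<subseteq> vf.span (e ` {..<6::nat}) \<and> J (e 0) = e 5 \<and> J (e 1) = e 2 \<and> J (e 3) = e 4 \<and>
    (\<forall>i<5. e i \<in> I) \<and> (\<forall>X\<in>I. ip X (e 5) = 0)"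
proof -
  obtain B where B: "B \<subseteq> I" "vf.independent B" "I \<subseteq> vf.span B" "card B = 5"
    using vf.basis_exists[of I] I(3) dimL by auto
  then have finB: "finite B" by (intro card_ge_0_finite) simp
  then obtain N where N: "N \<in> L" "ip N N = 1" "\<And>b. b \<in> B \<Longrightarrow> ip N b = 0"
    using orthogonal_unit[OF finB subset_trans[OF B(1) I(1)]] B(4) dimL by auto
  \<comment> \<open>Otherwise \<open>X\<close> would extend the basis \<open>B\<close> of the ideal
    to six independent vectors, all orthogonal to \<open>N\<close>; they span \<open>L\<close>, so
    \<open>N\<close> would be orthogonal to itself.\<close>
  have in_I: "X \<in> I" if X: "X \<in> L" "ip X N = 0" for X
  proof (rule ccontr)
    assume "X \<notin> I"
    then have "X \<notin> vf.span B" using vf.span_minimal[OF B(1) I(2)] by auto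
    then have "vf.independent (insert X B)" "X \<notin> B"
      using B(2) vf.independent_insertI vf.span_base by auto
    then have "L \<subseteq> vf.span (insert X B)"
      using B I X finB dimL by (intro independent_spans) auto
    moreover have sub: "insert X B \<subseteq> L" using X(1) B(1) I(1) by auto
    moreover have "ip b N = 0" if "b \<in> insert X B" for b
    proof (cases "b = X")
      case False
      then show ?thesis using that N(3)[of b] ip_sym[of N b] N(1) sub by auto
    qed (use X(2) in simp)
    ultimately have "ip N N = 0" using ip_span[of N "insert X B" N] N(1) by blast
    then show False using N by simp
  qed
  define E where "E = - J N"
  have E: "E \<in> L" "J E = N" "ip E E = 1" "ip E N = 0" "ip N E = 0"
    using N ip_J_self[of N] ip_sym[of E N]
      ip_sym[of "J N" "- J N"]
    by (simp_all add: E_def L_uminus J_L J_uminus J_J J_VF L_VF ip_uminus ip_J)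
  have unit: "\<exists>X\<in>L. ip X X = 1 \<and> (\<forall>b\<in>set bs. ip X b = 0)" if "set bs \<subseteq> L" "length bs < 6" for bs
    using orthogonal_unit[of "set bs"] that card_length[of bs] dimL by simp
  obtain X where X: "X \<in> L" "ip X X = 1" "ip X E = 0" "ip X N = 0"
    using unit[of "[E, N]"] E(1) N(1) by auto
  obtain Y where Y: "Y \<in> L" "ip Y Y = 1" "ip Y E = 0" "ip Y N = 0" "ip Y X = 0" "ip Y (J X) = 0"
    using unit[of "[E, N, X, J X]"] E(1) N(1) X(1) J_L[of X] by auto
  have JN: "J N = - E" using J_J[of E] E L_VF by simp
  have J: "ip (J Z) (J Z) = 1" "ip (J Z) E = 0" "ip (J Z) N = 0" "ip (J Z) Z = 0"
    if "Z \<in> L" "ip Z Z = 1" "ip Z E = 0" "ip Z N = 0" for Z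
    using that E N JN ip_J_left[of Z] ip_J_self[of Z] ip_sym[of Z E] ip_uminus[of E Z] ip_sym[of Z "- E"]
    by (auto simp: ip_J L_uminus)
  define e where "e i = [E, X, J X, Y, J Y, N] ! i" for i :: nat
  have lt6: "i < 6 \<longleftrightarrow> i \<in> {0, 1, 2, 3, 4, 5::nat}" for i by auto
  have e: "e 0 = E" "e 1 = X" "e 2 = J X" "e 3 = Y" "e 4 = J Y" "e 5 = N" "e (Suc 0) = X" by (simp_all add: e_def)
  have eL: "e i \<in> L" if "i < 6" for i
    using that unfolding lt6 by (elim insertE emptyE; simp add: e E X Y N J_L)
  have JYX: "ip (J Y) X = 0" "ip (J Y) (J X) = 0"
    using ip_J_left[of Y X] ip_J[of Y X] X Y by auto
  have half: "ip (e i) (e j) = 0" if "j < i" "i < 6" for i j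
  proof -
    have N0: "ip N Z = 0" if "Z \<in> L" "ip Z N = 0" for Z using ip_sym[of N Z] that N by simp
    have "j < 6" using that by simp
    then show ?thesis
      using that unfolding lt6
      by (elim insertE emptyE; simp add: e E X Y N J[OF X] J[OF Y(1-4)] JYX N0 J_L)
  qed
  have on: "ip (e i) (e j) = (if i = j then 1 else 0)" if "i < 6" "j < 6" for i j
  proof (cases i j rule: linorder_cases)
    case equal
    then show ?thesis
      using that unfolding lt6 by (elim insertE emptyE; simp add: e E X Y N J[OF X] J[OF Y(1-4)])
  qed (use half that ip_sym[of "e i" "e j"] eL in auto)
  have inj: "inj_on e {..<6}"
    using on by (intro inj_onI) (metis lessThan_iff zero_neq_one)
  have "vf.independent (e ` {..<6})"
  proof (rule orthogonal_independent)
    show "b \<noteq> 0" if "b \<in> e ` {..<6}" for b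
      using that on ip_0 eL by (metis (full_types) imageE lessThan_iff zero_neq_one)
    show "ip b c = 0" if "b \<in> e ` {..<6}" "c \<in> e ` {..<6}" "b \<noteq> c" for b c
      using that on by auto
  qed (use eL in auto)
  then have "L \<subseteq> vf.span (e ` {..<6})"
    using eL dimL by (intro independent_spans) (auto simp: card_image[OF inj])
  moreover have "e i \<in> I" if "i < 5" for i
    using on[of i 5] that eL[of i] by (intro in_I) (auto simp: e(6))
  moreover have "ip X (e 5) = 0" if "X \<in> I" for X
  proof -
    have "ip b N = 0" if "b \<in> B" for b
      using N ip_sym[of N b] that B(1) I(1) by auto
    then show ?thesis
      using ip_span[OF N(1) subset_trans[OF B(1) I(1)]] B(3) that by (auto simp: e(6))
  qed
  ultimately show ?thesis
    using eL on by (intro exI[of _ e]) (simp add: e E)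
qed

end

section \<open>Components, brackets and connections in an orthonormal left-invariant frame\<close>

text \<open>For connection coefficients \<open>a\<close>, this is the \<open>(j, k)\<close> entry of
  the connection matrix in the direction with components \<open>x\<close>.\<close>

definition lincomb :: "(nat \<Rightarrow> nat \<Rightarrow> nat \<Rightarrow> real) \<Rightarrow> (nat \<Rightarrow> real) \<Rightarrow> nat \<Rightarrow> nat \<Rightarrow> real" where
  "lincomb a x j k = (\<Sum>i<6. x i * a i j k)"

lemma lincomb_add: "lincomb a (\<lambda>i. x i + y i) j k = lincomb a x j k + lincomb a y j k"
  and lincomb_diff: "lincomb a (\<lambda>i. x i - y i) j k = lincomb a x j k - lincomb a y j k"
  and lincomb_scale: "lincomb a (\<lambda>i. c * x i) j k = c * lincomb a x j k"
  by (simp_all add: lincomb_def sum.distrib sum_subtractf sum_distrib_left algebra_simps)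

locale orthonormal_invariant_frame = invariant_hermitian G J g
  for G :: "('g::{t2_space, second_countable_topology}, 'n::finite) lie_group_data" and J g +
  fixes e :: "nat \<Rightarrow> 'g vf"
  assumes e_L: "i < 6 \<Longrightarrow> e i \<in> L"
    and e_orthonormal: "i < 6 \<Longrightarrow> j < 6 \<Longrightarrow> ip (e i) (e j) = (if i = j then 1 else 0)"
    and e_spans: "L \<subseteq> vf.span (e ` {..<6})"
begin

definition cf :: "'g vf \<Rightarrow> nat \<Rightarrow> 'g \<Rightarrow> real" where
  "cf X i = g X (e i)"

abbreviation comp :: "'g vf \<Rightarrow> 'g \<Rightarrow> nat \<Rightarrow> real" where
  "comp X p \<equiv> \<lambda>i. cf X i p"

definition frame_sum :: "(nat \<Rightarrow> 'g \<Rightarrow> real) \<Rightarrow> 'g vf" where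
  "frame_sum h = (\<Sum>i<6. fscale (h i) (e i))"

definition str :: "nat \<Rightarrow> nat \<Rightarrow> nat \<Rightarrow> real" where
  "str i j k = ip (lie_bracket (e i) (e j)) (e k)"

definition bracket_comp :: "(nat \<Rightarrow> real) \<Rightarrow> (nat \<Rightarrow> real) \<Rightarrow> nat \<Rightarrow> real" where
  "bracket_comp x y k = (\<Sum>i<6. \<Sum>j<6. x i * y j * str i j k)"

lemma e_VF: "i < 6 \<Longrightarrow> e i \<in> VF"
  using e_L L_VF by simp

lemma cf_smooth: "X \<in> VF \<Longrightarrow> i < 6 \<Longrightarrow> smooth_fun G (cf X i)"
  by (simp add: cf_def g_smooth e_VF)

lemma cf_plus: "X \<in> VF \<Longrightarrow> Y \<in> VF \<Longrightarrow> i < 6 \<Longrightarrow> cf (X + Y) i = (\<lambda>p. cf X i p + cf Y i p)"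
  by (auto simp: cf_def g_plus e_VF)

lemma cf_fscale: "X \<in> VF \<Longrightarrow> smooth_fun G h \<Longrightarrow> i < 6 \<Longrightarrow> cf (fscale h X) i = (\<lambda>p. h p * cf X i p)"
  by (auto simp: cf_def g_fscale e_VF)

lemma cf_uminus: "X \<in> VF \<Longrightarrow> i < 6 \<Longrightarrow> cf (- X) i = (\<lambda>p. - cf X i p)"
  by (auto simp: cf_def g_uminus e_VF)

lemma cf_L: "X \<in> L \<Longrightarrow> i < 6 \<Longrightarrow> cf X i = (\<lambda>p. ip X (e i))"
  using g_L[OF _ e_L] by (simp add: cf_def)

lemma cf_e: "i < 6 \<Longrightarrow> j < 6 \<Longrightarrow> cf (e j) i = (\<lambda>p. if j = i then 1 else 0)"
  by (simp add: cf_L e_L e_orthonormal)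

lemma frame_sum_VF: "(\<And>i. i < 6 \<Longrightarrow> smooth_fun G (h i)) \<Longrightarrow> frame_sum h \<in> VF"
  unfolding frame_sum_def by (intro vector_fields_sum vector_fields_fscale e_VF) auto

lemma cf_frame_sum:
  assumes "\<And>i. i < 6 \<Longrightarrow> smooth_fun G (h i)" "k < 6"
  shows "cf (frame_sum h) k = h k"
proof
  fix p
  have "cf (frame_sum h) k p = (\<Sum>i<6. cf (fscale (h i) (e i)) k p)"
    unfolding cf_def frame_sum_def
    using assms by (intro g_sum vector_fields_fscale e_VF) auto
  also have "\<dots> = (\<Sum>i<6. h i p * (if i = k then 1 else 0))"
    using assms by (intro sum.cong) (auto simp: cf_fscale e_VF cf_e)
  also have "\<dots> = h k p" using assms(2) by (simp add: if_distrib cong: if_cong)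
  finally show "cf (frame_sum h) k p = h k p" .
qed

lemma L_expansion:
  assumes "X \<in> L" shows "X = frame_sum (\<lambda>i p. ip X (e i))"
proof -
  let ?S = "{X \<in> L. X = (\<Sum>i<6. vscale (ip X (e i)) (e i))}"
  have "vf.subspace ?S"
    unfolding vf.subspace_def
  proof (intro conjI ballI allI)
    show "0 \<in> ?S"
      by (simp add: lie_algebra_0 ip_0 e_L)
    show "X + Y \<in> ?S" if "X \<in> ?S" "Y \<in> ?S" for X Y
    proof -
      have "(\<Sum>i<6. vscale (ip (X + Y) (e i)) (e i))
          = (\<Sum>i<6. vscale (ip X (e i)) (e i)) + (\<Sum>i<6. vscale (ip Y (e i)) (e i))"
        unfolding sum.distrib[symmetric]
        using that by (intro sum.cong) (simp_all add: ip_plus e_L vf.scale_left_distrib)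
      also have "\<dots> = X + Y" using that by simp
      finally show ?thesis using that by (simp add: lie_algebra_plus)
    qed
    show "vscale c X \<in> ?S" if "X \<in> ?S" for c X
    proof -
      have "(\<Sum>i<6. vscale (ip (vscale c X) (e i)) (e i))
          = vscale c (\<Sum>i<6. vscale (ip X (e i)) (e i))"
        unfolding vf.scale_sum_right
        using that by (intro sum.cong) (simp_all add: ip_vscale e_L)
      also have "\<dots> = vscale c X" using that by simp
      finally show ?thesis using that by (simp add: lie_algebra_vscale)
    qed
  qed
  moreover have "e ` {..<6} \<subseteq> ?S"
  proof
    fix X assume "X \<in> e ` {..<6}"
    then obtain j where j: "j < 6" "X = e j" by auto
    have "(\<Sum>i<6. vscale (ip (e j) (e i)) (e i)) = (\<Sum>i<6. if j = i then e i else 0)"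
      using j by (intro sum.cong) (auto simp: e_orthonormal)
    then show "X \<in> ?S" using j e_L by simp
  qed
  ultimately have "vf.span (e ` {..<6}) \<subseteq> ?S" by (rule vf.span_minimal[rotated])
  then have "X \<in> ?S" using assms e_spans by blast
  then show ?thesis by (simp add: frame_sum_def vscale_eq_fscale)
qed

lemma VF_expansion:
  assumes "X \<in> VF" shows "X = frame_sum (cf X)"
proof -
  obtain m h Y where X: "\<forall>i<(m::nat). smooth_fun G (h i) \<and> Y i \<in> L"
      "X = (\<Sum>i<m. fscale (h i) (Y i))"
    using assms unfolding vector_fields_def by blast
  have Y: "Y j = frame_sum (cf (Y j))" if "j < m" for j
  proof -
    have "frame_sum (cf (Y j)) = frame_sum (\<lambda>i p. ip (Y j) (e i))"
      unfolding frame_sum_def using that X(1) by (intro sum.cong) (simp_all add: cf_L)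
    then show ?thesis using L_expansion[of "Y j"] that X(1) by simp
  qed
  have c: "cf X i = (\<lambda>p. \<Sum>j<m. h j p * cf (Y j) i p)" if "i < 6" for i
  proof
    fix p
    have "cf X i p = (\<Sum>j<m. g (fscale (h j) (Y j)) (e i) p)"
      unfolding cf_def X(2) using that X(1) L_VF
      by (intro g_sum e_VF vector_fields_fscale) auto
    then show "cf X i p = (\<Sum>j<m. h j p * cf (Y j) i p)"
      using that X(1) L_VF by (simp add: cf_def g_fscale e_VF)
  qed
  have "X = (\<Sum>j<m. fscale (h j) (frame_sum (cf (Y j))))"
    unfolding X(2) using Y by (intro sum.cong) auto
  also have "\<dots> = (\<Sum>j<m. \<Sum>i<6. fscale (\<lambda>p. h j p * cf (Y j) i p) (e i))"
    by (simp add: frame_sum_def fscale_sum_right fscale_fscale)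
  also have "\<dots> = (\<Sum>i<6. \<Sum>j<m. fscale (\<lambda>p. h j p * cf (Y j) i p) (e i))"
    by (rule sum.swap)
  also have "\<dots> = (\<Sum>i<6. fscale (cf X i) (e i))"
    by (intro sum.cong) (auto simp: c fscale_def fun_eq_iff sum_vf_apply sum_distrib_right)
  finally show ?thesis by (simp add: frame_sum_def)
qed

lemma VF_eqI:
  assumes "X \<in> VF" "Y \<in> VF" "\<And>i. i < 6 \<Longrightarrow> cf X i = cf Y i"
  shows "X = Y"
proof -
  have "frame_sum (cf X) = frame_sum (cf Y)"
    unfolding frame_sum_def using assms(3) by (intro sum.cong) auto
  then show ?thesis using VF_expansion[OF assms(1)] VF_expansion[OF assms(2)] by simp
qed

lemma frame_sum_apply: "frame_sum h f p = (\<Sum>i<6. h i p * e i f p)"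
  by (simp add: frame_sum_def sum_vf_apply fscale_def)

lemma VF_apply: "X \<in> VF \<Longrightarrow> X f p = (\<Sum>i<6. cf X i p * e i f p)"
  using VF_expansion[of X] frame_sum_apply[of "cf X" f p] by simp

lemma g_cf:
  assumes X: "X \<in> VF" and Y: "Y \<in> VF"
  shows "g X Y p = (\<Sum>i<6. cf X i p * cf Y i p)"
proof -
  have "g X Y p = g (frame_sum (cf X)) Y p" using VF_expansion[OF X] by simp
  also have "\<dots> = (\<Sum>i<6. g (fscale (cf X i) (e i)) Y p)"
    unfolding frame_sum_def
    by (intro g_sum Y vector_fields_fscale e_VF cf_smooth X) auto
  also have "\<dots> = (\<Sum>i<6. cf X i p * cf Y i p)"
    using X Y by (intro sum.cong) (simp_all add: g_fscale e_VF cf_smooth cf_def[of Y] g_sym[OF Y e_VF])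
  finally show ?thesis .
qed

text \<open>The Leibniz rule in the frame. The second-order terms are kept separate because only
  their antisymmetrisation is again a vector field.\<close>

lemma VF_bracket_apply:
  assumes X: "X \<in> VF" and Y: "Y \<in> VF" and f: "smooth_fun G f"
  shows "X (Y f) p = (\<Sum>j<6. X (cf Y j) p * e j f p)
           + (\<Sum>i<6. \<Sum>j<6. cf X i p * cf Y j p * e i (e j f) p)"
proof -
  have D: "X \<in> derivations G" using X by (rule vector_fields_derivation)
  have s: "smooth_fun G (e j f)" if "j < 6" for j
    using that f derivation_smooth[OF vector_fields_derivation[OF e_VF]] by simp
  have "Y f = (\<lambda>q. \<Sum>j<6. cf Y j q * e j f q)" using VF_apply[OF Y] by auto
  then have "X (Y f) p = (\<Sum>j<6. X (\<lambda>q. cf Y j q * e j f q) p)"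
    using derivation_sum[OF D, of "{..<6}" "\<lambda>j q. cf Y j q * e j f q"] s cf_smooth[OF Y]
    by (simp add: smooth_mult)
  also have "\<dots> = (\<Sum>j<6. cf Y j p * X (e j f) p + e j f p * X (cf Y j) p)"
    using s cf_smooth[OF Y] by (intro sum.cong) (simp_all add: derivation_mult[OF D])
  also have "\<dots> = (\<Sum>j<6. X (cf Y j) p * e j f p) + (\<Sum>j<6. \<Sum>i<6. cf X i p * cf Y j p * e i (e j f) p)"
    by (simp add: VF_apply[OF X, of "e _ f"] sum.distrib sum_distrib_left mult_ac)
  also have "(\<Sum>j<6. \<Sum>i<6. cf X i p * cf Y j p * e i (e j f) p)
      = (\<Sum>i<6. \<Sum>j<6. cf X i p * cf Y j p * e i (e j f) p)" by (rule sum.swap)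
  finally show ?thesis .
qed

lemma bracket_e: "i < 6 \<Longrightarrow> j < 6 \<Longrightarrow> lie_bracket (e i) (e j) = frame_sum (\<lambda>k p. str i j k)"
  using L_expansion[OF lie_algebra_bracket[OF e_L e_L]] by (simp add: str_def)

text \<open>Antisymmetrising the second-order terms produces brackets of frame fields, hence
  structure constants. The equality is one of functions on all arguments, so non-smooth
  \<open>f\<close>, where both sides are \<open>0\<close>, form a separate case.\<close>

lemma bracket_frame_sum:
  assumes X: "X \<in> VF" and Y: "Y \<in> VF"
  shows "lie_bracket X Y = frame_sum (\<lambda>k p. X (cf Y k) p - Y (cf X k) p + bracket_comp (comp X p) (comp Y p) k)"
    (is "_ = frame_sum ?h")
proof (intro ext)
  fix f p
  show "lie_bracket X Y f p = frame_sum ?h f p"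
  proof (cases "smooth_fun G f")
    case False
    have D: "X \<in> derivations G" "Y \<in> derivations G" using X Y vector_fields_derivation by auto
    have "e i f = (\<lambda>p. 0)" if "i < 6" for i
      using False that derivation_nonsmooth[OF vector_fields_derivation[OF e_VF]] by simp
    then show ?thesis
      using False by (simp add: frame_sum_apply lie_bracket_def derivation_nonsmooth[OF D(1)]
          derivation_nonsmooth[OF D(2)] derivation_const[OF D(1)] derivation_const[OF D(2)])
  next
    case True
    have br: "e i (e j f) p - e j (e i f) p = (\<Sum>k<6. str i j k * e k f p)" if "i < 6" "j < 6" for i j
      using bracket_e[OF that] frame_sum_apply[of "\<lambda>k p. str i j k" f p]
      by (simp add: lie_bracket_def fun_eq_iff)
    have "(\<Sum>i<6. \<Sum>j<6. cf X i p * cf Y j p * e i (e j f) p)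
        - (\<Sum>i<6. \<Sum>j<6. cf Y i p * cf X j p * e i (e j f) p)
        = (\<Sum>i<6. \<Sum>j<6. cf X i p * cf Y j p * e i (e j f) p)
        - (\<Sum>j<6. \<Sum>i<6. cf Y i p * cf X j p * e i (e j f) p)"
      using sum.swap[of "\<lambda>i j. cf Y i p * cf X j p * e i (e j f) p" "{..<6}" "{..<6}"] by simp
    also have "\<dots> = (\<Sum>i<6. \<Sum>j<6. cf X i p * cf Y j p * (e i (e j f) p - e j (e i f) p))"
      by (simp add: sum_subtractf algebra_simps)
    also have "\<dots> = (\<Sum>i<6. \<Sum>j<6. \<Sum>k<6. cf X i p * cf Y j p * str i j k * e k f p)"
      by (intro sum.cong refl) (simp add: br sum_distrib_left mult_ac)
    also have "\<dots> = (\<Sum>i<6. \<Sum>k<6. \<Sum>j<6. cf X i p * cf Y j p * str i j k * e k f p)"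
      by (intro sum.cong refl sum.swap)
    also have "\<dots> = (\<Sum>k<6. \<Sum>i<6. \<Sum>j<6. cf X i p * cf Y j p * str i j k * e k f p)"
      by (rule sum.swap)
    also have "\<dots> = (\<Sum>k<6. bracket_comp (comp X p) (comp Y p) k * e k f p)"
      by (simp add: bracket_comp_def sum_distrib_right)
    finally have *: "(\<Sum>i<6. \<Sum>j<6. cf X i p * cf Y j p * e i (e j f) p)
        - (\<Sum>i<6. \<Sum>j<6. cf Y i p * cf X j p * e i (e j f) p)
        = (\<Sum>k<6. bracket_comp (comp X p) (comp Y p) k * e k f p)" .
    have "lie_bracket X Y f p = X (Y f) p - Y (X f) p" by (simp add: lie_bracket_def)
    also have "\<dots> = (\<Sum>k<6. X (cf Y k) p * e k f p) - (\<Sum>k<6. Y (cf X k) p * e k f p)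
       + (\<Sum>k<6. bracket_comp (comp X p) (comp Y p) k * e k f p)"
      unfolding VF_bracket_apply[OF X Y True] VF_bracket_apply[OF Y X True] *[symmetric] by simp
    also have "\<dots> = frame_sum ?h f p"
      by (simp add: frame_sum_apply distrib_right left_diff_distrib sum.distrib sum_subtractf)
    finally show ?thesis .
  qed
qed

lemma VF_smooth: "X \<in> VF \<Longrightarrow> smooth_fun G f \<Longrightarrow> smooth_fun G (X f)"
  by (rule derivation_smooth[OF vector_fields_derivation])

lemma bracket_smooth:
  assumes "X \<in> VF" "Y \<in> VF" "k < 6"
  shows "smooth_fun G (\<lambda>p. X (cf Y k) p - Y (cf X k) p + bracket_comp (comp X p) (comp Y p) k)"
  unfolding bracket_comp_def
  by (intro smooth_add smooth_diff smooth_sum smooth_mult VF_smooth[OF assms(1)] VF_smooth[OF assms(2)]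
      cf_smooth[OF assms(1)] cf_smooth[OF assms(2)] smooth_const assms(3)) auto

lemma bracket_VF: "X \<in> VF \<Longrightarrow> Y \<in> VF \<Longrightarrow> lie_bracket X Y \<in> VF"
  by (simp add: bracket_frame_sum frame_sum_VF bracket_smooth)

lemma cf_bracket:
  "X \<in> VF \<Longrightarrow> Y \<in> VF \<Longrightarrow> k < 6 \<Longrightarrow> cf (lie_bracket X Y) k p
     = X (cf Y k) p - Y (cf X k) p + bracket_comp (comp X p) (comp Y p) k"
  by (simp add: bracket_frame_sum cf_frame_sum bracket_smooth)

section \<open>Connections with constant coefficients\<close>

lemma VF_minus: "X \<in> VF \<Longrightarrow> Y \<in> VF \<Longrightarrow> X - Y \<in> VF"
  using vector_fields_plus[of X "- Y"] vector_fields_uminus[of Y] by simp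

lemma cf_minus: "X \<in> VF \<Longrightarrow> Y \<in> VF \<Longrightarrow> i < 6 \<Longrightarrow> cf (X - Y) i = (\<lambda>p. cf X i p - cf Y i p)"
  using cf_plus[of X "- Y"] cf_uminus[of Y] vector_fields_uminus[of Y] by simp

text \<open>The coefficients have the meaning \<open>a i j k = g (conn a (e i) (e j)) (e k)\<close>:
  on frame fields the derivative term disappears.\<close>

definition conn :: "(nat \<Rightarrow> nat \<Rightarrow> nat \<Rightarrow> real) \<Rightarrow> 'g connection" where
  "conn a X Y = frame_sum (\<lambda>k p. X (cf Y k) p + (\<Sum>j<6. lincomb a (comp X p) j k * cf Y j p))"

lemma conn_smooth:
  assumes "X \<in> VF" "Y \<in> VF" "k < 6"
  shows "smooth_fun G (\<lambda>p. X (cf Y k) p + (\<Sum>j<6. lincomb a (comp X p) j k * cf Y j p))"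
  unfolding lincomb_def
  by (intro smooth_add smooth_sum smooth_mult VF_smooth[OF assms(1)] cf_smooth[OF assms(1)]
      cf_smooth[OF assms(2)] smooth_const assms(3)) auto

lemma conn_VF: "X \<in> VF \<Longrightarrow> Y \<in> VF \<Longrightarrow> conn a X Y \<in> VF"
  by (simp add: conn_def frame_sum_VF conn_smooth)

lemma cf_conn: "X \<in> VF \<Longrightarrow> Y \<in> VF \<Longrightarrow> k < 6 \<Longrightarrow> cf (conn a X Y) k
     = (\<lambda>p. X (cf Y k) p + (\<Sum>j<6. lincomb a (comp X p) j k * cf Y j p))"
  by (simp add: conn_def cf_frame_sum conn_smooth)

lemma conn_affine: "affine_connection G (conn a)"
proof -
  have 1: "conn a (fscale h X + Y) Z = fscale h (conn a X Z) + conn a Y Z"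
    if V: "X \<in> VF" "Y \<in> VF" "Z \<in> VF" "smooth_fun G h" for X Y Z h
  proof (rule VF_eqI)
    fix i :: nat assume i: "i < 6"
    have hX: "fscale h X \<in> VF" and hXY: "fscale h X + Y \<in> VF"
      using V vector_fields_fscale vector_fields_plus by auto
    have "(fscale h X + Y) f p = h p * X f p + Y f p" for f p by (simp add: fscale_def)
    moreover have "lincomb a (comp (fscale h X + Y) p) j i
        = h p * lincomb a (comp X p) j i + lincomb a (comp Y p) j i" for p j
    proof -
      have "lincomb a (comp (fscale h X + Y) p) j i = lincomb a (\<lambda>m. h p * cf X m p + cf Y m p) j i"
        unfolding lincomb_def using V hX by (intro sum.cong) (simp_all add: cf_plus cf_fscale)
      then show ?thesis by (simp add: lincomb_add lincomb_scale)
    qed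
    ultimately show "cf (conn a (fscale h X + Y) Z) i = cf (fscale h (conn a X Z) + conn a Y Z) i"
      using V i hX hXY
      by (simp add: cf_conn cf_plus cf_fscale conn_VF vector_fields_fscale sum.distrib
          sum_distrib_left algebra_simps)
  qed (use that in \<open>auto intro!: conn_VF vector_fields_plus vector_fields_fscale\<close>)
  have 2: "conn a X (fscale h Y + Z) = fscale h (conn a X Y) + fscale (X h) Y + conn a X Z"
    if V: "X \<in> VF" "Y \<in> VF" "Z \<in> VF" "smooth_fun G h" for X Y Z h
  proof (rule VF_eqI)
    fix i :: nat assume i: "i < 6"
    have D: "X \<in> derivations G" using V(1) by (rule vector_fields_derivation)
    have hY: "fscale h Y \<in> VF" "fscale h Y + Z \<in> VF" "fscale (X h) Y \<in> VF" "fscale h (conn a X Y) \<in> VF"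
      "fscale h (conn a X Y) + fscale (X h) Y \<in> VF"
      using V VF_smooth[OF V(1,4)] by (auto intro!: conn_VF vector_fields_plus vector_fields_fscale)
    have c: "cf (fscale h Y + Z) m = (\<lambda>p. h p * cf Y m p + cf Z m p)" if "m < 6" for m
      using that V hY by (simp add: cf_plus cf_fscale)
    have l: "cf (conn a X (fscale h Y + Z)) i = (\<lambda>p. X (cf (fscale h Y + Z) i) p
        + (\<Sum>j<6. lincomb a (comp X p) j i * (h p * cf Y j p + cf Z j p)))"
      using i by (simp add: cf_conn[OF V(1) hY(2)] c)
    have x: "X (cf (fscale h Y + Z) i) = (\<lambda>p. h p * X (cf Y i) p + cf Y i p * X h p + X (cf Z i) p)"
      using V i by (simp add: c derivation_add[OF D] derivation_mult[OF D] smooth_mult cf_smooth)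
    have r: "cf (fscale h (conn a X Y) + fscale (X h) Y + conn a X Z) i
        = (\<lambda>p. h p * cf (conn a X Y) i p + X h p * cf Y i p + cf (conn a X Z) i p)"
      using V i hY by (simp add: cf_plus cf_fscale conn_VF VF_smooth[OF V(1,4)])
    show "cf (conn a X (fscale h Y + Z)) i
        = cf (fscale h (conn a X Y) + fscale (X h) Y + conn a X Z) i"
      unfolding l x r using V i by (simp add: cf_conn sum.distrib sum_distrib_left algebra_simps)
  qed (use that VF_smooth[OF that(1,4)] in \<open>auto intro!: conn_VF vector_fields_plus vector_fields_fscale\<close>)
  show ?thesis unfolding affine_connection_def using 1 2 conn_VF by simp
qed

text \<open>The derivative terms are the Leibniz rule for the sum of products of components; the
  coefficient terms cancel by skewness in the last two indices.\<close>

lemma conn_metric: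
  assumes a: "\<And>i j k. i < 6 \<Longrightarrow> j < 6 \<Longrightarrow> k < 6 \<Longrightarrow> a i j k = - a i k j"
    and V: "X \<in> VF" "Y \<in> VF" "Z \<in> VF"
  shows "X (g Y Z) = (\<lambda>p. g (conn a X Y) Z p + g Y (conn a X Z) p)"
proof
  fix p
  have D: "X \<in> derivations G" using V(1) by (rule vector_fields_derivation)
  have skew: "lincomb a x j k = - lincomb a x k j" if "j < 6" "k < 6" for x j k
    unfolding lincomb_def sum_negf[symmetric] using that by (intro sum.cong) (auto simp: a[of _ j k])
  have "g Y Z = (\<lambda>q. \<Sum>k<6. cf Y k q * cf Z k q)" using g_cf V by auto
  then have "X (g Y Z) p = (\<Sum>k<6. cf Y k p * X (cf Z k) p + cf Z k p * X (cf Y k) p)"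
    using V derivation_sum[OF D, of "{..<6}" "\<lambda>k q. cf Y k q * cf Z k q"]
    by (simp add: derivation_mult[OF D] smooth_mult cf_smooth)
  moreover have "(\<Sum>k<6. \<Sum>j<6. lincomb a (comp X p) j k * cf Y j p * cf Z k p)
     = - (\<Sum>k<6. \<Sum>j<6. lincomb a (comp X p) j k * cf Z j p * cf Y k p)" (is "?l = - ?r")
  proof -
    have "?l = (\<Sum>k<6. \<Sum>j<6. lincomb a (comp X p) k j * cf Y k p * cf Z j p)"
      by (rule sum.swap)
    also have "\<dots> = (\<Sum>k<6. \<Sum>j<6. - (lincomb a (comp X p) j k * cf Z j p * cf Y k p))"
      by (intro sum.cong refl) (subst skew, auto)
    finally show ?thesis by (simp add: sum_negf)
  qed
  ultimately show "X (g Y Z) p = g (conn a X Y) Z p + g Y (conn a X Z) p"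
    using V by (simp add: g_cf conn_VF cf_conn sum.distrib sum_distrib_left sum_distrib_right algebra_simps)
qed

text \<open>The derivative terms of the torsion are exactly those of the Lie bracket, which leaves a
  comparison of coefficients with structure constants.\<close>

lemma conn_levi_civita:
  assumes a: "\<And>i j k. i < 6 \<Longrightarrow> j < 6 \<Longrightarrow> k < 6 \<Longrightarrow> a i j k = - a i k j"
    and t: "\<And>i j k. i < 6 \<Longrightarrow> j < 6 \<Longrightarrow> k < 6 \<Longrightarrow> a i j k - a j i k = str i j k"
  shows "levi_civita G g (conn a)"
proof -
  have "conn a X Y - conn a Y X = lie_bracket X Y" if V: "X \<in> VF" "Y \<in> VF" for X Y
  proof (rule VF_eqI)
    fix k :: nat assume k: "k < 6"
    have "(\<Sum>j<6. lincomb a x j k * y j) - (\<Sum>j<6. lincomb a y j k * x j) = bracket_comp x y k" for x y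
    proof -
      have "(\<Sum>j<6. lincomb a x j k * y j) = (\<Sum>j<6. \<Sum>i<6. x i * y j * a i j k)"
        by (simp add: lincomb_def sum_distrib_left mult_ac)
      also have "\<dots> = (\<Sum>i<6. \<Sum>j<6. x i * y j * a i j k)" by (rule sum.swap)
      finally have 1: "(\<Sum>j<6. lincomb a x j k * y j) = (\<Sum>i<6. \<Sum>j<6. x i * y j * a i j k)" .
      have 2: "(\<Sum>j<6. lincomb a y j k * x j) = (\<Sum>i<6. \<Sum>j<6. x i * y j * a j i k)"
        by (simp add: lincomb_def sum_distrib_left mult_ac)
      have "(\<Sum>i<6. \<Sum>j<6. x i * y j * a i j k) - (\<Sum>i<6. \<Sum>j<6. x i * y j * a j i k)
          = (\<Sum>i<6. \<Sum>j<6. x i * y j * (a i j k - a j i k))"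
        by (simp add: sum_subtractf right_diff_distrib)
      also have "\<dots> = bracket_comp x y k"
        unfolding bracket_comp_def using k by (intro sum.cong refl) (simp add: t)
      finally show ?thesis unfolding 1 2 .
    qed
    note this[of "comp X _" "comp Y _"]
    then show "cf (conn a X Y - conn a Y X) k = cf (lie_bracket X Y) k"
      using V k by (auto simp: fun_eq_iff cf_minus conn_VF cf_conn cf_bracket algebra_simps)
  qed (use that in \<open>auto intro: VF_minus conn_VF bracket_VF\<close>)
  then show ?thesis unfolding levi_civita_def using conn_affine conn_metric[of a, OF a] by blast
qed

text \<open>The derivatives of the components of \<open>X\<close> and \<open>Y\<close> cancel
  against the derivative part of \<open>[X, Y]\<close>. Since the coefficients are constant, what
  remains is the commutator of the connection matrices minus the matrix of the algebraic bracket, a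
  function of the components at \<open>p\<close> alone.\<close>

lemma conn_curvature:
  assumes V: "X \<in> VF" "Y \<in> VF" and j: "j < 6" and k: "k < 6"
  shows "g (curvature (conn a) X Y (e j)) (e k) p =
    (\<Sum>l<6. lincomb a (comp Y p) j l * lincomb a (comp X p) l k
          - lincomb a (comp X p) j l * lincomb a (comp Y p) l k)
    - lincomb a (bracket_comp (comp X p) (comp Y p)) j k"
proof -
  have E: "cf (conn a Z (e j)) l = (\<lambda>p. lincomb a (comp Z p) j l)" if "Z \<in> VF" "l < 6" for Z l
  proof -
    have "Z (cf (e j) l) = (\<lambda>p. 0)"
      using that j derivation_const[OF vector_fields_derivation[OF that(1)]] by (simp add: cf_e)
    moreover have "(\<Sum>m<6. lincomb a (comp Z p) m l * cf (e j) m p) = lincomb a (comp Z p) j l" for p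
    proof -
      have "(\<Sum>m<6. lincomb a (comp Z p) m l * cf (e j) m p)
          = (\<Sum>m<6. if j = m then lincomb a (comp Z p) m l else 0)"
        using j by (intro sum.cong) (auto simp: cf_e)
      then show ?thesis using j by simp
    qed
    ultimately show ?thesis using that j by (simp add: cf_conn e_VF)
  qed
  have EE: "cf (conn a Z (conn a W (e j))) k p = lincomb a (\<lambda>i. Z (cf W i) p) j k
      + (\<Sum>l<6. lincomb a (comp Z p) l k * lincomb a (comp W p) j l)" if "Z \<in> VF" "W \<in> VF" for Z W
  proof -
    have D: "Z \<in> derivations G" using that(1) by (rule vector_fields_derivation)
    have "Z (\<lambda>p. lincomb a (comp W p) j k) p = (\<Sum>i<6. Z (\<lambda>p. a i j k * cf W i p) p)"
      unfolding lincomb_def using that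
      by (subst derivation_sum[OF D]) (auto simp: cf_smooth smooth_mult mult.commute)
    also have "\<dots> = lincomb a (\<lambda>i. Z (cf W i) p) j k"
      unfolding lincomb_def using that
      by (intro sum.cong) (auto simp: derivation_scale[OF D] cf_smooth)
    finally show ?thesis
      using that k by (simp add: cf_conn[OF that(1) conn_VF[OF that(2) e_VF[OF j]] k] E)
  qed
  have B: "lincomb a (comp (lie_bracket X Y) p) j k = lincomb a (\<lambda>i. X (cf Y i) p) j k
      - lincomb a (\<lambda>i. Y (cf X i) p) j k + lincomb a (bracket_comp (comp X p) (comp Y p)) j k"
  proof -
    have "lincomb a (comp (lie_bracket X Y) p) j k
       = lincomb a (\<lambda>i. (X (cf Y i) p - Y (cf X i) p) + bracket_comp (comp X p) (comp Y p) i) j k"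
      unfolding lincomb_def using V by (intro sum.cong) (simp_all add: cf_bracket)
    then show ?thesis by (simp only: lincomb_add lincomb_diff)
  qed
  have VV: "conn a X (conn a Y (e j)) \<in> VF" "conn a Y (conn a X (e j)) \<in> VF"
      "conn a (lie_bracket X Y) (e j) \<in> VF"
    using V j by (auto intro!: conn_VF e_VF bracket_VF)
  have "g (curvature (conn a) X Y (e j)) (e k) p = cf (conn a X (conn a Y (e j))) k p
       - cf (conn a Y (conn a X (e j))) k p - cf (conn a (lie_bracket X Y) (e j)) k p"
    using VV k VF_minus[OF VV(1,2)] by (simp add: curvature_def flip: cf_def add: cf_minus)
  then show ?thesis
    unfolding EE[OF V] EE[OF V(2,1)] E[OF bracket_VF[OF V] k] B
    by (simp add: sum_subtractf mult.commute)
qed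

lemma frame_orthonormal: "orthonormal_frame G g 6 e"
  unfolding orthonormal_frame_def
proof (intro conjI ballI allI impI)
  show "\<exists>h. (\<forall>i<6. smooth_fun G (h i)) \<and> X = (\<Sum>i<6. fscale (h i) (e i))" if "X \<in> VF" for X
    using VF_expansion[OF that] cf_smooth[OF that] unfolding frame_sum_def by blast
qed (use e_VF g_L e_L e_orthonormal in simp_all)

end

section \<open>Forms of low degree on explicit lists\<close>

lemma sum_permutes_3:
  fixes F :: "nat \<Rightarrow> nat \<Rightarrow> nat \<Rightarrow> 'a::comm_ring_1"
  shows "(\<Sum>\<sigma> | \<sigma> permutes {..<3}. of_int (sign \<sigma>) * F (\<sigma> 0) (\<sigma> 1) (\<sigma> 2))
    = F 0 1 2 - F 0 2 1 - F 1 0 2 + F 1 2 0 + F 2 0 1 - F 2 1 0"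
proof -
  have S: "{..<3} = {0, 1, 2::nat}" by auto
  have f: "finite {1, 2::nat}" "(0::nat) \<notin> {1, 2}" "finite {2::nat}" "(1::nat) \<notin> {2}" by auto
  show ?thesis
    unfolding S sum_over_permutations_insert[OF f(1,2)] sum_over_permutations_insert[OF f(3,4)]
      permutes_sing
    by (simp add: sign_compose sign_swap_id permutation_swap_id permutation_compose transpose_def)
qed

lemma sum_permutes_4:
  fixes F :: "nat \<Rightarrow> nat \<Rightarrow> nat \<Rightarrow> nat \<Rightarrow> 'a::comm_ring_1"
  shows "(\<Sum>\<sigma> | \<sigma> permutes {..<4}. of_int (sign \<sigma>) * F (\<sigma> 0) (\<sigma> 1) (\<sigma> 2) (\<sigma> 3))
    = F 0 1 2 3 - F 0 1 3 2 - F 0 2 1 3 + F 0 2 3 1 + F 0 3 1 2 - F 0 3 2 1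
    - F 1 0 2 3 + F 1 0 3 2 + F 1 2 0 3 - F 1 2 3 0 - F 1 3 0 2 + F 1 3 2 0
    + F 2 0 1 3 - F 2 0 3 1 - F 2 1 0 3 + F 2 1 3 0 + F 2 3 0 1 - F 2 3 1 0
    - F 3 0 1 2 + F 3 0 2 1 + F 3 1 0 2 - F 3 1 2 0 - F 3 2 0 1 + F 3 2 1 0"
proof -
  have S: "{..<4} = {0, 1, 2, 3::nat}" by auto
  have f: "finite {1, 2, 3::nat}" "(0::nat) \<notin> {1, 2, 3}" "finite {2, 3::nat}" "(1::nat) \<notin> {2, 3}"
    "finite {3::nat}" "(2::nat) \<notin> {3}" by auto
  show ?thesis
    unfolding S sum_over_permutations_insert[OF f(1,2)] sum_over_permutations_insert[OF f(3,4)]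
      sum_over_permutations_insert[OF f(5,6)] permutes_sing
    by (simp add: sign_compose sign_swap_id permutation_swap_id permutation_compose transpose_def)
qed

lemma wedge_1_2:
  assumes "\<beta> [Y, X] p = - \<beta> [X, Y] p" "\<beta> [Z, X] p = - \<beta> [X, Z] p" "\<beta> [Z, Y] p = - \<beta> [Y, Z] p"
  shows "wedge 1 2 \<alpha> \<beta> [X, Y, Z] p
    = \<alpha> [X] p * \<beta> [Y, Z] p - \<alpha> [Y] p * \<beta> [X, Z] p + \<alpha> [Z] p * \<beta> [X, Y] p"
proof -
  let ?l = "[X, Y, Z]"
  have u: "[0..<1] = [0]" "[1..<1 + 2] = [1, 2::nat]" "[1..<3] = [1, 2::nat]" "1 + 2 = (3::nat)" by (simp_all add: upt_rec)
  show ?thesis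
    unfolding wedge_def u list.map mult.assoc
      sum_permutes_3[of "\<lambda>i j k. \<alpha> [?l ! i] p * \<beta> [?l ! j, ?l ! k] p"]
    by (simp add: assms fact_2)
qed

text \<open>Each of the three splittings into two pairs arises from eight permutations: two orders
  within each pair and two orders of the pairs. Division by \<open>fact 2 * fact 2\<close> leaves
  the factor 2. Skewness is required only on the given fields, so that curvature entries can be
  inserted without first being shown to lie in \<open>forms\<close>.\<close>

lemma wedge_2_2:
  assumes "\<And>V W. V \<in> {X, Y, Z, U} \<Longrightarrow> W \<in> {X, Y, Z, U} \<Longrightarrow> \<eta> [V, W] p = - \<eta> [W, V] p"
  shows "wedge 2 2 \<eta> \<eta> [X, Y, Z, U] p
    = 2 * (\<eta> [X, Y] p * \<eta> [Z, U] p - \<eta> [X, Z] p * \<eta> [Y, U] p + \<eta> [X, U] p * \<eta> [Y, Z] p)"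
proof -
  let ?l = "[X, Y, Z, U]"
  have u: "[0..<2] = [0, 1]" "[2..<2 + 2] = [2, 3::nat]" "[2..<4] = [2, 3::nat]" "2 + 2 = (4::nat)" by (simp_all add: upt_rec)
  have s: "\<eta> [Y, X] p = - \<eta> [X, Y] p" "\<eta> [Z, X] p = - \<eta> [X, Z] p" "\<eta> [U, X] p = - \<eta> [X, U] p"
    "\<eta> [Z, Y] p = - \<eta> [Y, Z] p" "\<eta> [U, Y] p = - \<eta> [Y, U] p" "\<eta> [U, Z] p = - \<eta> [Z, U] p"
    by (rule assms; simp)+
  show ?thesis
    unfolding wedge_def u list.map mult.assoc
      sum_permutes_4[of "\<lambda>i j k l. \<eta> [?l ! i, ?l ! j] p * \<eta> [?l ! k, ?l ! l] p"]
    by (simp add: s fact_2 numeral_nat)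
qed

lemma sum_lessThan_numerals:
  "(\<Sum>i<2. f i) = f 0 + f (1::nat)"
  "(\<Sum>i<3. f i) = f 0 + f 1 + f (2::nat)"
  "(\<Sum>i<4. f i) = f 0 + f 1 + f 2 + f (3::nat)"
  "(\<Sum>i<6. f i) = f 0 + f 1 + f 2 + f 3 + f 4 + f (5::nat)"
  by (simp_all add: eval_nat_numeral)

lemma ext_d_3: "ext_d \<eta> [X, Y, Z] p =
    vf_apply X (\<eta> [Y, Z]) p - vf_apply Y (\<eta> [X, Z]) p + vf_apply Z (\<eta> [X, Y]) p
    - \<eta> [lie_bracket X Y, Z] p + \<eta> [lie_bracket X Z, Y] p - \<eta> [lie_bracket Y Z, X] p"
  by (simp add: ext_d_def omit_def numeral_nat)

lemma ext_d_4: "ext_d \<eta> [X, Y, Z, U] p =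
    vf_apply X (\<eta> [Y, Z, U]) p - vf_apply Y (\<eta> [X, Z, U]) p + vf_apply Z (\<eta> [X, Y, U]) p
      - vf_apply U (\<eta> [X, Y, Z]) p
    - \<eta> [lie_bracket X Y, Z, U] p + \<eta> [lie_bracket X Z, Y, U] p - \<eta> [lie_bracket Y Z, X, U] p
    - \<eta> [lie_bracket X U, Y, Z] p + \<eta> [lie_bracket Y U, X, Z] p - \<eta> [lie_bracket Z U, X, Y] p"
  by (simp add: ext_d_def omit_def numeral_nat)

section \<open>Type components of 3-forms\<close>

lemma Pow_insert_sum:
  assumes "finite A" "a \<notin> A"
  shows "sum f (Pow (insert a A)) = (\<Sum>B\<in>Pow A. f B + f (insert a B))"
proof -
  have "sum f (Pow (insert a A)) = sum f (Pow A) + sum f (insert a ` Pow A)"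
    unfolding Pow_insert using assms by (intro sum.union_disjoint) auto
  also have "sum f (insert a ` Pow A) = (\<Sum>B\<in>Pow A. f (insert a B))"
    using assms(2) by (subst sum.reindex) (auto intro!: inj_onI simp: o_def)
  finally show ?thesis by (simp add: sum.distrib)
qed

lemma sum_Pow_3: "sum f (Pow {..<3::nat}) = f {} + f {0} + f {1} + f {2}
    + f {0, 1} + f {0, 2} + f {1, 2} + f {0, 1, 2}"
proof -
  have "{..<3} = {0, 1, 2::nat}" by auto
  then show ?thesis by (simp add: Pow_insert_sum algebra_simps insert_commute)
qed

lemma card_3_1: "{S. S \<subseteq> {..<3::nat} \<and> card S = 1} = {{0}, {1}, {2}}"
proof -
  have "{..<3} = {0, 1, 2::nat}" by auto
  then show ?thesis by (auto simp: card_1_singleton_iff)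
qed

lemma card_3_3: "{S. S \<subseteq> {..<3::nat} \<and> card S = 3} = {{0, 1, 2}}"
proof -
  have "S = {0, 1, 2}" if "S \<subseteq> {..<3::nat}" "card S = 3" for S
    using card_subset_eq[OF _ that(1)] that(2) by auto
  then show ?thesis by auto
qed

text \<open>The coefficient of the term with \<open>J\<close> in the slots \<open>A\<close> is a sum
  over the three positions of the (1,0) slot, where each slot of \<open>A\<close> contributes
  \<open>- \<i>\<close> if it is that slot and \<open>\<i>\<close> otherwise. This gives
  \<open>3\<close>, \<open>\<i>\<close>, \<open>1\<close>, \<open>3 * \<i>\<close> for zero to three
  slots.\<close>

lemma type_part_1_2: "type_part J 1 2 \<eta> [X, Y, Z] p =
   (3 * \<eta> [X, Y, Z] p
    + \<i> * (\<eta> [J X, Y, Z] p + \<eta> [X, J Y, Z] p + \<eta> [X, Y, J Z] p)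
    + (\<eta> [J X, J Y, Z] p + \<eta> [J X, Y, J Z] p + \<eta> [X, J Y, J Z] p)
    + 3 * \<i> * \<eta> [J X, J Y, J Z] p) / 8"
proof -
  have u: "[0..<3] = [0, 1, 2::nat]" "1 + 2 = (3::nat)" by (simp_all add: upt_rec)
  show ?thesis
    unfolding type_part_def u card_3_1 sum_Pow_3
    by (simp add: algebra_simps)
qed

lemma type_part_3_0: "type_part J 3 0 \<eta> [X, Y, Z] p =
   (\<eta> [X, Y, Z] p
    - \<i> * (\<eta> [J X, Y, Z] p + \<eta> [X, J Y, Z] p + \<eta> [X, Y, J Z] p)
    - (\<eta> [J X, J Y, Z] p + \<eta> [J X, Y, J Z] p + \<eta> [X, J Y, J Z] p)
    + \<i> * \<eta> [J X, J Y, J Z] p) / 8"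
proof -
  have u: "[0..<3] = [0, 1, 2::nat]" "3 + 0 = (3::nat)" by (simp_all add: upt_rec)
  show ?thesis
    unfolding type_part_def u card_3_3 sum_Pow_3
    by (simp add: algebra_simps)
qed

section \<open>Evaluation of forms at a point through the frame\<close>

context real_lie_group
begin

lemma vf_apply_const: "X \<in> vector_fields G \<Longrightarrow> vf_apply X (\<lambda>p. c) = (\<lambda>p. 0)"
  using derivation_const[OF vector_fields_derivation]
  by (auto simp: vf_apply_def complex_eq_iff)

lemma forms_linear:
  assumes "\<eta> \<in> forms G k" "Xs \<in> vf_lists G k" "i < k" "X \<in> vector_fields G" "Y \<in> vector_fields G"
    "smooth_fun G h"
  shows "\<eta> (Xs[i := fscale h X + Y]) p = complex_of_real (h p) * \<eta> (Xs[i := X]) p + \<eta> (Xs[i := Y]) p"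
  using assms unfolding forms_def by (auto simp del: plus_fun_apply)

lemma forms_alternating:
  assumes "\<eta> \<in> forms G k" "Xs \<in> vf_lists G k" "i < k" "j < k" "i \<noteq> j" "Xs ! i = Xs ! j"
  shows "\<eta> Xs = (\<lambda>p. 0)"
  using assms unfolding forms_def by blast

end

context orthonormal_invariant_frame
begin

text \<open>Describes one slot of a form, with the point and the other slots held fixed. Linearity
  over functions makes the value depend only on the components at \<open>p\<close>.\<close>

definition tensorial_at :: "'g \<Rightarrow> ('g vf \<Rightarrow> complex) \<Rightarrow> bool" where
  "tensorial_at p \<phi> \<longleftrightarrow> (\<forall>X\<in>VF. \<forall>Y\<in>VF. \<forall>h. smooth_fun G h \<longrightarrow>
     \<phi> (fscale h X + Y) = complex_of_real (h p) * \<phi> X + \<phi> Y)"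

lemma tensorial_plus: "tensorial_at p \<phi> \<Longrightarrow> X \<in> VF \<Longrightarrow> Y \<in> VF \<Longrightarrow> \<phi> (X + Y) = \<phi> X + \<phi> Y"
  unfolding tensorial_at_def using smooth_const[of 1] by (metis fscale_1 mult_1 of_real_1)

lemma tensorial_0: "tensorial_at p \<phi> \<Longrightarrow> \<phi> 0 = 0"
  using tensorial_plus[of p \<phi> 0 0] vector_fields_0 by simp

lemma tensorial_fscale:
  assumes "tensorial_at p \<phi>" "X \<in> VF" "smooth_fun G h"
  shows "\<phi> (fscale h X) = complex_of_real (h p) * \<phi> X"
proof -
  have "\<phi> (fscale h X + 0) = complex_of_real (h p) * \<phi> X + \<phi> 0"
    using assms vector_fields_0 unfolding tensorial_at_def by blast
  then show ?thesis using tensorial_0[OF assms(1)] by simp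
qed

lemma tensorial_uminus:
  assumes "tensorial_at p \<phi>" "X \<in> VF" shows "\<phi> (- X) = - \<phi> X"
  using tensorial_plus[OF assms vector_fields_uminus[OF assms(2)]] tensorial_0[OF assms(1)]
  by (simp add: add_eq_0_iff)

lemma tensorial_expansion:
  assumes "tensorial_at p \<phi>" "X \<in> VF"
  shows "\<phi> X = (\<Sum>i<6. complex_of_real (cf X i p) * \<phi> (e i))"
proof -
  have "\<phi> (\<Sum>i<n. fscale (cf X i) (e i)) = (\<Sum>i<n. complex_of_real (cf X i p) * \<phi> (e i))" if "n \<le> 6" for n
    using that
  proof (induction n)
    case 0
    show ?case by (simp only: lessThan_0 sum.empty tensorial_0[OF assms(1)])
  next
    case (Suc n)
    have n: "n < 6" "n \<le> 6" using Suc.prems by simp_all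
    have "(\<Sum>i<n. fscale (cf X i) (e i)) \<in> VF"
      using n by (intro vector_fields_sum vector_fields_fscale e_VF cf_smooth assms(2)) auto
    moreover have "fscale (cf X n) (e n) \<in> VF"
      using n by (intro vector_fields_fscale e_VF cf_smooth assms(2))
    ultimately show ?case
      using Suc.IH[OF n(2)] tensorial_fscale[OF assms(1) e_VF[OF n(1)] cf_smooth[OF assms(2) n(1)]]
      by (simp only: sum.lessThan_Suc tensorial_plus[OF assms(1)])
  qed
  from this[of 6] show ?thesis using VF_expansion[OF assms(2)] by (simp add: frame_sum_def)
qed

lemma forms_tensorial:
  assumes "\<eta> \<in> forms G k" "Xs \<in> vf_lists G k" "i < k"
  shows "tensorial_at p (\<lambda>X. \<eta> (Xs[i := X]) p)"
  unfolding tensorial_at_def using forms_linear[OF assms] by blast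

lemma forms_1_tensorial: "\<eta> \<in> forms G 1 \<Longrightarrow> tensorial_at p (\<lambda>X. \<eta> [X] p)"
  using forms_tensorial[of \<eta> 1 "[0]" 0 p] vector_fields_0 by (simp add: vf_lists_def)

lemma forms_3_tensorial:
  assumes "\<eta> \<in> forms G 3" "X \<in> VF" "Y \<in> VF"
  shows "tensorial_at p (\<lambda>Z. \<eta> [Z, X, Y] p)" "tensorial_at p (\<lambda>Z. \<eta> [X, Z, Y] p)"
    "tensorial_at p (\<lambda>Z. \<eta> [X, Y, Z] p)"
  using forms_tensorial[OF assms(1), of "[0, X, Y]" 0 p] forms_tensorial[OF assms(1), of "[X, 0, Y]" 1 p]
    forms_tensorial[OF assms(1), of "[X, Y, 0]" 2 p] vector_fields_0 assms(2,3)
  by (simp_all add: vf_lists_def numeral_2_eq_2)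

lemma forms_3_alternating:
  assumes "\<eta> \<in> forms G 3" "X \<in> VF" "Y \<in> VF"
  shows "\<eta> [X, X, Y] p = 0" "\<eta> [X, Y, X] p = 0" "\<eta> [Y, X, X] p = 0"
  using forms_alternating[OF assms(1), of "[X, X, Y]" 0 1] forms_alternating[OF assms(1), of "[X, Y, X]" 0 2]
    forms_alternating[OF assms(1), of "[Y, X, X]" 1 2] assms(2,3)
  by (simp_all add: vf_lists_def numeral_2_eq_2)

text \<open>Polarisation: a sum is placed in two slots at once.\<close>

lemma forms_3_swap:
  assumes "\<eta> \<in> forms G 3" "X \<in> VF" "Y \<in> VF" "Z \<in> VF"
  shows "\<eta> [Y, X, Z] p = - \<eta> [X, Y, Z] p" "\<eta> [X, Z, Y] p = - \<eta> [X, Y, Z] p"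
proof -
  note t = forms_3_tensorial[OF assms(1), THEN tensorial_plus, where p = p]
  have XY: "X + Y \<in> VF" "Y + Z \<in> VF" using assms vector_fields_plus by auto
  have "0 = \<eta> [X + Y, X + Y, Z] p"
    using forms_3_alternating(1)[OF assms(1) XY(1) assms(4)] by simp
  also have "\<dots> = \<eta> [X, X, Z] p + \<eta> [Y, X, Z] p + (\<eta> [X, Y, Z] p + \<eta> [Y, Y, Z] p)"
    using assms XY by (simp only: t)
  finally show "\<eta> [Y, X, Z] p = - \<eta> [X, Y, Z] p"
    using forms_3_alternating[OF assms(1)] assms by (simp add: add_eq_0_iff)
  have "0 = \<eta> [X, Y + Z, Y + Z] p"
    using forms_3_alternating(3)[OF assms(1) XY(2) assms(2)] by simp
  also have "\<dots> = \<eta> [X, Y, Y] p + \<eta> [X, Z, Y] p + (\<eta> [X, Y, Z] p + \<eta> [X, Z, Z] p)"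
    using assms XY by (simp only: t)
  finally show "\<eta> [X, Z, Y] p = - \<eta> [X, Y, Z] p"
    using forms_3_alternating[OF assms(1)] assms by (simp add: add_eq_0_iff)
qed

text \<open>Because \<open>J\<close> squares to \<open>-1\<close>, applying it in one slot permutes
  the eight terms of the (3,0) projection up to an overall factor \<open>\<i>\<close>. A form that
  equals its own projection inherits this.\<close>

lemma has_type_3_0_J:
  assumes \<Psi>: "has_type G J 3 0 \<Psi>" and V: "X \<in> VF" "Y \<in> VF" "Z \<in> VF"
  shows "\<Psi> [J X, Y, Z] p = \<i> * \<Psi> [X, Y, Z] p" "\<Psi> [X, J Y, Z] p = \<i> * \<Psi> [X, Y, Z] p"
    "\<Psi> [X, Y, J Z] p = \<i> * \<Psi> [X, Y, Z] p"
proof -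
  have F: "\<Psi> \<in> forms G 3" using \<Psi> by (simp add: has_type_def)
  have T: "\<Psi> [A, B, C] p = type_part J 3 0 \<Psi> [A, B, C] p" if "A \<in> VF" "B \<in> VF" "C \<in> VF" for A B C
    using \<Psi> that by (simp add: has_type_def form_eq_def vf_lists_def)
  note m = forms_3_tensorial[OF F, THEN tensorial_uminus, where p = p]
  note JV = J_VF[OF V(1)] J_VF[OF V(2)] J_VF[OF V(3)]
  have "type_part J 3 0 \<Psi> [J X, Y, Z] p = \<i> * type_part J 3 0 \<Psi> [X, Y, Z] p"
    "type_part J 3 0 \<Psi> [X, J Y, Z] p = \<i> * type_part J 3 0 \<Psi> [X, Y, Z] p"
    "type_part J 3 0 \<Psi> [X, Y, J Z] p = \<i> * type_part J 3 0 \<Psi> [X, Y, Z] p"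
    unfolding type_part_3_0 using V JV by (simp_all add: J_J m algebra_simps add_divide_distrib diff_divide_distrib)
  then show "\<Psi> [J X, Y, Z] p = \<i> * \<Psi> [X, Y, Z] p" "\<Psi> [X, J Y, Z] p = \<i> * \<Psi> [X, Y, Z] p"
    "\<Psi> [X, Y, J Z] p = \<i> * \<Psi> [X, Y, Z] p"
    using T[OF V] T[OF JV(1) V(2,3)] T[OF V(1) JV(2) V(3)] T[OF V(1,2) JV(3)] by simp_all
qed

lemma left_invariant_form_const:
  assumes "left_invariant_form G k \<eta>" "length Xs = k" "set Xs \<subseteq> L"
  shows "\<eta> Xs p = \<eta> Xs q"
proof -
  interpret group G by (rule group_G)
  have "map (push G a) Xs = Xs" for a
    using assms(3) lie_algebra_push by (intro map_idI) auto
  moreover have "Xs \<in> vf_lists G k" using assms L_VF by (auto simp: vf_lists_def)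
  ultimately have "\<eta> Xs (a \<otimes>\<^bsub>G\<^esub> r) = \<eta> Xs r" for a r
    using assms(1) unfolding left_invariant_form_def by metis
  from this[of "p \<otimes>\<^bsub>G\<^esub> inv\<^bsub>G\<^esub> q" q] show ?thesis
    using carrier_G by (simp add: m_assoc)
qed

end

section \<open>Structure constants of an adapted frame\<close>

locale adapted_frame = orthonormal_invariant_frame G J g e
  for G :: "('g::{t2_space, second_countable_topology}, 'n::finite) lie_group_data" and J g e +
  fixes \<Psi> :: "'g form"
  assumes J_e0: "J (e 0) = e 5" and J_e1: "J (e 1) = e 2" and J_e3: "J (e 3) = e 4"
    and abelian: "i < 5 \<Longrightarrow> j < 5 \<Longrightarrow> lie_bracket (e i) (e j) = 0"
    and ideal: "i < 5 \<Longrightarrow> str 5 i 5 = 0"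
    and lck: "lck_metric G J g"
    and \<Psi>_type: "has_type G J 3 0 \<Psi>"
    and \<Psi>_invariant: "left_invariant_form G 3 \<Psi>"
    and \<Psi>_nonzero: "nowhere_vanishing G 3 \<Psi>"
    and \<Psi>_closed: "closed_form G 3 \<Psi>"
begin

lemma e_VFs: "e 0 \<in> VF" "e 1 \<in> VF" "e (Suc 0) \<in> VF" "e 2 \<in> VF" "e 3 \<in> VF" "e 4 \<in> VF" "e 5 \<in> VF"
  by (simp_all add: e_VF)

lemma e_Ls: "e 0 \<in> L" "e 1 \<in> L" "e (Suc 0) \<in> L" "e 2 \<in> L" "e 3 \<in> L" "e 4 \<in> L" "e 5 \<in> L"
  by (simp_all add: e_L)

lemma J_e5: "J (e 5) = - e 0" and J_e2: "J (e 2) = - e 1" and J_e4: "J (e 4) = - e 3"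
  using J_J[OF e_VFs(1)] J_J[OF e_VFs(2)] J_J[OF e_VFs(5)] by (simp_all only: J_e0 J_e1 J_e3)

lemma g_J_left:
  assumes "X \<in> VF" "Y \<in> VF" shows "g (J X) Y p = - g X (J Y) p"
proof -
  have "g (J X) Y p = g (J (J X)) (J Y) p" using assms by (simp add: g_J J_VF)
  also have "\<dots> = - g X (J Y) p" using assms by (simp add: J_J g_uminus J_VF)
  finally show ?thesis .
qed

lemma g_uminus_right: "X \<in> VF \<Longrightarrow> Y \<in> VF \<Longrightarrow> g X (- Y) p = - g X Y p"
  using g_uminus[of Y X p] g_sym[of X "- Y"] g_sym[of X Y] vector_fields_uminus by simp

lemma cf_J:
  assumes "X \<in> VF"
  shows "cf (J X) 0 p = - cf X 5 p" "cf (J X) 1 p = - cf X 2 p" "cf (J X) 2 p = cf X 1 p"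
    "cf (J X) 3 p = - cf X 4 p" "cf (J X) 4 p = cf X 3 p" "cf (J X) 5 p = cf X 0 p"
  using assms by (simp_all only: cf_def g_J_left e_VFs J_e0 J_e1 J_e3 J_e5 J_e2 J_e4 g_uminus_right minus_minus)

lemma ip_J_frame:
  assumes "X \<in> L"
  shows "ip (J X) (e 0) = - ip X (e 5)" "ip (J X) (e 1) = - ip X (e 2)" "ip (J X) (e 2) = ip X (e 1)"
    "ip (J X) (e 3) = - ip X (e 4)" "ip (J X) (e 4) = ip X (e 3)" "ip (J X) (e 5) = ip X (e 0)"
  using cf_J[OF L_VF[OF assms], of "\<one>\<^bsub>G\<^esub>"] by (simp_all add: cf_def ip_def)

lemma str_swap: "i < 6 \<Longrightarrow> j < 6 \<Longrightarrow> k < 6 \<Longrightarrow> str i j k = - str j i k"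
  unfolding str_def using lie_bracket_swap[of "e i" "e j"]
  by (simp add: ip_uminus lie_algebra_bracket e_L)

lemma str_abelian: "i < 5 \<Longrightarrow> j < 5 \<Longrightarrow> k < 6 \<Longrightarrow> str i j k = 0"
  unfolding str_def by (simp add: abelian ip_0 e_L)

text \<open>In the integrability equation for \<open>e 0\<close> and \<open>e i\<close>, the
  brackets \<open>[e 0, e i]\<close> and \<open>[e 0, J (e i)]\<close> vanish inside the ideal; the
  two brackets with \<open>e 5 = J (e 0)\<close> remain.\<close>

lemma ad_commutes_J:
  assumes "i < 5" "J (e i) = e j" "j < 5"
  shows "J (lie_bracket (e 5) (e i)) = lie_bracket (e 5) (e j)"
proof -
  have "lie_bracket (e 0) (e i) + J (lie_bracket (J (e 0)) (e i))
          + J (lie_bracket (e 0) (J (e i))) - lie_bracket (J (e 0)) (J (e i)) = 0"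
    using assms by (intro J_integrable e_VF) auto
  then show ?thesis
    using assms abelian[of 0 i] abelian[of 0 j] by (simp only: J_e0 J_0 add_0 add_0_right) simp
qed

text \<open>Brackets with \<open>e 5\<close> lie in the ideal, so they have no \<open>e 5\<close>
  component. As \<open>J\<close> exchanges \<open>e 0\<close> and \<open>e 5\<close> components up
  to sign and commutes with \<open>ad e\<^sub>5\<close> on \<open>W\<close>, the \<open>e 0\<close>
  components vanish too. The other equations are complex linearity on \<open>W\<close>.\<close>

lemma str_J:
  "str 5 2 0 = 0" "str 5 2 1 = - str 5 1 2" "str 5 2 2 = str 5 1 1" "str 5 2 3 = - str 5 1 4"
  "str 5 2 4 = str 5 1 3" "str 5 1 0 = 0"
  "str 5 4 0 = 0" "str 5 4 1 = - str 5 3 2" "str 5 4 2 = str 5 3 1" "str 5 4 3 = - str 5 3 4"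
  "str 5 4 4 = str 5 3 3" "str 5 3 0 = 0"
proof -
  have c: "J (lie_bracket (e 5) (e 1)) = lie_bracket (e 5) (e 2)"
    "J (lie_bracket (e 5) (e 3)) = lie_bracket (e 5) (e 4)"
    by (rule ad_commutes_J; simp add: J_e1 J_e3 del: One_nat_def)+
  show "str 5 2 0 = 0" "str 5 2 1 = - str 5 1 2" "str 5 2 2 = str 5 1 1" "str 5 2 3 = - str 5 1 4"
    "str 5 2 4 = str 5 1 3" "str 5 1 0 = 0"
    "str 5 4 0 = 0" "str 5 4 1 = - str 5 3 2" "str 5 4 2 = str 5 3 1" "str 5 4 3 = - str 5 3 4"
    "str 5 4 4 = str 5 3 3" "str 5 3 0 = 0"
    using ip_J_frame[OF lie_algebra_bracket[OF e_Ls(7) e_Ls(2)]]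
      ip_J_frame[OF lie_algebra_bracket[OF e_Ls(7) e_Ls(5)]]
      ideal[of 1] ideal[of 2] ideal[of 3] ideal[of 4]
    unfolding c by (simp_all add: str_def del: One_nat_def)
qed

section \<open>Consequences of the locally conformally Kaehler condition\<close>

definition \<omega> :: "'g form" where
  "\<omega> = fundamental_form J g"

definition \<omega>c :: "(nat \<Rightarrow> real) \<Rightarrow> (nat \<Rightarrow> real) \<Rightarrow> real" where
  "\<omega>c x y = x 0 * y 5 - x 5 * y 0 + x 1 * y 2 - x 2 * y 1 + x 3 * y 4 - x 4 * y 3"

lemma \<omega>_eq:
  assumes "X \<in> VF" "Y \<in> VF" shows "\<omega> [X, Y] p = complex_of_real (\<omega>c (comp X p) (comp Y p))"
  using assms by (simp add: \<omega>_def fundamental_form_def g_cf J_VF sum_lessThan_numerals cf_J[OF assms(1)]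
      \<omega>c_def del: One_nat_def)

lemma \<omega>_L: "X \<in> L \<Longrightarrow> Y \<in> L \<Longrightarrow> \<omega> [X, Y] = (\<lambda>p. complex_of_real (ip (J X) Y))"
  by (simp add: \<omega>_def fundamental_form_def g_L J_L)

lemma d\<omega>_L:
  assumes "X \<in> L" "Y \<in> L" "Z \<in> L"
  shows "ext_d \<omega> [X, Y, Z] p = complex_of_real
    (- ip (J (lie_bracket X Y)) Z + ip (J (lie_bracket X Z)) Y - ip (J (lie_bracket Y Z)) X)"
  using assms by (simp add: ext_d_3 \<omega>_L lie_algebra_bracket vf_apply_const[OF L_VF])

text \<open>All conclusions come from one Lee form \<open>\<alpha>\<close>, which is only known to
  exist, so they are proved together. Triples inside the ideal show that \<open>\<alpha>\<close> is
  a multiple of \<open>e\<^sup>5\<close>; triples containing \<open>e 5\<close> then compare the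
  symmetric part of \<open>ad e\<^sub>5\<close> on \<open>W\<close> with the restriction of
  \<open>\<omega>\<close>, which makes it scalar.\<close>

lemma lck_structure:
  "str 5 0 1 = 0" "str 5 0 2 = 0" "str 5 0 3 = 0" "str 5 0 4 = 0"
  "str 5 3 3 = str 5 1 1" "str 5 3 2 = str 5 1 4" "str 5 3 1 = - str 5 1 3"
  and d\<omega>_VF: "X \<in> VF \<Longrightarrow> Y \<in> VF \<Longrightarrow> Z \<in> VF \<Longrightarrow> ext_d \<omega> [X, Y, Z] p = complex_of_real (- 2 * str 5 1 1 *
     (cf X 5 p * \<omega>c (comp Y p) (comp Z p) - cf Y 5 p * \<omega>c (comp X p) (comp Z p)
       + cf Z 5 p * \<omega>c (comp X p) (comp Y p)))"
proof -
  obtain \<alpha> where \<alpha>: "\<alpha> \<in> forms G 1" "form_eq G 3 (ext_d \<omega>) (wedge 1 2 \<alpha> \<omega>)"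
    using lck unfolding lck_metric_def \<omega>_def by blast
  have d: "ext_d \<omega> [X, Y, Z] p = \<alpha> [X] p * \<omega> [Y, Z] p - \<alpha> [Y] p * \<omega> [X, Z] p + \<alpha> [Z] p * \<omega> [X, Y] p"
    if V: "X \<in> VF" "Y \<in> VF" "Z \<in> VF" for X Y Z p
  proof -
    have "ext_d \<omega> [X, Y, Z] p = wedge 1 2 \<alpha> \<omega> [X, Y, Z] p"
      using \<alpha>(2) V by (simp add: form_eq_def vf_lists_def)
    also have "\<dots> = \<alpha> [X] p * \<omega> [Y, Z] p - \<alpha> [Y] p * \<omega> [X, Z] p + \<alpha> [Z] p * \<omega> [X, Y] p"
      using V by (intro wedge_1_2) (simp_all add: \<omega>_eq \<omega>c_def flip: of_real_minus)
    finally show ?thesis .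
  qed
  have E: "\<omega> [e i, e j] p = complex_of_real (ip (J (e i)) (e j))" if "i < 6" "j < 6" for i j p
    using that by (simp add: \<omega>_L e_L)
  note ipE = E e_orthonormal J_e0 J_e1[simplified] J_e2[simplified] J_e3 J_e4 J_e5 ip_uminus e_Ls
  have br: "lie_bracket (e i) (e j) = 0" if "i < 5" "j < 5" for i j using abelian that .
  have D: "complex_of_real (- ip (J (lie_bracket (e i) (e j))) (e k) + ip (J (lie_bracket (e i) (e k))) (e j)
      - ip (J (lie_bracket (e j) (e k))) (e i))
     = \<alpha> [e i] p * \<omega> [e j, e k] p - \<alpha> [e j] p * \<omega> [e i, e k] p + \<alpha> [e k] p * \<omega> [e i, e j] p"
    if "i < 6" "j < 6" "k < 6" for i j k p
    using d[of "e i" "e j" "e k" p] d\<omega>_L[of "e i" "e j" "e k" p] that by (simp add: e_L e_VF)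
  \<comment> \<open>Each vector is tested together with a pair \<open>(e 1, e 2)\<close> or
    \<open>(e 3, e 4)\<close> orthogonal to it: \<open>d\<omega>\<close> vanishes there because the
    brackets do, while \<open>\<alpha> \<and> \<omega>\<close> reduces to the value of
    \<open>\<alpha>\<close>.\<close>
  have a0: "\<alpha> [e 0] p = 0" and a1: "\<alpha> [e 1] p = 0" and a2: "\<alpha> [e 2] p = 0" and a3: "\<alpha> [e 3] p = 0"
    and a4: "\<alpha> [e 4] p = 0" for p
    using D[of 0 1 2 p] D[of 1 3 4 p] D[of 2 3 4 p] D[of 3 1 2 p] D[of 4 1 2 p]
    by (simp_all add: ipE br ip_0)
  have J5: "ip (J (lie_bracket (e 5) (e i))) (e 0) = - str 5 i 5" "ip (J (lie_bracket (e 5) (e i))) (e 1) = - str 5 i 2"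
    "ip (J (lie_bracket (e 5) (e i))) (e (Suc 0)) = - str 5 i 2"
    "ip (J (lie_bracket (e 5) (e i))) (e 2) = str 5 i 1" "ip (J (lie_bracket (e 5) (e i))) (e 3) = - str 5 i 4"
    "ip (J (lie_bracket (e 5) (e i))) (e 4) = str 5 i 3" "ip (J (lie_bracket (e 5) (e i))) (e 5) = str 5 i 0"
    if "i < 6" for i
    using ip_J_frame[OF lie_algebra_bracket[OF e_Ls(7) e_L[OF that]]] by (simp_all add: str_def)
  note S = ipE br ip_0 J5 a0 a1[simplified] a2 a3 a4 str_J[simplified] ideal
  \<comment> \<open>Structure constants do not depend on the point, so any point will do;
    \<open>undefined\<close> merely names one.\<close>
  show "str 5 0 1 = 0" "str 5 0 2 = 0" "str 5 0 3 = 0" "str 5 0 4 = 0"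
    using D[of 5 0 2 undefined] D[of 5 0 1 undefined] D[of 5 0 4 undefined] D[of 5 0 3 undefined]
    by (simp_all add: S)
  \<comment> \<open>The two pairs spanning \<open>W\<close> express the same value of
    \<open>\<alpha>\<close>, each through the trace of \<open>ad e\<^sub>5\<close> on its
    plane.\<close>
  have a5: "\<alpha> [e 5] p = complex_of_real (- 2 * str 5 1 1)" "\<alpha> [e 5] p = complex_of_real (- 2 * str 5 3 3)" for p
    using D[of 5 1 2 p] D[of 5 3 4 p] by (simp_all add: S)
  then have "complex_of_real (- 2 * str 5 1 1) = complex_of_real (- 2 * str 5 3 3)" by metis
  then show "str 5 3 3 = str 5 1 1" by simp
  show "str 5 3 2 = str 5 1 4" "str 5 3 1 = - str 5 1 3"
    using D[of 5 1 3 undefined] D[of 5 1 4 undefined]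
    by (simp_all add: S flip: of_real_add of_real_diff of_real_minus)
  show "ext_d \<omega> [X, Y, Z] p = complex_of_real (- 2 * str 5 1 1 *
     (cf X 5 p * \<omega>c (comp Y p) (comp Z p) - cf Y 5 p * \<omega>c (comp X p) (comp Z p)
       + cf Z 5 p * \<omega>c (comp X p) (comp Y p)))" if V: "X \<in> VF" "Y \<in> VF" "Z \<in> VF"
  proof -
    have A: "\<alpha> [W] p = complex_of_real (cf W 5 p * (- 2 * str 5 1 1))" if "W \<in> VF" for W
      using tensorial_expansion[OF forms_1_tensorial[OF \<alpha>(1)] that, of p]
      unfolding sum_lessThan_numerals a0 a1 a2 a3 a4 a5(1) by simp
    show ?thesis
      unfolding d[OF V] A[OF V(1)] A[OF V(2)] A[OF V(3)] using V by (simp add: \<omega>_eq algebra_simps)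
  qed
qed

text \<open>Closedness on \<open>e 5, e 0, e 1, e 3\<close> says that \<open>P\<close> times a
  complex trace of \<open>ad e\<^sub>5\<close>, taken over the complex basis
  \<open>e 0, e 1, e 3\<close>, is zero. Since \<open>P\<close> is nonzero, the real part gives the
  relation.\<close>

lemma \<Psi>_trace: "str 5 0 0 = - 2 * str 5 1 1"
proof -
  fix p :: 'g
  have F: "\<Psi> \<in> forms G 3" using \<Psi>_type by (simp add: has_type_def)
  note lin = forms_3_tensorial[OF F]
  note P_J = has_type_3_0_J[OF \<Psi>_type]
  define P where "P = \<Psi> [e 0, e 1, e 3] p"
  \<comment> \<open>A functional that turns \<open>J\<close> into multiplication by
    \<open>\<i>\<close> is determined by the complex basis \<open>e 0, e 1, e 3\<close>. Applied
    slot by slot, this shows that \<open>P = 0\<close> would force \<open>\<Psi>\<close> to vanish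
    at \<open>p\<close>.\<close>
  have zero: "\<phi> X = 0"
    if t: "tensorial_at p \<phi>" and J: "\<And>X. X \<in> VF \<Longrightarrow> \<phi> (J X) = \<i> * \<phi> X" and X: "X \<in> VF"
      and z: "\<phi> (e 0) = 0" "\<phi> (e 1) = 0" "\<phi> (e 3) = 0" for \<phi> X
  proof -
    have "\<phi> (e 5) = 0" "\<phi> (e 2) = 0" "\<phi> (e 4) = 0"
      using J[OF e_VFs(1)] J[OF e_VFs(2)] J[OF e_VFs(5)] z by (simp_all add: J_e0 J_e1[simplified] J_e3)
    then show ?thesis unfolding tensorial_expansion[OF t X] sum_lessThan_numerals using z by simp
  qed
  have "P \<noteq> 0"
  proof
    assume P0: "P = 0"
    have frame: "\<Psi> [e i, e j, e k] p = 0" if "i \<in> {0, 1, 3}" "j \<in> {0, 1, 3}" "k \<in> {0, 1, 3}" for i j k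
    proof -
      note alt = forms_3_alternating[OF F] and sw = forms_3_swap[OF F]
      have P: "\<Psi> [e 0, e 1, e 3] p = 0" "\<Psi> [e 1, e 0, e 3] p = 0" "\<Psi> [e 0, e 3, e 1] p = 0"
        "\<Psi> [e 1, e 3, e 0] p = 0" "\<Psi> [e 3, e 0, e 1] p = 0" "\<Psi> [e 3, e 1, e 0] p = 0"
        using P0 sw[OF e_VFs(1) e_VFs(2) e_VFs(5), of p] sw[OF e_VFs(2) e_VFs(1) e_VFs(5), of p]
          sw[OF e_VFs(1) e_VFs(5) e_VFs(2), of p] sw[OF e_VFs(2) e_VFs(5) e_VFs(1), of p]
        by (simp_all add: P_def)
      show ?thesis
        using that by (elim insertE emptyE; simp add: alt e_VFs P P[simplified])
    qed
    have eV: "e i \<in> VF" if "i \<in> {0, 1, 3}" for i using that by (intro e_VF) auto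
    have 1: "\<Psi> [e i, e j, Z] p = 0" if ij: "i \<in> {0, 1, 3}" "j \<in> {0, 1, 3}" and Z: "Z \<in> VF" for i j Z
      using zero[where \<phi> = "\<lambda>Z. \<Psi> [e i, e j, Z] p", OF lin(3)[OF ij[THEN eV]] P_J(3)[OF ij[THEN eV]] Z]
        frame[OF ij, of 0] frame[OF ij, of 1] frame[OF ij, of 3] by simp
    have 2: "\<Psi> [e i, Y, Z] p = 0" if i: "i \<in> {0, 1, 3}" and Y: "Y \<in> VF" and Z: "Z \<in> VF" for i Y Z
      using zero[where \<phi> = "\<lambda>Y. \<Psi> [e i, Y, Z] p", OF lin(2)[OF eV[OF i] Z] P_J(2)[OF eV[OF i] _ Z] Y]
        1[OF i _ Z, of 0] 1[OF i _ Z, of 1] 1[OF i _ Z, of 3] by simp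
    have 3: "\<Psi> [X, Y, Z] p = 0" if X: "X \<in> VF" and Y: "Y \<in> VF" and Z: "Z \<in> VF" for X Y Z
      using zero[where \<phi> = "\<lambda>X. \<Psi> [X, Y, Z] p", OF lin(1)[OF Y Z] P_J(1)[OF _ Y Z] X]
        2[OF _ Y Z, of 0] 2[OF _ Y Z, of 1] 2[OF _ Y Z, of 3] by simp
    obtain Xs where Xs: "Xs \<in> vf_lists G 3" "\<Psi> Xs p \<noteq> 0"
      using \<Psi>_nonzero unfolding nowhere_vanishing_def by blast
    then obtain X Y Z where "Xs = [X, Y, Z]" "X \<in> VF" "Y \<in> VF" "Z \<in> VF"
      by (auto simp: vf_lists_def numeral_3_eq_3 length_Suc_conv)
    then show False using 3 Xs by simp
  qed
  have const: "\<Psi> [e i, e j, e k] = (\<lambda>q. \<Psi> [e i, e j, e k] p)" if "i < 6" "j < 6" "k < 6" for i j k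
    using that e_L by (intro ext left_invariant_form_const[OF \<Psi>_invariant]) auto
  have va: "vf_apply (e m) (\<Psi> [e i, e j, e k]) p = 0" if "m < 6" "i < 6" "j < 6" "k < 6" for m i j k
    by (subst const[OF that(2-4)]) (simp add: vf_apply_const[OF e_VF[OF that(1)]])
  have z: "\<Psi> [0, X, Y] p = 0" if "X \<in> VF" "Y \<in> VF" for X Y
    using tensorial_0[OF lin(1)[OF that]] .
  have ad: "\<Psi> [lie_bracket (e 5) (e i), X, Y] p = (\<Sum>k<6. complex_of_real (str 5 i k) * \<Psi> [e k, X, Y] p)"
    if "i < 6" "X \<in> VF" "Y \<in> VF" for i X Y
    unfolding str_def tensorial_expansion[OF lin(1)[OF that(2,3)] L_VF[OF lie_algebra_bracket[OF e_Ls(7) e_L[OF that(1)]]]]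
    using that by (intro sum.cong) (simp_all add: cf_L lie_algebra_bracket e_L)
  have "ext_d \<Psi> [e 5, e 0, e 1, e 3] p = 0"
    using \<Psi>_closed e_VFs by (simp add: closed_form_def form_eq_def vf_lists_def)
  \<comment> \<open>In Cartan's formula the derivative terms vanish because \<open>\<Psi>\<close> is
    constant on frame fields, and among the brackets only those with \<open>e 5\<close>
    survive.\<close>
  then have eq: "- \<Psi> [lie_bracket (e 5) (e 0), e 1, e 3] p + \<Psi> [lie_bracket (e 5) (e 1), e 0, e 3] p
      - \<Psi> [lie_bracket (e 5) (e 3), e 0, e 1] p = 0"
    using abelian[of 0 1] abelian[of 0 3] abelian[of 1 3] va[of 5 0 1 3] va[of 0 5 1 3] va[of 1 5 0 3] va[of 3 5 0 1]
      z[OF e_VFs(7) e_VFs(5)] z[OF e_VFs(7) e_VFs(2)] z[OF e_VFs(7) e_VFs(1)]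
    unfolding ext_d_4 by (simp del: One_nat_def)
  note J2 = P_J(1)[OF e_VFs(2), unfolded J_e1] and J4 = P_J(1)[OF e_VFs(5), unfolded J_e3]
  note alt = forms_3_alternating[OF F]
  have P2: "\<Psi> [e 1, e 0, e 3] p = - P"
    using forms_3_swap(1)[OF F e_VFs(1) e_VFs(2) e_VFs(5)] by (simp add: P_def)
  have P3: "\<Psi> [e 3, e 0, e 1] p = P"
    using forms_3_swap(1)[OF F e_VFs(1) e_VFs(5) e_VFs(2), of p] forms_3_swap(2)[OF F e_VFs(1) e_VFs(2) e_VFs(5), of p]
    by (simp add: P_def)
  have n6: "0 < (6::nat)" "1 < (6::nat)" "3 < (6::nat)" by simp_all
  have A0: "\<Psi> [lie_bracket (e 5) (e 0), e 1, e 3] p = complex_of_real (str 5 0 0) * P"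
    unfolding ad[OF n6(1) e_VFs(2) e_VFs(5)] sum_lessThan_numerals
    using lck_structure ideal[of 0] by (simp add: P_def)
  have A1: "\<Psi> [lie_bracket (e 5) (e 1), e 0, e 3] p
      = - (complex_of_real (str 5 1 1) + \<i> * complex_of_real (str 5 1 2)) * P"
    unfolding ad[OF n6(2) e_VFs(1) e_VFs(5)] sum_lessThan_numerals J2[OF e_VFs(1) e_VFs(5)]
      J4[OF e_VFs(1) e_VFs(5)] P2 alt(2)[OF e_VFs(5) e_VFs(1)]
    using str_J ideal[of 1] P2 by (simp add: algebra_simps)
  have A3: "\<Psi> [lie_bracket (e 5) (e 3), e 0, e 1] p
      = (complex_of_real (str 5 3 3) + \<i> * complex_of_real (str 5 3 4)) * P"
    unfolding ad[OF n6(3) e_VFs(1) e_VFs(2)] sum_lessThan_numerals J2[OF e_VFs(1) e_VFs(2)]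
      J4[OF e_VFs(1) e_VFs(2)] P3 alt(2)[OF e_VFs(2) e_VFs(1)]
    using str_J ideal[of 3] by (simp add: algebra_simps)
  have "(complex_of_real (str 5 0 0) + complex_of_real (str 5 1 1) + complex_of_real (str 5 3 3)
      + \<i> * (complex_of_real (str 5 1 2) + complex_of_real (str 5 3 4))) * P
    = - (- (complex_of_real (str 5 0 0) * P)
        + - (complex_of_real (str 5 1 1) + \<i> * complex_of_real (str 5 1 2)) * P
        - (complex_of_real (str 5 3 3) + \<i> * complex_of_real (str 5 3 4)) * P)"
    by (simp add: algebra_simps)
  also have "\<dots> = 0" using eq unfolding A0 A1 A3 by (simp only: neg_equal_0_iff_equal)
  finally have "(complex_of_real (str 5 0 0) + complex_of_real (str 5 1 1) + complex_of_real (str 5 3 3)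
      + \<i> * (complex_of_real (str 5 1 2) + complex_of_real (str 5 3 4))) * P = 0" .
  then have "complex_of_real (str 5 0 0) + complex_of_real (str 5 1 1) + complex_of_real (str 5 3 3)
      + \<i> * (complex_of_real (str 5 1 2) + complex_of_real (str 5 3 4)) = 0"
    using \<open>P \<noteq> 0\<close> by simp
  from arg_cong[OF this, of Re] show ?thesis using lck_structure(5) by simp
qed

end

section \<open>Curvature of the Gauduchon connections\<close>

definition unitv :: "nat \<Rightarrow> nat \<Rightarrow> real" where
  "unitv i = (\<lambda>m. if m = i then 1 else 0)"

text \<open>Phrasing linearity as expansion in unit vectors also records that, of arguments defined
  on all naturals, only the components below 6 count.\<close>

definition trilinear :: "((nat \<Rightarrow> real) \<Rightarrow> (nat \<Rightarrow> real) \<Rightarrow> (nat \<Rightarrow> real) \<Rightarrow> real) \<Rightarrow> bool" where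
  "trilinear t \<longleftrightarrow> (\<forall>x y z. t x y z = (\<Sum>i<6. x i * t (unitv i) y z) \<and>
     t x y z = (\<Sum>i<6. y i * t x (unitv i) z) \<and> t x y z = (\<Sum>i<6. z i * t x y (unitv i)))"

definition coeffs :: "((nat \<Rightarrow> real) \<Rightarrow> (nat \<Rightarrow> real) \<Rightarrow> (nat \<Rightarrow> real) \<Rightarrow> real) \<Rightarrow> nat \<Rightarrow> nat \<Rightarrow> nat \<Rightarrow> real" where
  "coeffs t i j k = t (unitv i) (unitv j) (unitv k)"

lemma lincomb_coeffs: "trilinear t \<Longrightarrow> lincomb (coeffs t) x j k = t x (unitv j) (unitv k)"
  unfolding trilinear_def lincomb_def coeffs_def by metis

lemma sum_lincomb_coeffs:
  assumes "trilinear t"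
  shows "(\<Sum>k<6. (\<Sum>j<6. lincomb (coeffs t) x j k * y j) * z k) = t x y z"
proof -
  have "(\<Sum>j<6. lincomb (coeffs t) x j k * y j) = t x y (unitv k)" for k
    using assms unfolding lincomb_coeffs[OF assms] trilinear_def by (metis (no_types, lifting) mult.commute sum.cong)
  then have "(\<Sum>k<6. (\<Sum>j<6. lincomb (coeffs t) x j k * y j) * z k) = (\<Sum>k<6. z k * t x y (unitv k))"
    by (simp add: mult.commute)
  then show ?thesis using assms unfolding trilinear_def by metis
qed

text \<open>\<open>g (A Y) Z\<close> for the skew part \<open>A\<close> of
  \<open>ad e\<^sub>5\<close>, which commutes with \<open>J\<close> on \<open>W\<close>: a general
  element of u(2) in four real parameters.\<close>

definition ad_skew :: "real \<Rightarrow> real \<Rightarrow> real \<Rightarrow> real \<Rightarrow> (nat \<Rightarrow> real) \<Rightarrow> (nat \<Rightarrow> real) \<Rightarrow> real" where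
  "ad_skew u v q w y z = u * (y 1 * z 2 - y 2 * z 1)
     + v * (y 1 * z 3 - y 3 * z 1 + y 2 * z 4 - y 4 * z 2)
     + q * (y 1 * z 4 - y 4 * z 1 - y 2 * z 3 + y 3 * z 2) + w * (y 3 * z 4 - y 4 * z 3)"

definition inner4 :: "(nat \<Rightarrow> real) \<Rightarrow> (nat \<Rightarrow> real) \<Rightarrow> real" where
  "inner4 x y = x 1 * y 1 + x 2 * y 2 + x 3 * y 3 + x 4 * y 4"

definition kahler4 :: "(nat \<Rightarrow> real) \<Rightarrow> (nat \<Rightarrow> real) \<Rightarrow> real" where
  "kahler4 x y = x 1 * y 2 - x 2 * y 1 + x 3 * y 4 - x 4 * y 3"

text \<open>Component forms of \<open>g (D\<^sub>X Y) Z\<close> and \<open>g (E\<^sub>X Y) Z\<close>. By the Koszul formula,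
  \<open>D\<^sub>X Y = x\<^sub>5 A Y + \<langle>S X, Y\<rangle> e\<^sub>5 - y\<^sub>5 S X\<close> with \<open>S\<close> and \<open>A\<close> the symmetric and skew parts of
  \<open>ad e\<^sub>5\<close>. The second form adds the torsion terms; the Gauduchon connection has
  \<open>\<kappa> = (1 - \<tau>) s / 4\<close>, a relation that the curvature computation does not use.\<close>

definition lc_form where
  "lc_form s u v q w x y z = x 5 * ad_skew u v q w y z
     + (s * x 0 * y 0 - s / 2 * inner4 x y) * z 5 - (s * x 0 * z 0 - s / 2 * inner4 x z) * y 5"

definition gauduchon_form where
  "gauduchon_form s \<tau> \<kappa> u v q w x y z = x 5 * ad_skew u v q w y z
     + s * x 0 * (y 0 * z 5 - y 5 * z 0 - \<tau> / 2 * kahler4 y z)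
     - \<kappa> * (inner4 x y * z 5 - inner4 x z * y 5 - kahler4 x y * z 0 + kahler4 x z * y 0)"

lemmas form_defs = ad_skew_def inner4_def kahler4_def

lemma trilinear_lc_form: "trilinear (lc_form s u v q w)"
  unfolding trilinear_def sum_lessThan_numerals lc_form_def form_defs unitv_def
  by (simp add: field_simps del: One_nat_def)

lemma trilinear_gauduchon_form: "trilinear (gauduchon_form s \<tau> \<kappa> u v q w)"
  unfolding trilinear_def sum_lessThan_numerals gauduchon_form_def form_defs unitv_def
  by (simp add: field_simps del: One_nat_def)

text \<open>The entries above the diagonal of \<open>[E\<^sub>X, E\<^sub>Y] - E\<^sub>[\<^sub>X\<^sub>,\<^sub>Y\<^sub>]\<close>. Writing \<open>E\<^sub>0 = s M\<close> and \<open>E\<^sub>i = - \<kappa> Q\<^sub>i\<close> for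
  \<open>1 \<le> i \<le> 4\<close>, it equals
  \<open>- s\<^sup>2 p\<^sub>5\<^sub>0 M - \<kappa> (\<Sum>\<^sub>i l\<^sub>i Q\<^sub>i) + \<kappa>\<^sup>2 (\<Sum>\<^sub>i\<^sub><\<^sub>j p\<^sub>i\<^sub>j [Q\<^sub>i, Q\<^sub>j])\<close>.\<close>

definition curv_entry :: "real \<Rightarrow> real \<Rightarrow> real \<Rightarrow> nat \<Rightarrow> nat \<Rightarrow> (nat \<Rightarrow> real) \<Rightarrow> (nat \<Rightarrow> real) \<Rightarrow> real" where
  "curv_entry s \<tau> \<kappa> i j x y = (let p = (\<lambda>m n. x m * y n - x n * y m); c = s * (1 + \<tau> / 2);
     l1 = s / 2 * p 5 1 + c * p 0 2; l2 = s / 2 * p 5 2 - c * p 0 1;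
     l3 = s / 2 * p 5 3 + c * p 0 4; l4 = s / 2 * p 5 4 - c * p 0 3 in
     (if i = 0 then [0, \<kappa> * l2, - \<kappa> * l1, \<kappa> * l4, - \<kappa> * l3, - s\<^sup>2 * p 5 0 - 2 * \<kappa>\<^sup>2 * (p 1 2 + p 3 4)] ! j
      else if i = 1 then [0, 0, s\<^sup>2 * \<tau> / 2 * p 5 0 + 2 * \<kappa>\<^sup>2 * p 1 2, \<kappa>\<^sup>2 * (p 1 3 + p 2 4), \<kappa>\<^sup>2 * (p 1 4 - p 2 3), - \<kappa> * l1] ! j
      else if i = 2 then [0, 0, 0, - \<kappa>\<^sup>2 * (p 1 4 - p 2 3), \<kappa>\<^sup>2 * (p 1 3 + p 2 4), - \<kappa> * l2] ! j
      else if i = 3 then [0, 0, 0, 0, s\<^sup>2 * \<tau> / 2 * p 5 0 + 2 * \<kappa>\<^sup>2 * p 3 4, - \<kappa> * l3] ! j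
      else - \<kappa> * l4))"

text \<open>Since the ideal is abelian, \<open>[X, Y]\<close> is \<open>ad e\<^sub>5\<close> applied
  to \<open>x\<^sub>5 Y - y\<^sub>5 X\<close>, whose components are \<open>B\<close>.\<close>

definition ad_bracket :: "real \<Rightarrow> real \<Rightarrow> real \<Rightarrow> real \<Rightarrow> real \<Rightarrow> (nat \<Rightarrow> real) \<Rightarrow> (nat \<Rightarrow> real) \<Rightarrow> nat \<Rightarrow> real" where
  "ad_bracket s u v q w x y k = (let B = (\<lambda>j. x 5 * y j - x j * y 5) in
     [s * B 0, - s / 2 * B 1 - u * B 2 - v * B 3 - q * B 4, u * B 1 - s / 2 * B 2 + q * B 3 - v * B 4,
      v * B 1 - q * B 2 - s / 2 * B 3 - w * B 4, q * B 1 + v * B 2 + w * B 3 - s / 2 * B 4, 0] ! k)"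

lemma ad_bracket_simps:
  "ad_bracket s u v q w x y 0 = s * (x 5 * y 0 - x 0 * y 5)"
  "ad_bracket s u v q w x y 1 = - s / 2 * (x 5 * y 1 - x 1 * y 5) - u * (x 5 * y 2 - x 2 * y 5)
      - v * (x 5 * y 3 - x 3 * y 5) - q * (x 5 * y 4 - x 4 * y 5)"
  "ad_bracket s u v q w x y 2 = u * (x 5 * y 1 - x 1 * y 5) - s / 2 * (x 5 * y 2 - x 2 * y 5)
      + q * (x 5 * y 3 - x 3 * y 5) - v * (x 5 * y 4 - x 4 * y 5)"
  "ad_bracket s u v q w x y 3 = v * (x 5 * y 1 - x 1 * y 5) - q * (x 5 * y 2 - x 2 * y 5)
      - s / 2 * (x 5 * y 3 - x 3 * y 5) - w * (x 5 * y 4 - x 4 * y 5)"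
  "ad_bracket s u v q w x y 4 = q * (x 5 * y 1 - x 1 * y 5) + v * (x 5 * y 2 - x 2 * y 5)
      + w * (x 5 * y 3 - x 3 * y 5) - s / 2 * (x 5 * y 4 - x 4 * y 5)"
  "ad_bracket s u v q w x y 5 = 0"
  by (simp_all add: ad_bracket_def Let_def)

text \<open>Why \<open>u\<close>, \<open>v\<close>, \<open>q\<close>, \<open>w\<close> disappear:
  write \<open>E\<^sub>X = x\<^sub>5 A + F\<^sub>X\<close>. The part \<open>F\<close> is built from
  the metric, \<open>J\<close>, \<open>e 0\<close> and \<open>e 5\<close>, all preserved by
  \<open>A\<close>, hence \<open>[A, F\<^sub>X] = F\<^sub>A\<^sub>X\<close>. These commutators
  cancel the contribution of \<open>A\<close> to \<open>[X, Y]\<close>, which has no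
  \<open>e 5\<close> component.\<close>

lemma curvature_entries:
  assumes "i < j" "j < 6" and b: "b = gauduchon_form s \<tau> \<kappa> u v q w"
  shows "(\<Sum>l<6. b y (unitv i) (unitv l) * b x (unitv l) (unitv j)
          - b x (unitv i) (unitv l) * b y (unitv l) (unitv j))
     - b (ad_bracket s u v q w x y) (unitv i) (unitv j) = curv_entry s \<tau> \<kappa> i j x y"
proof -
  have "j \<in> {0, 1, 2, 3, 4, 5}" "i \<in> {0, 1, 2, 3, 4}" using assms by auto
  then show ?thesis
    using assms(1) unfolding sum_lessThan_numerals b gauduchon_form_def form_defs unitv_def curv_entry_def Let_def
      ad_bracket_simps
    by (elim insertE emptyE; simp del: One_nat_def; simp add: field_simps power2_eq_square)
qed

text \<open>The sum is half the evaluated sum of wedge squares, and only two 4-forms occur in the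
  latter. Along \<open>e\<^sup>5 \<and> e\<^sup>0 \<and> (e\<^sup>1 \<and> e\<^sup>2 + e\<^sup>3
  \<and> e\<^sup>4)\<close> the entries with \<open>l1\<close> to \<open>l4\<close> give
  \<open>- 2 \<kappa>\<^sup>2 s\<^sup>2 (2 + \<tau>)\<close>, entry (0,5) gives
  \<open>4 \<kappa>\<^sup>2 s\<^sup>2\<close>, and entries (1,2) and (3,4) give
  \<open>2 \<kappa>\<^sup>2 s\<^sup>2 \<tau>\<close>. Along the volume form of \<open>W\<close>,
  entry (0,5) gives \<open>8 \<kappa>\<^sup>4\<close> and the entries mixing the two planes give
  \<open>- 8 \<kappa>\<^sup>4\<close>.\<close>

lemma curvature_identity:
  "(\<Sum>j<6. \<Sum>i<j. curv_entry s \<tau> \<kappa> i j x y * curv_entry s \<tau> \<kappa> i j z t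
     - curv_entry s \<tau> \<kappa> i j x z * curv_entry s \<tau> \<kappa> i j y t
     + curv_entry s \<tau> \<kappa> i j x t * curv_entry s \<tau> \<kappa> i j y z) = 0"
proof -
  have l: "(\<Sum>i<5. f i) = f 0 + f 1 + f 2 + f 3 + f (4::nat)" "(\<Sum>i<1. f i) = f (0::nat)" for f :: "nat \<Rightarrow> real"
    by (simp_all add: eval_nat_numeral)
  \<comment> \<open>Halving the parameters removes the denominators, so \<open>algebra\<close> meets
    polynomials with integer coefficients.\<close>
  obtain h r where hr: "s = 2 * h" "\<tau> = 2 * r"
    by (metis field_sum_of_halves mult_2)
  show ?thesis
    unfolding sum_lessThan_numerals l curv_entry_def Let_def hr
    by (simp del: One_nat_def) algebra
qed

lemma form_zeroI: "form_eq G k \<eta> 0 \<longleftrightarrow> (\<forall>Xs\<in>vf_lists G k. \<forall>p. \<eta> Xs p = 0)"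
  by (auto simp: form_eq_def fun_eq_iff)

lemma vf_lists_4E:
  assumes "Xs \<in> vf_lists G 4"
  obtains X Y Z U where "Xs = [X, Y, Z, U]" "X \<in> vector_fields G" "Y \<in> vector_fields G"
    "Z \<in> vector_fields G" "U \<in> vector_fields G"
  using assms by (auto simp: vf_lists_def eval_nat_numeral length_Suc_conv)

lemma curv_entry_swap:
  assumes "i < j" "j < 6"
  shows "curv_entry s \<tau> \<kappa> i j x y = - curv_entry s \<tau> \<kappa> i j y x"
proof -
  have "j \<in> {0, 1, 2, 3, 4, 5}" "i \<in> {0, 1, 2, 3, 4}" using assms by auto
  then show ?thesis
    using assms(1) unfolding curv_entry_def Let_def
    by (elim insertE emptyE; simp del: One_nat_def; simp add: field_simps)
qed

text \<open>With \<open>d\<omega> = s e\<^sup>5 \<and> \<omega>\<close> the torsion terms are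
  explicit polynomials; here \<open>W\<close> and \<open>J\<close> are the component versions of the
  fundamental form and the complex structure. This is where the value
  \<open>(1 - \<tau>) s / 4\<close> of \<open>\<kappa>\<close> comes from.\<close>

lemma gauduchon_form_eq:
  defines "W \<equiv> \<lambda>x y. x 0 * y 5 - x 5 * y 0 + x 1 * y 2 - x 2 * y 1 + x 3 * y 4 - x 4 * y 3"
    and "J \<equiv> \<lambda>x. (nth [- x 5, - x 2, x 1, - x 4, x 3, x 0]) :: nat \<Rightarrow> real"
  defines "dW \<equiv> \<lambda>x y z. x 5 * W y z - y 5 * W x z + z 5 * W x y"
  shows "gauduchon_form s \<tau> ((1 - \<tau>) / 4 * s) u v q w x y z = lc_form s u v q w x y z
     + (1 - \<tau>) / 4 * (s * dW (J x) (J y) (J z)) + (1 + \<tau>) / 4 * - (s * dW (J x) y z)"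
proof -
  \<comment> \<open>Chosen so that \<open>(1 - \<tau>) / 4 = - r\<close> and
    \<open>(1 + \<tau>) / 4 * s = (2 * r + 1) * h\<close>, which clears all denominators.\<close>
  define h r where "h = s / 2" and "r = (\<tau> - 1) / 4"
  then have hr: "s = 2 * h" "\<tau> = 4 * r + 1" by simp_all
  have "(1 - \<tau>) / 4 = - r" "(1 + \<tau>) / 4 * - (s * M) = - (2 * r + 1) * (h * M)" "s / 2 = h"
    "s * P * (Q - \<tau> / 2 * R) = 2 * h * P * Q - h * (4 * r + 1) * P * R" for M P Q R
    by (simp_all add: hr field_simps)
  note hr' = this
  show ?thesis
    unfolding gauduchon_form_def lc_form_def hr' hr dW_def W_def J_def form_defs
    by (simp del: One_nat_def) algebra
qed

section \<open>The Gauduchon connections of the metric and the trace term\<close>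

context adapted_frame
begin

lemma type_part_zero:
  assumes "form_eq G (k + l) \<eta> 0" "Xs \<in> vf_lists G (k + l)"
  shows "type_part J k l \<eta> Xs p = 0"
proof -
  have "map (\<lambda>i. if i \<in> A then J (Xs ! i) else Xs ! i) [0..<k + l] \<in> vf_lists G (k + l)" for A
    using assms(2) J_VF nth_mem[of _ Xs] by (auto simp: vf_lists_def subset_iff)
  then have "\<eta> (map (\<lambda>i. if i \<in> A then J (Xs ! i) else Xs ! i) [0..<k + l]) p = 0" for A
    using assms(1) unfolding form_zeroI by blast
  then show ?thesis by (simp add: type_part_def)
qed

definition s where "s = str 5 0 0"
definition u where "u = str 5 1 2"
definition v where "v = str 5 1 3"
definition q where "q = str 5 1 4"
definition w where "w = str 5 3 4"

lemma str_table:
  "str 5 0 0 = s" "str 5 0 1 = 0" "str 5 0 2 = 0" "str 5 0 3 = 0" "str 5 0 4 = 0" "str 5 0 5 = 0"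
  "str 5 1 0 = 0" "str 5 1 1 = - s / 2" "str 5 1 2 = u" "str 5 1 3 = v" "str 5 1 4 = q" "str 5 1 5 = 0"
  "str 5 2 0 = 0" "str 5 2 1 = - u" "str 5 2 2 = - s / 2" "str 5 2 3 = - q" "str 5 2 4 = v" "str 5 2 5 = 0"
  "str 5 3 0 = 0" "str 5 3 1 = - v" "str 5 3 2 = q" "str 5 3 3 = - s / 2" "str 5 3 4 = w" "str 5 3 5 = 0"
  "str 5 4 0 = 0" "str 5 4 1 = - q" "str 5 4 2 = - v" "str 5 4 3 = - w" "str 5 4 4 = - s / 2" "str 5 4 5 = 0"
  using str_J lck_structure \<Psi>_trace ideal[of 0] ideal[of 1] ideal[of 2] ideal[of 3] ideal[of 4]
  by (simp_all add: s_def u_def v_def q_def w_def)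

lemma str_55: "k < 6 \<Longrightarrow> str 5 5 k = 0"
  using str_swap[of 5 5 k] by simp

lemma bracket_comp_eq:
  assumes "k < 6" shows "bracket_comp x y k = ad_bracket s u v q w x y k"
proof -
  have 1: "str i 5 k = - str 5 i k" if "i < 5" "k < 6" for i k
    using str_swap[of i 5 k] that by simp
  have "k \<in> {0, 1, 2, 3, 4, 5}" using assms by auto
  then show ?thesis
    by (elim insertE emptyE; hypsubst;
        simp add: bracket_comp_def sum_lessThan_numerals ad_bracket_simps str_abelian 1 str_table str_55 del: One_nat_def;
        simp add: field_simps)
qed

lemma bracket_comp_unitv: "i < 6 \<Longrightarrow> j < 6 \<Longrightarrow> bracket_comp (unitv i) (unitv j) k = str i j k"
proof -
  assume ij: "i < 6" "j < 6"
  have "bracket_comp (unitv i) (unitv j) k = (\<Sum>m<6. \<Sum>n<6. if n = j then unitv i m * str m n k else 0)"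
    unfolding bracket_comp_def by (intro sum.cong refl) (simp add: unitv_def)
  also have "\<dots> = (\<Sum>m<6. if m = i then str m j k else 0)"
    using ij by (intro sum.cong refl) (simp add: unitv_def)
  finally show "bracket_comp (unitv i) (unitv j) k = str i j k" using ij by simp
qed

definition "lc = coeffs (lc_form s u v q w)"
definition "gc \<tau> = coeffs (gauduchon_form s \<tau> ((1 - \<tau>) / 4 * s) u v q w)"

lemma lc_levi_civita: "levi_civita G g (conn lc)"
proof (rule conn_levi_civita)
  fix i j k :: nat assume ijk: "i < 6" "j < 6" "k < 6"
  show "lc i j k = - lc i k j"
    by (simp add: lc_def coeffs_def lc_form_def form_defs algebra_simps)
  have k: "k \<in> {0, 1, 2, 3, 4, 5}" using ijk by auto
  have "lc_form s u v q w x y (unitv k) - lc_form s u v q w y x (unitv k) = ad_bracket s u v q w x y k" for x y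
    using k by (elim insertE emptyE; hypsubst;
        simp add: lc_form_def form_defs unitv_def ad_bracket_simps del: One_nat_def; simp add: field_simps)
  then show "lc i j k - lc j i k = str i j k"
    using ijk by (simp add: lc_def coeffs_def flip: bracket_comp_eq bracket_comp_unitv)
qed

text \<open>The derivative part is the same for all coefficients, so comparing two connections
  amounts to comparing their trilinear forms at a point.\<close>

lemma g_conn:
  assumes t: "trilinear t" and V: "X \<in> VF" "Y \<in> VF" "Z \<in> VF"
  shows "g (conn (coeffs t) X Y) Z p = (\<Sum>k<6. X (cf Y k) p * cf Z k p) + t (comp X p) (comp Y p) (comp Z p)"
proof -
  have "g (conn (coeffs t) X Y) Z p = (\<Sum>k<6. X (cf Y k) p * cf Z k p
      + (\<Sum>j<6. lincomb (coeffs t) (comp X p) j k * cf Y j p) * cf Z k p)"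
    unfolding g_cf[OF conn_VF[OF V(1,2)] V(3)]
    using V by (intro sum.cong) (simp_all add: cf_conn distrib_right)
  then show ?thesis by (simp only: sum.distrib sum_lincomb_coeffs[OF t])
qed

lemma d\<omega>_eq: "X \<in> VF \<Longrightarrow> Y \<in> VF \<Longrightarrow> Z \<in> VF \<Longrightarrow> ext_d \<omega> [X, Y, Z] p = complex_of_real (s *
     (cf X 5 p * \<omega>c (comp Y p) (comp Z p) - cf Y 5 p * \<omega>c (comp X p) (comp Z p)
       + cf Z 5 p * \<omega>c (comp X p) (comp Y p)))"
  using d\<omega>_VF[of X Y Z p] \<Psi>_trace by (simp add: s_def)

lemma gc_gauduchon: "gauduchon_connection G J g \<tau> (conn (gc \<tau>))"
  unfolding gauduchon_connection_def Let_def \<omega>_def[symmetric]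
proof (intro conjI exI[of _ "conn lc"] ballI allI lc_levi_civita conn_affine)
  fix X Y Z p assume V: "X \<in> VF" "Y \<in> VF" "Z \<in> VF"
  note JV = J_VF[OF V(1)] J_VF[OF V(2)] J_VF[OF V(3)]
  show "g (conn (gc \<tau>) X Y) Z p = g (conn lc X Y) Z p
      + (1 - \<tau>) / 4 * Re (ext_d \<omega> [J X, J Y, J Z] p) + (1 + \<tau>) / 4 * - Re (ext_d \<omega> [J X, Y, Z] p)"
    unfolding gc_def lc_def g_conn[OF trilinear_gauduchon_form V] g_conn[OF trilinear_lc_form V]
      d\<omega>_eq[OF JV] d\<omega>_eq[OF JV(1) V(2,3)] Re_complex_of_real \<omega>c_def cf_J[OF V(1)] cf_J[OF V(2)] cf_J[OF V(3)]
      gauduchon_form_eq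
    by (simp del: One_nat_def)
qed

lemma curvature_frame:
  assumes V: "X \<in> VF" "Y \<in> VF" and ij: "i < j" "j < 6"
  shows "g (curvature (conn (gc \<tau>)) X Y (e i)) (e j) p
    = curv_entry s \<tau> ((1 - \<tau>) / 4 * s) i j (comp X p) (comp Y p)"
proof -
  have bc: "lincomb a (bracket_comp x y) i j = lincomb a (ad_bracket s u v q w x y) i j" for a x y
    unfolding lincomb_def by (intro sum.cong) (simp_all add: bracket_comp_eq)
  show ?thesis
    unfolding conn_curvature[OF V less_trans[OF ij] ij(2)] bc gc_def lincomb_coeffs[OF trilinear_gauduchon_form]
    by (rule curvature_entries[OF ij refl])
qed

text \<open>For \<open>i < j\<close> the trace uses the \<open>e i\<close> component of
  \<open>R (e j)\<close>, the transpose of the entry in \<open>curv_entry\<close>. The connection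
  matrices are skew, so the two differ by a sign, which squares away.\<close>

lemma g_skew_curvature:
  assumes V: "X \<in> VF" "Y \<in> VF" and ij: "i < j" "j < 6"
  shows "g (curvature (conn (gc \<tau>)) X Y (e j)) (e i) p
    = - curv_entry s \<tau> ((1 - \<tau>) / 4 * s) i j (comp X p) (comp Y p)"
proof -
  have skew: "lincomb (gc \<tau>) x i j = - lincomb (gc \<tau>) x j i" for x i j
    unfolding gc_def lincomb_coeffs[OF trilinear_gauduchon_form]
    by (simp add: gauduchon_form_def form_defs algebra_simps)
  have "g (curvature (conn (gc \<tau>)) X Y (e j)) (e i) p = - g (curvature (conn (gc \<tau>)) X Y (e i)) (e j) p"
    unfolding conn_curvature[OF V less_trans[OF ij] ij(2)] conn_curvature[OF V ij(2) less_trans[OF ij]]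
    unfolding skew[of _ j] skew[of _ _ i]
    by (simp add: sum_negf[symmetric] mult.commute)
  then show ?thesis using curvature_frame[OF assms] by simp
qed

lemma tr_curvature_zero:
  assumes "Xs \<in> vf_lists G 4"
  shows "tr_curvature_squared g (conn (gc \<tau>)) 6 e Xs p = 0"
proof -
  obtain X Y Z U where Xs: "Xs = [X, Y, Z, U]" and V: "X \<in> VF" "Y \<in> VF" "Z \<in> VF" "U \<in> VF"
    using assms by (rule vf_lists_4E)
  let ?R = "curv_entry s \<tau> ((1 - \<tau>) / 4 * s)"
  let ?x = "comp X p" and ?y = "comp Y p" and ?z = "comp Z p" and ?u = "comp U p"
  have C: "curvature_form g (conn (gc \<tau>)) e i j [A, B] p = complex_of_real (- ?R i j (comp A p) (comp B p))"
    if "A \<in> VF" "B \<in> VF" "i < j" "j < 6" for A B i j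
    using that by (simp add: curvature_form_def g_skew_curvature)
  have W: "wedge 2 2 (curvature_form g (conn (gc \<tau>)) e i j) (curvature_form g (conn (gc \<tau>)) e i j) Xs p
      = 2 * complex_of_real (?R i j ?x ?y * ?R i j ?z ?u - ?R i j ?x ?z * ?R i j ?y ?u + ?R i j ?x ?u * ?R i j ?y ?z)"
    if ij: "i < j" "j < 6" for i j
  proof -
    let ?C = "curvature_form g (conn (gc \<tau>)) e i j"
    have sk: "?C [A, B] p = - ?C [B, A] p" if "A \<in> {X, Y, Z, U}" "B \<in> {X, Y, Z, U}" for A B
    proof -
      have "A \<in> VF" "B \<in> VF" using that V by auto
      then show ?thesis using ij curv_entry_swap[OF ij, of s \<tau> _ "comp A p" "comp B p"] by (simp add: C)
    qed
    have "wedge 2 2 ?C ?C [X, Y, Z, U] p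
        = 2 * (?C [X, Y] p * ?C [Z, U] p - ?C [X, Z] p * ?C [Y, U] p + ?C [X, U] p * ?C [Y, Z] p)"
      by (rule wedge_2_2) (rule sk)
    then show ?thesis unfolding Xs using V ij by (simp add: C)
  qed
  have "tr_curvature_squared g (conn (gc \<tau>)) 6 e Xs p
      = (\<Sum>j<6. \<Sum>i<j. wedge 2 2 (curvature_form g (conn (gc \<tau>)) e i j) (curvature_form g (conn (gc \<tau>)) e i j) Xs p)"
  proof -
    have ap: "(\<Sum>i\<in>I. F i :: 'g form) Xs p = (\<Sum>i\<in>I. F i Xs p)" for I :: "nat set" and F
      by (induction I rule: infinite_finite_induct) auto
    show ?thesis by (simp add: tr_curvature_squared_def ap)
  qed
  also have "\<dots> = (\<Sum>j<6. \<Sum>i<j. 2 * complex_of_real (?R i j ?x ?y * ?R i j ?z ?u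
      - ?R i j ?x ?z * ?R i j ?y ?u + ?R i j ?x ?u * ?R i j ?y ?z))"
    by (intro sum.cong refl) (simp add: W)
  also have "\<dots> = 2 * complex_of_real (\<Sum>j<6. \<Sum>i<j. ?R i j ?x ?y * ?R i j ?z ?u
      - ?R i j ?x ?z * ?R i j ?y ?u + ?R i j ?x ?u * ?R i j ?y ?z)"
    by (simp only: of_real_sum sum_distrib_left)
  also have "\<dots> = 0" unfolding curvature_identity by simp
  finally show ?thesis .
qed

section \<open>The Dolbeault term\<close>

definition om where "om Y Z = g (J Y) Z"

lemma om_eq: "X \<in> VF \<Longrightarrow> Y \<in> VF \<Longrightarrow> om X Y p = \<omega>c (comp X p) (comp Y p)"
  using \<omega>_eq[of X Y p] by (simp add: om_def \<omega>_def fundamental_form_def)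

lemma om_smooth: "X \<in> VF \<Longrightarrow> Y \<in> VF \<Longrightarrow> smooth_fun G (om X Y)"
  by (simp add: om_def g_smooth J_VF)

lemma d_om:
  assumes "X \<in> VF" "Y \<in> VF" "Z \<in> VF"
  shows "X (om Y Z) p - Y (om X Z) p + Z (om X Y) p
      - om (lie_bracket X Y) Z p + om (lie_bracket X Z) Y p - om (lie_bracket Y Z) X p
    = s * (cf X 5 p * om Y Z p - cf Y 5 p * om X Z p + cf Z 5 p * om X Y p)"
proof -
  have "\<omega> [A, B] = (\<lambda>p. complex_of_real (om A B p))" for A B
    by (simp add: \<omega>_def om_def fundamental_form_def)
  then have "Re (ext_d \<omega> [X, Y, Z] p) = X (om Y Z) p - Y (om X Z) p + Z (om X Y) p
      - om (lie_bracket X Y) Z p + om (lie_bracket X Z) Y p - om (lie_bracket Y Z) X p"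
    by (simp add: ext_d_3 vf_apply_def)
  then show ?thesis using assms by (simp add: d\<omega>_eq om_eq)
qed

text \<open>The real 3-form \<open>e\<^sup>k \<and> \<omega>\<close>; for \<open>k = 5\<close> and
  \<open>k = 0\<close> these supply the real and imaginary parts of
  \<open>delbar J 1 1 \<omega>\<close>.\<close>

definition cfO :: "nat \<Rightarrow> 'g vf \<Rightarrow> 'g vf \<Rightarrow> 'g vf \<Rightarrow> 'g \<Rightarrow> real" where
  "cfO k X Y Z = (\<lambda>p. cf X k p * om Y Z p - cf Y k p * om X Z p + cf Z k p * om X Y p)"

lemma cfO_smooth: "k < 6 \<Longrightarrow> X \<in> VF \<Longrightarrow> Y \<in> VF \<Longrightarrow> Z \<in> VF \<Longrightarrow> smooth_fun G (cfO k X Y Z)"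
  unfolding cfO_def by (intro smooth_add smooth_diff smooth_mult cf_smooth om_smooth)

lemma derivation_cfO:
  assumes V: "X \<in> VF" "Y \<in> VF" "Z \<in> VF" "U \<in> VF" and k: "k < 6"
  shows "X (cfO k Y Z U) p = cf Y k p * X (om Z U) p + om Z U p * X (cf Y k) p
     - (cf Z k p * X (om Y U) p + om Y U p * X (cf Z k) p)
     + (cf U k p * X (om Y Z) p + om Y Z p * X (cf U k) p)"
proof -
  note D = vector_fields_derivation[OF V(1)]
  show ?thesis unfolding cfO_def using V k
    by (simp add: derivation_add[OF D] derivation_diff[OF D] derivation_mult[OF D] smooth_mult smooth_diff cf_smooth om_smooth)
qed

text \<open>The Leibniz rule \<open>d (e\<^sup>k \<and> \<omega>) = de\<^sup>k \<and> \<omega> -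
  e\<^sup>k \<and> d\<omega>\<close>, spelled out as six terms and then four. For
  \<open>k = 5\<close> both parts vanish; for \<open>k = 0\<close> they cancel.\<close>

lemma d_cfO:
  assumes V: "X \<in> VF" "Y \<in> VF" "Z \<in> VF" "U \<in> VF" and k: "k = 0 \<or> k = 5"
  shows "X (cfO k Y Z U) p - Y (cfO k X Z U) p + Z (cfO k X Y U) p - U (cfO k X Y Z) p
    - cfO k (lie_bracket X Y) Z U p + cfO k (lie_bracket X Z) Y U p - cfO k (lie_bracket Y Z) X U p
    - cfO k (lie_bracket X U) Y Z p + cfO k (lie_bracket Y U) X Z p - cfO k (lie_bracket Z U) X Y p = 0"
proof -
  have k6: "k < 6" using k by auto
  \<comment> \<open>The exterior derivative of the coframe: derivative terms drop out and the
    algebraic bracket remains.\<close>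
  have th: "A (cf B k) p - B (cf A k) p - cf (lie_bracket A B) k p = - ad_bracket s u v q w (comp A p) (comp B p) k"
    if "A \<in> VF" "B \<in> VF" for A B
    using cf_bracket[OF that k6] bracket_comp_eq[OF k6] by simp
  have "X (cfO k Y Z U) p - Y (cfO k X Z U) p + Z (cfO k X Y U) p - U (cfO k X Y Z) p
    - cfO k (lie_bracket X Y) Z U p + cfO k (lie_bracket X Z) Y U p - cfO k (lie_bracket Y Z) X U p
    - cfO k (lie_bracket X U) Y Z p + cfO k (lie_bracket Y U) X Z p - cfO k (lie_bracket Z U) X Y p
   = (X (cf Y k) p - Y (cf X k) p - cf (lie_bracket X Y) k p) * om Z U p
   - (X (cf Z k) p - Z (cf X k) p - cf (lie_bracket X Z) k p) * om Y U p
   + (X (cf U k) p - U (cf X k) p - cf (lie_bracket X U) k p) * om Y Z p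
   + (Y (cf Z k) p - Z (cf Y k) p - cf (lie_bracket Y Z) k p) * om X U p
   - (Y (cf U k) p - U (cf Y k) p - cf (lie_bracket Y U) k p) * om X Z p
   + (Z (cf U k) p - U (cf Z k) p - cf (lie_bracket Z U) k p) * om X Y p
   - cf X k p * (Y (om Z U) p - Z (om Y U) p + U (om Y Z) p
      - om (lie_bracket Y Z) U p + om (lie_bracket Y U) Z p - om (lie_bracket Z U) Y p)
   + cf Y k p * (X (om Z U) p - Z (om X U) p + U (om X Z) p
      - om (lie_bracket X Z) U p + om (lie_bracket X U) Z p - om (lie_bracket Z U) X p)
   - cf Z k p * (X (om Y U) p - Y (om X U) p + U (om X Y) p
      - om (lie_bracket X Y) U p + om (lie_bracket X U) Y p - om (lie_bracket Y U) X p)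
   + cf U k p * (X (om Y Z) p - Y (om X Z) p + Z (om X Y) p
      - om (lie_bracket X Y) Z p + om (lie_bracket X Z) Y p - om (lie_bracket Y Z) X p)"
    unfolding derivation_cfO[OF V k6] derivation_cfO[OF V(2,1,3,4) k6] derivation_cfO[OF V(3,1,2,4) k6]
      derivation_cfO[OF V(4,1,2,3) k6]
    by (simp add: cfO_def algebra_simps)
  also have "\<dots> = 0"
    unfolding th[OF V(1,2)] th[OF V(1,3)] th[OF V(1,4)] th[OF V(2,3)] th[OF V(2,4)] th[OF V(3,4)]
      d_om[OF V(2,3,4)] d_om[OF V(1,3,4)] d_om[OF V(1,2,4)] d_om[OF V(1,2,3)]
    using k by (elim disjE; simp add: ad_bracket_simps; simp add: algebra_simps)
  finally show ?thesis .
qed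

text \<open>As \<open>\<omega>\<close> has type (1,1), the (1,2) part of
  \<open>s e\<^sup>5 \<and> \<omega>\<close> involves just the (0,1) part of
  \<open>e\<^sup>5\<close>, which is \<open>(e\<^sup>5 + \<i> e\<^sup>0) / 2\<close> because
  \<open>e\<^sup>5 \<circ> J = e\<^sup>0\<close>. Separating real and imaginary parts suits
  \<open>vf_apply\<close>, which differentiates them separately.\<close>

lemma delbar_\<omega>:
  assumes V: "X \<in> VF" "Y \<in> VF" "Z \<in> VF"
  shows "delbar J 1 1 \<omega> [X, Y, Z] = (\<lambda>p. Complex (s / 2 * cfO 5 X Y Z p) (s / 2 * cfO 0 X Y Z p))"
proof
  fix p
  note JV = J_VF[OF V(1)] J_VF[OF V(2)] J_VF[OF V(3)]
  have "delbar J 1 1 \<omega> [X, Y, Z] p = type_part J 1 2 (ext_d \<omega>) [X, Y, Z] p"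
    by (simp add: delbar_def numeral_2_eq_2)
  also have "\<dots> = Complex (s / 2 * cfO 5 X Y Z p) (s / 2 * cfO 0 X Y Z p)"
    unfolding type_part_1_2 d\<omega>_eq[OF V] d\<omega>_eq[OF JV(1) V(2,3)] d\<omega>_eq[OF V(1) JV(2) V(3)]
      d\<omega>_eq[OF V(1,2) JV(3)] d\<omega>_eq[OF JV(1,2) V(3)] d\<omega>_eq[OF JV(1) V(2) JV(3)] d\<omega>_eq[OF V(1) JV(2,3)] d\<omega>_eq[OF JV]
      cfO_def om_eq[OF V(1,2)] om_eq[OF V(1,3)] om_eq[OF V(2,3)] \<omega>c_def cf_J[OF V(1)] cf_J[OF V(2)] cf_J[OF V(3)]
    by (simp add: complex_eq_iff del: One_nat_def) (simp add: field_simps)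
  finally show "delbar J 1 1 \<omega> [X, Y, Z] p = Complex (s / 2 * cfO 5 X Y Z p) (s / 2 * cfO 0 X Y Z p)" .
qed

lemma d_delbar_\<omega>: "form_eq G 4 (ext_d (delbar J 1 1 \<omega>)) 0"
  unfolding form_zeroI
proof (intro ballI allI)
  fix Xs p assume "Xs \<in> vf_lists G 4"
  then obtain X Y Z U where Xs: "Xs = [X, Y, Z, U]" and V: "X \<in> VF" "Y \<in> VF" "Z \<in> VF" "U \<in> VF"
    by (rule vf_lists_4E)
  have ap: "vf_apply A (delbar J 1 1 \<omega> [B, C, D]) p
      = Complex (s / 2 * A (cfO 5 B C D) p) (s / 2 * A (cfO 0 B C D) p)"
    if "A \<in> VF" "B \<in> VF" "C \<in> VF" "D \<in> VF" for A B C D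
  proof -
    have "A (\<lambda>q. s / 2 * cfO k B C D q) = (\<lambda>q. s / 2 * A (cfO k B C D) q)" if "k < 6" for k
      using \<open>A \<in> VF\<close> cfO_smooth[OF that \<open>B \<in> VF\<close> \<open>C \<in> VF\<close> \<open>D \<in> VF\<close>]
      by (intro derivation_scale vector_fields_derivation)
    then show ?thesis
      unfolding vf_apply_def delbar_\<omega>[OF that(2-4)] complex.sel by simp
  qed
  have "ext_d (delbar J 1 1 \<omega>) Xs p = Complex
     (s / 2 * (X (cfO 5 Y Z U) p - Y (cfO 5 X Z U) p + Z (cfO 5 X Y U) p - U (cfO 5 X Y Z) p
    - cfO 5 (lie_bracket X Y) Z U p + cfO 5 (lie_bracket X Z) Y U p - cfO 5 (lie_bracket Y Z) X U p
    - cfO 5 (lie_bracket X U) Y Z p + cfO 5 (lie_bracket Y U) X Z p - cfO 5 (lie_bracket Z U) X Y p))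
     (s / 2 * (X (cfO 0 Y Z U) p - Y (cfO 0 X Z U) p + Z (cfO 0 X Y U) p - U (cfO 0 X Y Z) p
    - cfO 0 (lie_bracket X Y) Z U p + cfO 0 (lie_bracket X Z) Y U p - cfO 0 (lie_bracket Y Z) X U p
    - cfO 0 (lie_bracket X U) Y Z p + cfO 0 (lie_bracket Y U) X Z p - cfO 0 (lie_bracket Z U) X Y p))"
    unfolding Xs ext_d_4 ap[OF V] ap[OF V(2,1,3,4)] ap[OF V(3,1,2,4)] ap[OF V(4,1,2,3)]
    using V by (simp add: delbar_\<omega> bracket_VF del: One_nat_def) (simp add: complex_eq_iff algebra_simps)
  then show "ext_d (delbar J 1 1 \<omega>) Xs p = 0"
    using d_cfO[OF V, of 5 p] d_cfO[OF V, of 0 p] by (simp add: complex_eq_iff)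
qed

lemma constant_solution: "anomaly_flow_solution G J \<Psi> \<tau> \<alpha>' g UNIV (\<lambda>t. g)"
  unfolding anomaly_flow_solution_def
proof (intro conjI ballI exI[of _ "conn (gc \<tau>)"] exI[of _ e] allI gc_gauduchon frame_orthonormal hermitian)
  fix t :: real and Xs p assume Xs: "Xs \<in> vf_lists G 4"
  \<comment> \<open>\<open>del J 1 2\<close> takes the type component \<open>(Suc 1, 2)\<close>; its
    total degree has to be recognised as 4.\<close>
  have 4: "Suc 1 + 2 = (4::nat)" by simp
  have "del J 1 2 (delbar J 1 1 \<omega>) Xs p = 0"
    unfolding del_def
    using Xs d_delbar_\<omega> by (intro type_part_zero) (simp_all only: 4)
  then show "((\<lambda>s. complex_of_real (form_norm G J g \<Psi> p) *
       wedge 2 2 (fundamental_form J g) (fundamental_form J g) Xs p) has_vector_derivative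
       \<i> * del J 1 2 (delbar J 1 1 (fundamental_form J g)) Xs p -
       complex_of_real (\<alpha>' / 4) * tr_curvature_squared g (conn (gc \<tau>)) 6 e Xs p) (at t within UNIV)"
    using tr_curvature_zero[OF Xs] by (simp add: \<omega>_def)
qed simp_all

end

theorem theorem6p6:
  fixes G :: "('g::{t2_space, second_countable_topology}, 'n::finite) lie_group_data"
    and J :: "'g vf \<Rightarrow> 'g vf"
    and \<Psi> :: "'g form"
    and g\<^sub>0 :: "'g metric"
    and \<tau> \<alpha>' :: real
  assumes "lie_group G"
    and "lie_group_dim G = 6"
    and "almost_abelian G"
    and "left_invariant_complex_structure G J"
    and "has_type G J 3 0 \<Psi>"
    and "left_invariant_form G 3 \<Psi>"
    and "nowhere_vanishing G 3 \<Psi>"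
    and "closed_form G 3 \<Psi>"
    and "lck_metric G J g\<^sub>0"
    and "left_invariant_metric G g\<^sub>0"
  shows "anomaly_flow_solution G J \<Psi> \<tau> \<alpha>' g\<^sub>0 UNIV (\<lambda>t. g\<^sub>0)"
proof -
  interpret H: invariant_hermitian G J g\<^sub>0
    by unfold_locales (use assms lck_metric_def in auto)
  obtain I where I: "I \<subseteq> lie_algebra G" "vf.subspace I"
      "\<And>X Y. X \<in> lie_algebra G \<Longrightarrow> Y \<in> I \<Longrightarrow> lie_bracket X Y \<in> I"
      "\<And>X Y. X \<in> I \<Longrightarrow> Y \<in> I \<Longrightarrow> lie_bracket X Y = 0" "vf.dim I + 1 = vf.dim (lie_algebra G)"
    using assms(3) unfolding almost_abelian_def by blast
  have dim6: "vf.dim (lie_algebra G) = 6" using assms(2) by (simp add: lie_group_dim_def)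
  obtain e where e: "\<forall>i<6. e i \<in> lie_algebra G" "\<forall>i<6. \<forall>j<6. H.ip (e i) (e j) = (if i = j then 1 else 0)"
      "lie_algebra G \<subseteq> vf.span (e ` {..<6::nat})" "J (e 0) = e 5" "J (e 1) = e 2" "J (e 3) = e 4"
      "\<forall>i<5. e i \<in> I" "\<forall>X\<in>I. H.ip X (e 5) = 0"
    using H.adapted_frame_exists[OF dim6 I(1,2,5)] by (elim exE conjE) (rule that; assumption)
  interpret K: orthonormal_invariant_frame G J g\<^sub>0 e
    by unfold_locales (use e in auto)
  interpret adapted_frame G J g\<^sub>0 e \<Psi>
  proof unfold_locales
    \<comment> \<open>The bracket of \<open>e 5\<close> with a vector of the ideal stays in the
      ideal, to which \<open>e 5\<close> is normal.\<close>
    show "K.str 5 i 5 = 0" if "i < 5" for i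
      unfolding K.str_def using that e(1,7,8) I(3) by simp
  qed (use assms e I in auto)
  show ?thesis by (rule constant_solution)
qed

end
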